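(* Let $d=2n$ be even and let $A$ be a $d\times d$ Cotlar matrix. Let $B_t$ be standard $d$-dimensional Brownian motion with its natural filtration, $K_s\in\mathbb{R}^d$ predictable with $\mathbb{E}\int_0^t|K_s|^2ds<\infty$ for all $t$, and $M_t=\int_0^tK_s\cdot dB_s$. Then for all $t\ge0$, \[ \|A*M_t\|_p\le\cot\Big(\frac{\pi}{2p^*}\Big)\|M_t\|_p\quad\text{for } p=2^k \text{ or } p=\frac{2^k}{2^k-1},\ k\in\mathbb{N}. \]
   Context: A real $d\times d$ matrix $A$ ($d$ even) is a Cotlar matrix if $Av\cdot v=0$ for all $v\in\mathbb{R}^d$ and $A^2=-I$. The martingale transform of $M$ by $A$ is $A*M_t=\int_0^tAK_s\cdot dB_s$. $\|\cdot\|_p$ is the $L^p(\mathbb{P})$ norm, and $p^*=\max\{p,p/(p-1)\}$. *)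

theory Defs
  imports "HOL-Probability.Probability"
begin

definition cotlar_matrix :: "real^'n^'n \<Rightarrow> bool" where
  "cotlar_matrix A \<longleftrightarrow> (\<forall>v. (A *v v) \<bullet> v = 0) \<and> A ** A = - mat 1"

definition std_brownian :: "'a measure \<Rightarrow> (real \<Rightarrow> 'a \<Rightarrow> real^'n) \<Rightarrow> bool" where
  "std_brownian M B \<longleftrightarrow> prob_space M
     \<and> (\<forall>t. B t \<in> borel_measurable M)
     \<and> (\<forall>\<omega>\<in>space M. B 0 \<omega> = 0 \<and> continuous_on {0..} (\<lambda>t. B t \<omega>))
     \<and> (\<forall>s t i. 0 \<le> s \<and> s < t \<longrightarrow>
          distributed M lborel (\<lambda>\<omega>. (B t \<omega> - B s \<omega>) $ i)
            (\<lambda>x. ennreal (normal_density 0 (sqrt (t - s)) x)))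
     \<and> (\<forall>(k::nat) (ts::nat \<Rightarrow> real). 0 \<le> ts 0 \<and> (\<forall>j<k. ts j \<le> ts (Suc j)) \<longrightarrow>
          prob_space.indep_vars M (\<lambda>_. borel)
            (\<lambda>(j, i) \<omega>. (B (ts (Suc j)) \<omega> - B (ts j) \<omega>) $ i) ({..<k} \<times> (UNIV :: 'n set)))"

definition nat_filtration :: "'a measure \<Rightarrow> (real \<Rightarrow> 'a \<Rightarrow> real^'n) \<Rightarrow> real \<Rightarrow> 'a measure" where
  "nat_filtration M B t = sigma (space M)
     {B s -` U \<inter> space M | s U. 0 \<le> s \<and> s \<le> t \<and> U \<in> sets borel}"

definition predictable_sigma :: "'a measure \<Rightarrow> (real \<Rightarrow> 'a measure) \<Rightarrow> (real \<times> 'a) measure" where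
  "predictable_sigma M F = sigma ({0..} \<times> space M)
     ({{s<..t} \<times> S | s t S. 0 \<le> s \<and> s \<le> t \<and> S \<in> sets (F s)}
      \<union> {{0} \<times> S | S. S \<in> sets (F 0)})"

definition elem_proc ::
  "'a measure \<Rightarrow> (real \<Rightarrow> 'a measure) \<Rightarrow> nat \<Rightarrow> (nat \<Rightarrow> real) \<Rightarrow> (nat \<Rightarrow> 'a \<Rightarrow> real^'n) \<Rightarrow> bool" where
  "elem_proc M F k ts \<xi> \<longleftrightarrow> 0 \<le> ts 0 \<and> (\<forall>j<k. ts j \<le> ts (Suc j))
     \<and> (\<forall>j<k. \<xi> j \<in> borel_measurable (F (ts j)) \<and> bounded (\<xi> j ` space M))"

definition elem_fun :: "nat \<Rightarrow> (nat \<Rightarrow> real) \<Rightarrow> (nat \<Rightarrow> 'a \<Rightarrow> real^'n) \<Rightarrow> real \<Rightarrow> 'a \<Rightarrow> real^'n" where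
  "elem_fun k ts \<xi> s \<omega> = (\<Sum>j<k. if ts j < s \<and> s \<le> ts (Suc j) then \<xi> j \<omega> else 0)"

definition elem_int ::
  "(real \<Rightarrow> 'a \<Rightarrow> real^'n) \<Rightarrow> nat \<Rightarrow> (nat \<Rightarrow> real) \<Rightarrow> (nat \<Rightarrow> 'a \<Rightarrow> real^'n) \<Rightarrow> real \<Rightarrow> 'a \<Rightarrow> real" where
  "elem_int B k ts \<xi> t \<omega> =
     (\<Sum>j<k. \<xi> j \<omega> \<bullet> (B (min t (ts (Suc j))) \<omega> - B (min t (ts j)) \<omega>))"

definition ito_integral ::
  "'a measure \<Rightarrow> (real \<Rightarrow> 'a \<Rightarrow> real^'n) \<Rightarrow> (real \<Rightarrow> 'a \<Rightarrow> real^'n) \<Rightarrow> real \<Rightarrow> ('a \<Rightarrow> real) \<Rightarrow> bool" where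
  "ito_integral M B K t X \<longleftrightarrow> X \<in> borel_measurable M \<and>
     (\<exists>(k::nat \<Rightarrow> nat) (ts::nat \<Rightarrow> nat \<Rightarrow> real) (\<xi>::nat \<Rightarrow> nat \<Rightarrow> 'a \<Rightarrow> real^'n).
        (\<forall>m. elem_proc M (nat_filtration M B) (k m) (ts m) (\<xi> m))
      \<and> (\<lambda>m. \<integral>\<^sup>+\<omega>. (\<integral>\<^sup>+s\<in>{0..t}. ennreal ((norm (elem_fun (k m) (ts m) (\<xi> m) s \<omega> - K s \<omega>))\<^sup>2) \<partial>lborel) \<partial>M)
          \<longlonglongrightarrow> 0
      \<and> (\<lambda>m. \<integral>\<^sup>+\<omega>. ennreal ((elem_int B (k m) (ts m) (\<xi> m) t \<omega> - X \<omega>)\<^sup>2) \<partial>M) \<longlonglongrightarrow> 0)"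

definition pstar :: "real \<Rightarrow> real" where
  "pstar p = max p (p / (p - 1))"

end

theory Submission
  imports Defs "HOL-Real_Asymp.Real_Asymp"
begin

text \<open>
  Since \<open>A v\<close> is orthogonal to \<open>v\<close> and of the same length, \<open>Z = X + \<i> Y\<close> is a conformal martingale: given the
  past, its increments are isotropic Gaussians in the plane.

  For \<open>p = 2\<^sup>k\<close> this gives \<open>E Re Z\<^sup>p = 0\<close>, and the inequality follows from this single identity by Cotlar's
  induction \<open>Z \<mapsto> Z\<^sup>2\<close>. As \<open>Z\<close> need not be in \<open>L\<^sup>p\<close> a priori, it is stopped on leaving a large disc, on a grid
  so fine that the overshoot is negligible; the stopped \<open>X\<close> is compared with \<open>X\<close> through the tangent
  inequality of \<open>x\<^sup>p\<close>.

  For \<open>1 < p < 2\<close>, Essen's inequality bounds \<open>\<bar>y\<bar>\<^sup>p - tan (pi / 2 p)\<^sup>p \<bar>x\<bar>\<^sup>p\<close> by \<open>- c Re (\<bar>x\<bar> + \<i> y)\<^sup>p\<close>, and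
  \<open>Re (\<bar>x\<bar> + \<i> y)\<^sup>p\<close> is a mixture over \<open>s > 0\<close>, with weights \<open>s\<^sup>-\<^sup>p\<^sup>-\<^sup>1\<close>, of the subharmonic functions
  \<open>exp (- s \<bar>x\<bar>) cos (s y) + s \<bar>x\<bar> - 1\<close>, which have linear growth.
\<close>

section \<open>Cotlar's doubling argument and the trigonometric inequality\<close>

text \<open>Given the past, one cell of a time grid is a single Gaussian average, so Fubini's
  theorem takes the place of Ito calculus; \<open>X\<close> and \<open>Y\<close> are reached by a
  limit. For p = 2^k the obstacle is that elementary integrals converge to \<open>X\<close> only in
  L^2: their p-th moments need not converge, and \<open>X\<close> can be compared with them only
  under bounded weights. Hence three cut-offs: the disc of radius \<open>R\<close>, a clamp of the
  stopped real part, a truncation of |Y| at \<open>a\<close>. The order of limits is forced. The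
  overshoot error contains the bound of the elementary process, so the mesh shrinks first with that
  process fixed; then the approximation index grows, then \<open>R\<close>, then \<open>a\<close>.
  For p < 2, duality with p / (p - 1) would require test variables that are themselves stochastic
  integrals; an argument for all 1 < p < 2 avoids this. There L^2 makes p-th moments finite, and
  linear growth lets the mean inequality of the subharmonic functions pass to the limit without
  truncation. The constant is the expected one because pi / (2 p) and pi / (2 q) are complementary
  angles for the conjugate exponent q = p / (p - 1).\<close>

lemma power_split_le:
  fixes u v C D :: real
  assumes q: "even q" "q > 0" and C: "C > 0" and D: "D > 0" and quad: "D\<^sup>2 = 1 + 2 * C * D"
  shows "(v\<^sup>2) ^ q \<le> D ^ (2 * q - 2) * (u\<^sup>2) ^ q + (D / (2 * C)) ^ (q - 1) * (u\<^sup>2 - v\<^sup>2) ^ q"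
proof -
  \<comment> \<open>v^2 is the mean, with weights \<open>l\<close> and \<open>1 - l\<close>, of u^2
    / l and (v^2 - u^2) / (1 - l), and x^q is convex. For \<open>l\<close> = D^(-2) the two points
    coincide when |v| = D |u|, the extremal ray of the inequality to be proved, so nothing is lost
    there.\<close>
  define l where "l = 1 / D\<^sup>2"
  have l: "0 < l" "1 - l = 2 * C / D" "0 < 1 - l"
  proof -
    show "0 < l" using D by (simp add: l_def)
    show e: "1 - l = 2 * C / D"
    proof -
      have "D\<^sup>2 - 1 = 2 * C * D" using quad by simp
      then have "(D\<^sup>2 - 1) / D\<^sup>2 = 2 * C * D / D\<^sup>2" by simp
      then show ?thesis using D unfolding l_def by (simp add: diff_divide_distrib power2_eq_square)
    qed
    show "0 < 1 - l" unfolding e using C D by simp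
  qed
  have conv: "convex_on UNIV (\<lambda>x::real. x ^ q)"
    using q by (intro convex_power_even)
  have "(v\<^sup>2) ^ q = ((1 - (1 - l)) *\<^sub>R (u\<^sup>2 / l) + (1 - l) *\<^sub>R ((v\<^sup>2 - u\<^sup>2) / (1 - l))) ^ q"
    using l(1,3) by simp
  also have "\<dots> \<le> (1 - (1 - l)) * (u\<^sup>2 / l) ^ q + (1 - l) * ((v\<^sup>2 - u\<^sup>2) / (1 - l)) ^ q"
    using l by (intro convex_onD[OF conv]) auto
  also have "(1 - (1 - l)) * (u\<^sup>2 / l) ^ q = (1 / l) ^ (q - 1) * (u\<^sup>2) ^ q"
    using l(1) q(2) by (cases q) (auto simp: power_divide)
  also have "(1 / l) ^ (q - 1) = D ^ (2 * q - 2)"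
    unfolding l_def diff_mult_distrib2[of 2 q 1, simplified, symmetric] power_mult by simp
  also have "(1 - l) * ((v\<^sup>2 - u\<^sup>2) / (1 - l)) ^ q = (1 / (1 - l)) ^ (q - 1) * (u\<^sup>2 - v\<^sup>2) ^ q"
  proof -
    have "(v\<^sup>2 - u\<^sup>2) ^ q = (u\<^sup>2 - v\<^sup>2) ^ q"
      using q(1) by (metis minus_diff_eq power_minus_even)
    then show ?thesis
      using l(3) q(2) by (cases q) (auto simp: power_divide)
  qed
  finally show ?thesis
    by (simp add: l(2))
qed

text \<open>The arithmetic-geometric mean inequality, weighted so that equality holds for |v| = D
  |u|. This is the ray on which the convexity estimate is sharp, which is why the two combine
  without loss in the constant.\<close>

lemma power_mult_le_mean:
  fixes u v D :: real
  assumes "D > 0"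
  shows "\<bar>u * v\<bar> ^ q \<le> (D ^ q * (u\<^sup>2) ^ q + (v\<^sup>2) ^ q / D ^ q) / 2"
proof -
  define P Q E where "P = \<bar>u\<bar> ^ q" and "Q = \<bar>v\<bar> ^ q" and "E = D ^ q"
  have E: "E > 0" using assms by (simp add: E_def)
  have "0 \<le> (E * P - Q)\<^sup>2 / E"
    using E by simp
  also have "\<dots> = E * P\<^sup>2 + Q\<^sup>2 / E - 2 * (P * Q)"
    using E by (simp add: power2_eq_square field_simps)
  finally have "P * Q \<le> (E * P\<^sup>2 + Q\<^sup>2 / E) / 2" by simp
  moreover have "P\<^sup>2 = (u\<^sup>2) ^ q" "Q\<^sup>2 = (v\<^sup>2) ^ q"
    by (simp_all add: P_def Q_def power_mult[symmetric] mult.commute power_even_abs)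
  ultimately show ?thesis
    by (simp add: P_def Q_def E_def abs_mult power_mult_distrib)
qed

text \<open>With \<open>a\<close>, \<open>b\<close>, \<open>c\<close>, \<open>d\<close> the four
  integrals, convexity bounds \<open>b\<close> by \<open>a\<close> and \<open>c\<close>, the
  hypothesis bounds \<open>c\<close> by \<open>d\<close>, and the mean inequality bounds
  \<open>d\<close> by \<open>a\<close> and \<open>b\<close> again. The loop closes because
  \<open>b\<close> recurs with the factor C / D < 1, and the equation for \<open>D\<close> turns the
  resulting quotient into exactly D^(2q).\<close>

lemma cotlar_step:
  fixes U V :: "'a \<Rightarrow> real" and C D :: real
  assumes q: "even q" "q > 0" and C: "C > 0" and D: "D > 0" and quad: "D\<^sup>2 = 1 + 2 * C * D"
    and int: "integrable M (\<lambda>x. (U x) ^ (2 * q))" "integrable M (\<lambda>x. (V x) ^ (2 * q))"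
             "integrable M (\<lambda>x. ((U x)\<^sup>2 - (V x)\<^sup>2) ^ q)" "integrable M (\<lambda>x. (2 * U x * V x) ^ q)"
    and le: "(\<integral>x. ((U x)\<^sup>2 - (V x)\<^sup>2) ^ q \<partial>M) \<le> C ^ q * (\<integral>x. (2 * U x * V x) ^ q \<partial>M)"
  shows "(\<integral>x. (V x) ^ (2 * q) \<partial>M) \<le> D ^ (2 * q) * (\<integral>x. (U x) ^ (2 * q) \<partial>M)"
proof -
  define a b c d where "a = (\<integral>x. (U x) ^ (2 * q) \<partial>M)" and "b = (\<integral>x. (V x) ^ (2 * q) \<partial>M)"
    and "c = (\<integral>x. ((U x)\<^sup>2 - (V x)\<^sup>2) ^ q \<partial>M)" and "d = (\<integral>x. (2 * U x * V x) ^ q \<partial>M)"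
  obtain r where r: "q = Suc r" using q by (cases q) auto
  have "b \<le> (\<integral>x. D ^ (2 * q - 2) * (U x) ^ (2 * q) + (D / (2 * C)) ^ (q - 1) * ((U x)\<^sup>2 - (V x)\<^sup>2) ^ q \<partial>M)"
    unfolding b_def using power_split_le[OF q C D quad] int
    by (intro integral_mono) (auto simp: power_mult)
  also have "\<dots> = D ^ (2 * q - 2) * a + (D / (2 * C)) ^ (q - 1) * c"
    unfolding a_def c_def using int by simp
  finally have 1: "b \<le> D ^ (2 * q - 2) * a + (D / (2 * C)) ^ (q - 1) * c" .
  have "d \<le> (\<integral>x. 2 ^ q * ((D ^ q * (U x) ^ (2 * q) + (V x) ^ (2 * q) / D ^ q) / 2) \<partial>M)"
    unfolding d_def
  proof (intro integral_mono int)
    fix x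
    have "(2 * U x * V x) ^ q = 2 ^ q * \<bar>U x * V x\<bar> ^ q"
      using q(1) by (simp add: power_mult_distrib power_even_abs abs_mult)
    then show "(2 * U x * V x) ^ q \<le> 2 ^ q * ((D ^ q * (U x) ^ (2 * q) + (V x) ^ (2 * q) / D ^ q) / 2)"
      using power_mult_le_mean[OF D, of "U x" "V x" q] by (simp add: power_mult)
  qed (use int in auto)
  also have "\<dots> = 2 ^ q * ((D ^ q * a + b / D ^ q) / 2)"
    unfolding a_def b_def using int by simp
  finally have 2: "d \<le> 2 ^ q * ((D ^ q * a + b / D ^ q) / 2)" .
  have "b \<le> D ^ (2 * q - 2) * a + (D / (2 * C)) ^ (q - 1) * (C ^ q * (2 ^ q * ((D ^ q * a + b / D ^ q) / 2)))"
    using 1 2 le C D unfolding c_def[symmetric] d_def[symmetric]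
    by (smt (verit, best) divide_pos_pos mult_left_mono zero_le_power)
  also have "\<dots> = D ^ (2 * r) * (1 + C * D) * a + (C / D) * b"
    using C D unfolding r
    by (simp add: power_divide power_mult_distrib field_simps) (simp add: power_add[symmetric] mult_2 mult_2_right algebra_simps)
  \<comment> \<open>Moving \<open>b\<close> to the left is legitimate because it is a finite
    integral; for this reason the doubling argument is run on stopped processes.\<close>
  finally have "b * (1 - C / D) \<le> D ^ (2 * r) * (1 + C * D) * a"
    by (simp add: algebra_simps)
  moreover have "1 + C * D = D\<^sup>2 * (1 - C / D)"
  proof -
    have "D\<^sup>2 * (1 - C / D) = D\<^sup>2 - C * D" using D by (simp add: right_diff_distrib power2_eq_square)
    then show ?thesis using quad by simp
  qed
  moreover have "0 < 1 - C / D"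
    using D quad C
    by (smt (verit) calculation(2) mult_pos_pos zero_less_mult_pos zero_less_power)
  ultimately have "b \<le> D ^ (2 * r) * D\<^sup>2 * a"
    by (smt (verit, ccfv_threshold) mult.assoc mult.commute mult_le_cancel_right_pos)
  then show ?thesis
    unfolding a_def b_def r by (simp add: power_add[symmetric])
qed

lemma cot_double_quadratic:
  fixes x :: real
  assumes "0 < x" "x < pi / 2"
  shows "cot (x / 2) > 0" "cot x > 0" "(cot (x / 2))\<^sup>2 = 1 + 2 * cot x * cot (x / 2)"
proof -
  have s: "sin (x/2) > 0" "cos (x/2) > 0" "sin x > 0" "cos x > 0"
    using assms by (auto intro!: sin_gt_zero cos_gt_zero)
  then show "cot (x / 2) > 0" "cot x > 0"
    by (auto simp: cot_def)
  have sx: "sin x = 2 * sin (x/2) * cos (x/2)" "cos x = (cos (x/2))\<^sup>2 - (sin (x/2))\<^sup>2"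
    using sin_double[of "x/2"] cos_double[of "x/2"] by auto
  have "cos x = (cos (x/2))\<^sup>2 - (sin (x/2))\<^sup>2" by fact
  then show "(cot (x / 2))\<^sup>2 = 1 + 2 * cot x * cot (x / 2)"
    unfolding cot_def sx using s by (simp add: field_simps power2_eq_square)
qed

text \<open>Squaring \<open>U + \<i> V\<close> halves the exponent, and the constant \<open>D\<close> for \<open>2 q\<close> is the positive root of
  \<open>D\<^sup>2 = 1 + 2 C D\<close>, \<open>C\<close> the constant for \<open>q\<close>: this is the half-angle formula of the cotangent.\<close>

lemma cotlar_moment_bound:
  fixes U V :: "'a \<Rightarrow> real"
  assumes "k \<ge> 1"
    and [measurable]: "U \<in> borel_measurable M" "V \<in> borel_measurable M"
    and "integrable M (\<lambda>x. (U x) ^ (2 ^ k))" "integrable M (\<lambda>x. (V x) ^ (2 ^ k))"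
    and "(\<integral>x. Re ((Complex (U x) (V x)) ^ (2 ^ k)) \<partial>M) = 0"
  shows "(\<integral>x. (V x) ^ (2 ^ k) \<partial>M) \<le> cot (pi / (2 * 2 ^ k)) ^ (2 ^ k) * (\<integral>x. (U x) ^ (2 ^ k) \<partial>M)
       \<and> (\<integral>x. (U x) ^ (2 ^ k) \<partial>M) \<le> cot (pi / (2 * 2 ^ k)) ^ (2 ^ k) * (\<integral>x. (V x) ^ (2 ^ k) \<partial>M)"
  using assms
proof (induction k arbitrary: U V rule: nat_induct_at_least)
  case base
  note [measurable] = base(1,2)
  have "cot (pi / (2 * 2 ^ 1)) = 1"
    by (simp add: cot_def cos_45 sin_45)
  moreover have "Re ((Complex (U x) (V x)) ^ (2 ^ 1)) = (U x)\<^sup>2 - (V x)\<^sup>2" for x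
    by (simp add: power2_eq_square)
  then have "(\<integral>x. (U x)\<^sup>2 \<partial>M) - (\<integral>x. (V x)\<^sup>2 \<partial>M) = 0"
    using base by simp
  ultimately show ?case by simp
next
  case (Suc k)
  note [measurable] = Suc.prems(1,2)
  define q :: nat where "q = 2 ^ k"
  define x where "x = pi / (2 * real q)"
  have q: "even q" "q > 0" "q \<ge> 2"
    using Suc.hyps unfolding q_def by (auto intro: self_le_power)
  have q2: "2 ^ Suc k = 2 * q" by (simp add: q_def)
  have x: "0 < x" "x < pi / 2" "pi / (2 * 2 ^ Suc k) = x / 2"
    using q by (auto simp: x_def q_def field_simps)
  have intU: "integrable M (\<lambda>x. (U x) ^ (2 * q))" and intV: "integrable M (\<lambda>x. (V x) ^ (2 * q))"
    using Suc.prems unfolding q2 by auto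
  have intp: "integrable M (\<lambda>x. (2 * U x * V x) ^ q)"
  proof (rule Bochner_Integration.integrable_bound)
    show "integrable M (\<lambda>x. 2 ^ q * ((U x) ^ (2 * q) + (V x) ^ (2 * q)))"
      using intU intV by simp
    show "AE x in M. norm ((2 * U x * V x) ^ q) \<le> norm (2 ^ q * ((U x) ^ (2 * q) + (V x) ^ (2 * q)))"
    proof (rule AE_I2)
      fix x
      have "\<bar>U x * V x\<bar> ^ q \<le> (U x) ^ (2 * q) + (V x) ^ (2 * q)"
      proof -
        have "0 \<le> \<bar>U x * V x\<bar> ^ q" by simp
        moreover have "2 * \<bar>U x * V x\<bar> ^ q \<le> (U x) ^ (2 * q) + (V x) ^ (2 * q)"
          using power_mult_le_mean[of 1 "U x" "V x" q] by (simp add: power_mult)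
        ultimately show ?thesis by linarith
      qed
      moreover have "norm ((2 * U x * V x) ^ q) = 2 ^ q * \<bar>U x * V x\<bar> ^ q"
        by (simp add: power_abs[symmetric] power_mult_distrib abs_mult power_mult_distrib)
      moreover have "norm (2 ^ q * ((U x) ^ (2 * q) + (V x) ^ (2 * q))) = 2 ^ q * ((U x) ^ (2 * q) + (V x) ^ (2 * q))"
        by (simp add: abs_mult power_mult)
      ultimately show "norm ((2 * U x * V x) ^ q) \<le> norm (2 ^ q * ((U x) ^ (2 * q) + (V x) ^ (2 * q)))"
        by simp
    qed
  qed simp
  have intm: "integrable M (\<lambda>x. ((U x)\<^sup>2 - (V x)\<^sup>2) ^ q)"
  proof (rule Bochner_Integration.integrable_bound)
    show "integrable M (\<lambda>x. (U x) ^ (2 * q) + (V x) ^ (2 * q))"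
      using intU intV by simp
    show "AE x in M. norm (((U x)\<^sup>2 - (V x)\<^sup>2) ^ q) \<le> norm ((U x) ^ (2 * q) + (V x) ^ (2 * q))"
    proof (rule AE_I2)
      fix x
      have "\<bar>(U x)\<^sup>2 - (V x)\<^sup>2\<bar> \<le> max ((U x)\<^sup>2) ((V x)\<^sup>2)"
        using zero_le_power2[of "U x"] zero_le_power2[of "V x"] by linarith
      then have "\<bar>(U x)\<^sup>2 - (V x)\<^sup>2\<bar> ^ q \<le> (max ((U x)\<^sup>2) ((V x)\<^sup>2)) ^ q"
        by (intro power_mono) auto
      also have "\<dots> \<le> ((U x)\<^sup>2) ^ q + ((V x)\<^sup>2) ^ q"
        by (auto simp: max_def)
      finally show "norm (((U x)\<^sup>2 - (V x)\<^sup>2) ^ q) \<le> norm ((U x) ^ (2 * q) + (V x) ^ (2 * q))"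
        by (simp add: power_abs power_mult)
    qed
  qed simp
  have sq: "Complex ((U x)\<^sup>2 - (V x)\<^sup>2) (2 * U x * V x) ^ q = Complex (U x) (V x) ^ (2 ^ Suc k)" for x
  proof -
    have "Complex ((U x)\<^sup>2 - (V x)\<^sup>2) (2 * U x * V x) = (Complex (U x) (V x))\<^sup>2"
      by (simp add: complex_eq_iff power2_eq_square)
    then show ?thesis
      unfolding q2 power_mult by simp
  qed
  \<comment> \<open>The induction hypothesis is used in the direction "real part by imaginary part",
    opposite to the one the theorem needs. So both directions are carried along; exchanging
    \<open>U\<close> and \<open>V\<close> only changes the sign of the real part of the square,
    which an even power ignores.\<close>
  have IH: "(\<integral>x. ((U x)\<^sup>2 - (V x)\<^sup>2) ^ q \<partial>M) \<le> cot x ^ q * (\<integral>x. (2 * U x * V x) ^ q \<partial>M)"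
    using Suc.IH[of "\<lambda>x. (U x)\<^sup>2 - (V x)\<^sup>2" "\<lambda>x. 2 * U x * V x"] intp intm Suc.prems(5) sq
    unfolding q_def x_def by simp
  note D = cot_double_quadratic[OF x(1,2)]
  have "(\<integral>x. (V x) ^ (2 * q) \<partial>M) \<le> cot (x / 2) ^ (2 * q) * (\<integral>x. (U x) ^ (2 * q) \<partial>M)"
    by (rule cotlar_step[OF q(1,2) D(2,1,3) intU intV intm intp IH])
  moreover have "(\<integral>x. (U x) ^ (2 * q) \<partial>M) \<le> cot (x / 2) ^ (2 * q) * (\<integral>x. (V x) ^ (2 * q) \<partial>M)"
  proof (rule cotlar_step[OF q(1,2) D(2,1,3) intV intU])
    have *: "((V x)\<^sup>2 - (U x)\<^sup>2) ^ q = ((U x)\<^sup>2 - (V x)\<^sup>2) ^ q" for x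
      using q(1) by (metis minus_diff_eq power_minus_even)
    have **: "2 * V x * U x = 2 * U x * V x" for x by simp
    show "integrable M (\<lambda>x. ((V x)\<^sup>2 - (U x)\<^sup>2) ^ q)" "integrable M (\<lambda>x. (2 * V x * U x) ^ q)"
      "(\<integral>x. ((V x)\<^sup>2 - (U x)\<^sup>2) ^ q \<partial>M) \<le> cot x ^ q * (\<integral>x. (2 * V x * U x) ^ q \<partial>M)"
      unfolding * ** using intm intp IH by auto
  qed
  ultimately show ?case
    unfolding q2 x(3) by (simp add: x)
qed

text \<open>Divided by cos^p the claim says that \<open>g\<close> is maximal at a = pi / (2 p),
  where cos (p a) = 0 leaves tan(a)^p. The sign of g' is that of sin(t)^(p-1) - c sin((p-1) t). The
  quotient of sin(t)^(p-1) by sin((p-1) t) decreases and \<open>c\<close> is its value at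
  \<open>a\<close>, so \<open>g\<close> rises before \<open>a\<close> and falls after it.\<close>

lemma essen_trig_ineq_interior:
  fixes p \<theta> :: real
  assumes p: "1 < p" "p < 2" and th: "0 < \<theta>" "\<theta> < pi / 2"
  defines "c \<equiv> sin (pi / (2 * p)) powr (p - 1) / cos (pi / (2 * p))"
  shows "sin \<theta> powr p \<le> tan (pi / (2 * p)) powr p * cos \<theta> powr p - c * cos (p * \<theta>)"
proof -
  define a where "a = pi / (2 * p)"
  have a: "0 < a" "a < pi / 2" "p * a = pi / 2"
    using p by (auto simp: a_def field_simps)
  define g where "g t = tan t powr p + c * cos (p * t) / cos t powr p" for t
  define g' where "g' t = p / cos t powr (p + 1) * (sin t powr (p - 1) - c * sin ((p - 1) * t))" for t
  have pos: "sin t > 0" "cos t > 0" "tan t > 0" "sin ((p - 1) * t) > 0" if "0 < t" "t < pi / 2" for t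
  proof -
    show "sin t > 0" "cos t > 0" "tan t > 0" using that by (auto intro!: sin_gt_zero cos_gt_zero tan_gt_zero)
    have "(p - 1) * t < 1 * t" using p that by (intro mult_strict_right_mono) auto
    then have "(p - 1) * t < pi" using that by linarith
    then show "sin ((p - 1) * t) > 0" using p that by (intro sin_gt_zero) auto
  qed
  have der: "(g has_real_derivative g' t) (at t)" if t: "0 < t" "t < pi / 2" for t
  proof -
    note P = pos[OF t]
    have e: "sin ((p - 1) * t) = sin (p * t) * cos t - cos (p * t) * sin t"
      by (simp add: algebra_simps sin_diff)
    have "(g has_real_derivative (p * tan t powr (p - 1) * inverse ((cos t)\<^sup>2)
        + ((c * (- sin (p * t) * p)) * cos t powr p - c * cos (p * t) * (p * cos t powr (p - 1) * (- sin t))) / (cos t powr p * cos t powr p))) (at t)"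
      unfolding g_def using P
      by (auto intro!: derivative_eq_intros simp: powr_diff field_simps)
    moreover have "p * tan t powr (p - 1) * inverse ((cos t)\<^sup>2)
        + ((c * (- sin (p * t) * p)) * cos t powr p - c * cos (p * t) * (p * cos t powr (p - 1) * (- sin t))) / (cos t powr p * cos t powr p) = g' t"
      unfolding g'_def e using P
      by (simp add: powr_diff powr_add tan_def powr_divide field_simps power2_eq_square)
    ultimately show ?thesis by simp
  qed
  \<comment> \<open>The logarithm of that quotient. It decreases because cot does and (p - 1) t <
    t.\<close>
  define r where "r t = (p - 1) * ln (sin t) - ln (sin ((p - 1) * t))" for t
  have rder: "(r has_real_derivative (p - 1) * (cot t - cot ((p - 1) * t))) (at t)" if t: "0 < t" "t < pi / 2" for t
    unfolding r_def using pos[OF t]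
    by (auto intro!: derivative_eq_intros simp: cot_def field_simps)
  have rneg: "(p - 1) * (cot t - cot ((p - 1) * t)) \<le> 0" if t: "0 < t" "t < pi / 2" for t
  proof -
    have "(p - 1) * t < 1 * t" using p t by (intro mult_strict_right_mono) auto
    moreover have "0 < (p - 1) * t" using p t by simp
    ultimately have "sin (t - (p - 1) * t) > 0" using t by (intro sin_gt_zero) linarith+
    then have "cos t * sin ((p - 1) * t) \<le> cos ((p - 1) * t) * sin t"
      by (simp add: sin_diff mult.commute)
    then have "cot t \<le> cot ((p - 1) * t)"
      using pos[OF t] by (simp add: cot_def field_simps)
    then show ?thesis using p by (simp add: mult_nonneg_nonpos)
  qed
  have rmono: "r t \<le> r s" if "0 < s" "s \<le> t" "t < pi / 2" for s t
  proof (rule DERIV_nonpos_imp_nonincreasing[of s t r])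
    fix x assume "s \<le> x" "x \<le> t"
    then show "\<exists>y. DERIV r x :> y \<and> y \<le> 0"
      using that rder[of x] rneg[of x] by auto
  qed (use that in auto)
  have ratio: "sin t powr (p - 1) = exp (r t) * sin ((p - 1) * t)" if t: "0 < t" "t < pi / 2" for t
    unfolding r_def using pos[OF t] by (simp add: exp_diff powr_def)
  \<comment> \<open>p a = pi / 2 makes (p - 1) a and a complementary; this is the origin of the
    closed form of \<open>c\<close>.\<close>
  have "sin ((p - 1) * a) = cos a"
    by (simp only: left_diff_distrib sin_diff a(3)) simp
  then have c: "c = exp (r a)"
    using ratio[OF a(1,2)] pos[OF a(1,2)] unfolding c_def a_def[symmetric] by simp
  have g'pos: "g' t \<ge> 0" if "0 < t" "t \<le> a" for t
    unfolding g'_def c using rmono[of t a] that a p ratio[of t] pos[of t]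
    by (auto intro!: mult_nonneg_nonneg mult_right_mono)
  have g'neg: "g' t \<le> 0" if "a \<le> t" "t < pi/2" for t
  proof -
    have "sin t powr (p - 1) - exp (r a) * sin ((p - 1) * t) \<le> 0"
      using rmono[of a t] that a ratio[of t] pos[of t] by (simp add: mult_right_mono)
    then show ?thesis
      unfolding g'_def c using p by (intro mult_nonneg_nonpos) auto
  qed
  have "g \<theta> \<le> g a"
  proof (cases "\<theta> \<le> a")
    case True
    show ?thesis
    proof (rule DERIV_nonneg_imp_nondecreasing[of \<theta> a g])
      fix x assume "\<theta> \<le> x" "x \<le> a"
      then show "\<exists>y. DERIV g x :> y \<and> y \<ge> 0"
        using th a der[of x] g'pos[of x] by auto
    qed (use True in auto)
  next
    case False
    show ?thesis
    proof (rule DERIV_nonpos_imp_nonincreasing[of a \<theta> g])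
      fix x assume "a \<le> x" "x \<le> \<theta>"
      then show "\<exists>y. DERIV g x :> y \<and> y \<le> 0"
        using th a der[of x] g'neg[of x] by auto
    qed (use False in auto)
  qed
  also have "g a = tan a powr p" by (simp add: g_def a)
  finally have "g \<theta> * cos \<theta> powr p \<le> tan a powr p * cos \<theta> powr p"
    by (intro mult_right_mono) auto
  moreover have "g \<theta> * cos \<theta> powr p = sin \<theta> powr p + c * cos (p * \<theta>)"
    unfolding g_def using pos[OF th] by (simp add: tan_def powr_divide field_simps)
  ultimately show ?thesis unfolding a_def by simp
qed

lemma essen_trig_ineq:
  fixes p \<theta> :: real
  assumes p: "1 < p" "p < 2" and th: "0 \<le> \<theta>" "\<theta> \<le> pi / 2"
  defines "c \<equiv> sin (pi / (2 * p)) powr (p - 1) / cos (pi / (2 * p))"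
  shows "sin \<theta> powr p \<le> tan (pi / (2 * p)) powr p * cos \<theta> powr p - c * cos (p * \<theta>)"
proof -
  have "tan (pi / (2 * p)) powr p * cos \<theta> powr p - c * cos (p * \<theta>) - sin \<theta> powr p \<ge> 0"
  proof (rule continuous_ge_on_closure[of "{0<..<pi/2}"
        "\<lambda>\<theta>. tan (pi / (2 * p)) powr p * cos \<theta> powr p - c * cos (p * \<theta>) - sin \<theta> powr p"])
    have "continuous_on {0..pi/2} (\<lambda>\<theta>. tan (pi / (2 * p)) powr p * cos \<theta> powr p - c * cos (p * \<theta>) - sin \<theta> powr p)"
      using p by (intro continuous_intros continuous_on_powr') (auto simp: cos_ge_zero sin_ge_zero)
    then show "continuous_on (closure {0<..<pi/2}) (\<lambda>\<theta>. tan (pi / (2 * p)) powr p * cos \<theta> powr p - c * cos (p * \<theta>) - sin \<theta> powr p)"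
      by simp
    show "\<theta> \<in> closure {0<..<pi/2}" using th by simp
  qed (use essen_trig_ineq_interior[OF p] c_def in auto)
  then show ?thesis by simp
qed

section \<open>Gaussian integrals\<close>

text \<open>A class closed under sums, products and powers that contains Gaussian increments with
  bounded coefficients. Membership replaces separate integrability proofs for the polynomial
  expressions that occur on a grid.\<close>

definition all_moments :: "'a measure \<Rightarrow> ('a \<Rightarrow> real) \<Rightarrow> bool" where
  "all_moments M f \<longleftrightarrow> f \<in> borel_measurable M \<and> (\<forall>m::nat. integrable M (\<lambda>x. \<bar>f x\<bar> ^ m))"

lemma all_moments_measurable: "all_moments M f \<Longrightarrow> f \<in> borel_measurable M"
  by (simp add: all_moments_def)

lemma all_moments_bound:
  assumes "all_moments M f" "g \<in> borel_measurable M" "\<And>x. x \<in> space M \<Longrightarrow> \<bar>g x\<bar> \<le> \<bar>f x\<bar>"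
  shows "all_moments M g"
proof -
  have "integrable M (\<lambda>x. \<bar>g x\<bar> ^ m)" for m
  proof (rule Bochner_Integration.integrable_bound[of M "\<lambda>x. \<bar>f x\<bar> ^ m"])
    show "integrable M (\<lambda>x. \<bar>f x\<bar> ^ m)" using assms(1) by (simp add: all_moments_def)
    show "AE x in M. norm (\<bar>g x\<bar> ^ m) \<le> norm (\<bar>f x\<bar> ^ m)"
      using power_mono[OF assms(3)] by (intro AE_I2) simp
  qed (use assms(2) in simp)
  then show ?thesis using assms by (simp add: all_moments_def)
qed

lemma all_moments_const: "finite_measure M \<Longrightarrow> all_moments M (\<lambda>_. c)"
  by (simp add: all_moments_def finite_measure.integrable_const)

lemma all_moments_add:
  assumes "all_moments M f" "all_moments M g"
  shows "all_moments M (\<lambda>x. f x + g x)"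
proof -
  have [measurable]: "f \<in> borel_measurable M" "g \<in> borel_measurable M"
    using assms by (auto simp: all_moments_def)
  have "integrable M (\<lambda>x. \<bar>f x + g x\<bar> ^ m)" for m
  proof (rule Bochner_Integration.integrable_bound[of M "\<lambda>x. 2 ^ m * (\<bar>f x\<bar> ^ m + \<bar>g x\<bar> ^ m)"])
    show "integrable M (\<lambda>x. 2 ^ m * (\<bar>f x\<bar> ^ m + \<bar>g x\<bar> ^ m))"
      using assms by (simp add: all_moments_def)
    show "AE x in M. norm (\<bar>f x + g x\<bar> ^ m) \<le> norm (2 ^ m * (\<bar>f x\<bar> ^ m + \<bar>g x\<bar> ^ m))"
    proof (rule AE_I2)
      fix x
      have "\<bar>f x + g x\<bar> ^ m \<le> (2 * max \<bar>f x\<bar> \<bar>g x\<bar>) ^ m"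
        by (intro power_mono) auto
      also have "\<dots> = 2 ^ m * max \<bar>f x\<bar> \<bar>g x\<bar> ^ m"
        by (simp add: power_mult_distrib)
      also have "\<dots> \<le> 2 ^ m * (\<bar>f x\<bar> ^ m + \<bar>g x\<bar> ^ m)"
        by (intro mult_left_mono) (auto simp: max_def)
      finally show "norm (\<bar>f x + g x\<bar> ^ m) \<le> norm (2 ^ m * (\<bar>f x\<bar> ^ m + \<bar>g x\<bar> ^ m))"
        by simp
    qed
  qed simp
  then show ?thesis by (simp add: all_moments_def)
qed

lemma all_moments_mult:
  assumes "all_moments M f" "all_moments M g"
  shows "all_moments M (\<lambda>x. f x * g x)"
proof -
  have [measurable]: "f \<in> borel_measurable M" "g \<in> borel_measurable M"
    using assms by (auto simp: all_moments_def)
  have "integrable M (\<lambda>x. \<bar>f x * g x\<bar> ^ m)" for m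
  proof (rule Bochner_Integration.integrable_bound[of M "\<lambda>x. \<bar>f x\<bar> ^ (2 * m) + \<bar>g x\<bar> ^ (2 * m)"])
    show "integrable M (\<lambda>x. \<bar>f x\<bar> ^ (2 * m) + \<bar>g x\<bar> ^ (2 * m))"
      using assms by (simp add: all_moments_def del: power_even_abs)
    show "AE x in M. norm (\<bar>f x * g x\<bar> ^ m) \<le> norm (\<bar>f x\<bar> ^ (2 * m) + \<bar>g x\<bar> ^ (2 * m))"
    proof (rule AE_I2)
      fix x
      have "\<bar>f x * g x\<bar> \<le> (max \<bar>f x\<bar> \<bar>g x\<bar>)\<^sup>2"
        unfolding power2_eq_square abs_mult by (intro mult_mono) auto
      then have "\<bar>f x * g x\<bar> ^ m \<le> ((max \<bar>f x\<bar> \<bar>g x\<bar>)\<^sup>2) ^ m"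
        by (intro power_mono) auto
      also have "\<dots> \<le> \<bar>f x\<bar> ^ (2 * m) + \<bar>g x\<bar> ^ (2 * m)"
        by (auto simp: max_def power_mult simp del: power2_abs)
      finally show "norm (\<bar>f x * g x\<bar> ^ m) \<le> norm (\<bar>f x\<bar> ^ (2 * m) + \<bar>g x\<bar> ^ (2 * m))"
        by simp
    qed
  qed simp
  then show ?thesis by (simp add: all_moments_def)
qed

lemma all_moments_sum:
  assumes "finite_measure M" "\<And>i. i \<in> I \<Longrightarrow> all_moments M (f i)"
  shows "all_moments M (\<lambda>x. \<Sum>i\<in>I. f i x)"
  using assms(2)
  by (induction I rule: infinite_finite_induct)
     (auto intro: all_moments_add all_moments_const[OF assms(1)])

lemma all_moments_abs: "all_moments M f \<Longrightarrow> all_moments M (\<lambda>x. \<bar>f x\<bar>)"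
  by (auto simp: all_moments_def)

lemma all_moments_power:
  "finite_measure M \<Longrightarrow> all_moments M f \<Longrightarrow> all_moments M (\<lambda>x. f x ^ m)"
  by (induction m) (auto intro: all_moments_mult all_moments_const)

lemma all_moments_integrable:
  assumes "all_moments M f" shows "integrable M f"
proof -
  have "integrable M (\<lambda>x. \<bar>f x\<bar> ^ 1)" "f \<in> borel_measurable M"
    using assms unfolding all_moments_def by blast+
  then show ?thesis by (simp add: integrable_abs_iff)
qed

lemma all_moments_integrable_power: "finite_measure M \<Longrightarrow> all_moments M f \<Longrightarrow> integrable M (\<lambda>x. f x ^ m)"
  by (intro all_moments_integrable all_moments_power)

lemma all_moments_norm_vec:
  fixes f :: "'a \<Rightarrow> 'b::euclidean_space"
  assumes "finite_measure M" "f \<in> borel_measurable M" "\<And>b. b \<in> Basis \<Longrightarrow> all_moments M (\<lambda>x. b \<bullet> f x)"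
  shows "all_moments M (\<lambda>x. norm (f x))"
proof (rule all_moments_bound)
  show "all_moments M (\<lambda>x. \<Sum>b\<in>Basis. \<bar>b \<bullet> f x\<bar>)"
    using assms by (intro all_moments_sum all_moments_abs) auto
  show "\<bar>norm (f x)\<bar> \<le> \<bar>\<Sum>b\<in>Basis. \<bar>b \<bullet> f x\<bar>\<bar>" for x
    using norm_le_l1[of "f x"] by (simp add: inner_commute sum_nonneg)
qed (use assms(2) in measurable)

interpretation std_normal: prob_space std_normal_distribution
  by (rule prob_space_normal_density) simp

lemma all_moments_std_normal: "all_moments std_normal_distribution (\<lambda>x. c * x)"
  unfolding all_moments_def
proof (intro conjI allI)
  fix m
  have "integrable lborel (\<lambda>x. std_normal_density x * (\<bar>x\<bar> ^ m))"
    by (rule integrable_std_normal_moment_abs)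
  then have "integrable lborel (\<lambda>x. \<bar>c\<bar> ^ m * (std_normal_density x * (\<bar>x\<bar> ^ m)))"
    by simp
  then show "integrable std_normal_distribution (\<lambda>x. \<bar>c * x\<bar> ^ m)"
    by (subst integrable_density) (auto simp: abs_mult power_mult_distrib mult_ac)
qed simp

section \<open>Exponential tilting of the Gaussian density and the function a - \<kappa> sinh
  a\<close>

lemma exp_mult_std_normal_density:
  "exp (c * x) * std_normal_density x = exp (c\<^sup>2 / 2) * std_normal_density (x - c)"
  by (simp add: std_normal_density_def exp_add[symmetric] field_simps power2_eq_square)

lemma integrable_std_normal_shift: "integrable lborel (\<lambda>x. std_normal_density (x - c))"
  using lborel_integrable_real_affine[of std_normal_density 1 "-c"] by simp

lemma integrable_exp_std_normal: "integrable lborel (\<lambda>x. exp (c * x) * std_normal_density x)"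
  unfolding exp_mult_std_normal_density using integrable_std_normal_shift by simp

lemma integral_exp_std_normal: "(\<integral>x. exp (c * x) * std_normal_density x \<partial>lborel) = exp (c\<^sup>2 / 2)"
proof -
  have "(\<integral>x. std_normal_density (x - c) \<partial>lborel) = 1"
    using lborel_integral_real_affine[of 1 std_normal_density "-c"] by simp
  then show ?thesis unfolding exp_mult_std_normal_density by simp
qed

lemma sinh_mult_le:
  fixes a t :: real
  assumes "0 \<le> a" "0 \<le> t" "t \<le> 1"
  shows "sinh (t * a) \<le> t * sinh a"
proof -
  have "convex_on {0..} (sinh :: real \<Rightarrow> real)"
  proof (rule f''_ge0_imp_convex[where f' = cosh and f'' = sinh])
    show "(sinh has_real_derivative cosh x) (at x)" for x :: real
      by (auto intro!: derivative_eq_intros)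
    show "(cosh has_real_derivative sinh x) (at x)" for x :: real
      by (auto intro!: derivative_eq_intros)
  qed auto
  from convex_onD[OF this, of t 0 a] show ?thesis using assms by simp
qed

text \<open>sinh is convex and vanishes at 0, so for \<kappa> >= 0 nonnegativity of a - \<kappa>
  sinh a at one point passes to all smaller points: there is at most one sign change, from plus to
  minus. If no negative value occurs there is no crossing point to name, hence the second
  alternative.\<close>

lemma sinh_defect_crossing:
  fixes \<kappa> :: real
  obtains a0 where "\<And>a. 0 \<le> a \<Longrightarrow> a < a0 \<Longrightarrow> 0 \<le> a - \<kappa> * sinh a"
    "\<And>a. 0 \<le> a \<Longrightarrow> a > a0 \<Longrightarrow> a - \<kappa> * sinh a \<le> 0"
  | "\<And>a. 0 \<le> a \<Longrightarrow> 0 \<le> a - \<kappa> * sinh a"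
proof (cases "\<kappa> \<ge> 0 \<and> (\<exists>b\<ge>0. b - \<kappa> * sinh b < 0)")
  case False
  have "0 \<le> a - \<kappa> * sinh a" if "a \<ge> 0" for a
  proof (cases "\<kappa> \<ge> 0")
    case True then show ?thesis using False that by force
  next
    case False
    then have "\<kappa> * sinh a \<le> 0" using that by (intro mult_nonpos_nonneg) auto
    then show ?thesis using that by linarith
  qed
  then show ?thesis using that by blast
next
  case True
  then obtain b where k: "\<kappa> \<ge> 0" and b: "b \<ge> 0" "b - \<kappa> * sinh b < 0" by blast
  have down: "0 \<le> s - \<kappa> * sinh s" if "0 \<le> s" "s \<le> a" "0 \<le> a - \<kappa> * sinh a" for s a
  proof (cases "a = 0")
    case False
    with that have a: "a > 0" by simp
    have "sinh (s / a * a) \<le> s / a * sinh a"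
      using that a by (intro sinh_mult_le) (auto simp: field_simps)
    then have "\<kappa> * sinh s \<le> \<kappa> * (s / a * sinh a)"
      using a k by (intro mult_left_mono) auto
    also have "\<dots> \<le> s / a * a"
      using that a mult_left_mono[of "\<kappa> * sinh a" a "s / a"] by (simp add: mult_ac)
    finally show ?thesis using a by simp
  qed (use that in simp)
  define S where "S = {a. 0 \<le> a \<and> 0 \<le> a - \<kappa> * sinh a}"
  have bdd: "bdd_above S"
  proof (rule bdd_aboveI[of _ b])
    fix x assume "x \<in> S"
    then show "x \<le> b" using down[of b x] b unfolding S_def by (cases "x \<le> b") auto
  qed
  have "0 \<in> S" by (simp add: S_def)
  show ?thesis
  proof (rule that(1)[of "Sup S"])
    fix a assume a: "0 \<le> a" "a < Sup S"
    then obtain s where "s \<in> S" "a < s"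
      using \<open>0 \<in> S\<close> bdd by (subst (asm) less_cSup_iff) auto
    then show "0 \<le> a - \<kappa> * sinh a" using a down[of a s] by (auto simp: S_def)
  next
    fix a assume "0 \<le> a" "a > Sup S"
    then have "a \<notin> S" using cSup_upper[OF _ bdd, of a] by force
    then show "a - \<kappa> * sinh a \<le> 0" using \<open>0 \<le> a\<close> by (simp add: S_def)
  qed
qed

text \<open>Tilting turns sinh into half the difference of two shifted densities. The integral is
  then \<sigma> / sqrt (2 pi) minus half the normal mass of the interval from -\<sigma> to \<sigma>,
  and this mass is at most the length 2 \<sigma> times the maximal density 1 / sqrt (2 pi).\<close>

lemma integral_sinh_defect_zero:
  fixes \<sigma> :: real
  assumes "\<sigma> \<ge> 0"
  shows "integrable lborel (\<lambda>x. indicator {0<..} x * (\<sigma> * x - exp (- \<sigma>\<^sup>2 / 2) * sinh (\<sigma> * x)) * std_normal_density x)"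
    and "0 \<le> (\<integral>x. indicator {0<..} x * (\<sigma> * x - exp (- \<sigma>\<^sup>2 / 2) * sinh (\<sigma> * x)) * std_normal_density x \<partial>lborel)"
proof -
  let ?\<phi> = std_normal_density
  have sh: "exp (- \<sigma>\<^sup>2 / 2) * sinh (\<sigma> * x) * ?\<phi> x = (?\<phi> (x - \<sigma>) - ?\<phi> (x - (- \<sigma>))) / 2" for x
  proof -
    have "exp (- \<sigma>\<^sup>2 / 2) * sinh (\<sigma> * x) * ?\<phi> x
        = exp (- \<sigma>\<^sup>2 / 2) * (exp (\<sigma> * x) * ?\<phi> x - exp ((- \<sigma>) * x) * ?\<phi> x) / 2"
      by (simp add: sinh_field_def algebra_simps)
    also have "\<dots> = (exp (- \<sigma>\<^sup>2 / 2) * exp (\<sigma>\<^sup>2 / 2)) * (?\<phi> (x - \<sigma>) - ?\<phi> (x - (- \<sigma>))) / 2"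
      unfolding exp_mult_std_normal_density by (simp add: algebra_simps)
    finally show ?thesis by (simp add: exp_add[symmetric])
  qed
  have i1: "has_bochner_integral lborel (\<lambda>x. indicator {0<..} x * (x * ?\<phi> x)) (1 / sqrt (2 * pi))"
  proof (rule has_bochner_integral_nn_integral)
    have "(\<integral>\<^sup>+x. ennreal (x * ?\<phi> x) * indicator {0..} x \<partial>lborel) = ennreal (0 - (- ?\<phi> 0))"
    proof (rule nn_integral_FTC_atLeast[where F = "\<lambda>x. - ?\<phi> x"])
      show "((\<lambda>x. - ?\<phi> x) has_real_derivative x * ?\<phi> x) (at x)" for x
      proof -
        have "((\<lambda>x. - (1 / sqrt (2 * pi) * exp (- x\<^sup>2 / 2))) has_real_derivative - (1 / sqrt (2 * pi) * (exp (- x\<^sup>2 / 2) * (- x)))) (at x)"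
          by (rule derivative_eq_intros refl | simp)+
        then show ?thesis unfolding std_normal_density_def by (simp add: mult_ac)
      qed
      show "((\<lambda>x. - ?\<phi> x) \<longlongrightarrow> 0) at_top"
        unfolding std_normal_density_def by real_asymp
    qed auto
    then show "(\<integral>\<^sup>+x. ennreal (indicator {0<..} x * (x * ?\<phi> x)) \<partial>lborel) = ennreal (1 / sqrt (2 * pi))"
      by (subst nn_integral_cong[of _ _ "\<lambda>x. ennreal (x * ?\<phi> x) * indicator {0..} x"])
         (auto simp: indicator_def std_normal_density_def)
  qed (auto simp: indicator_def)
  have i2: "integrable lborel (\<lambda>x. indicator {0<..} x * ?\<phi> (x - c))" for c
    using integrable_real_mult_indicator[OF _ integrable_std_normal_shift[of c], of "{0<..}"] by (simp add: mult.commute)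
  have e2: "(\<integral>x. indicator {0<..} x * ?\<phi> (x - c) \<partial>lborel) = (\<integral>x. indicator {-c<..} x * ?\<phi> x \<partial>lborel)" for c
    using lborel_integral_real_affine[of 1 "\<lambda>x. indicator {-c<..} x * ?\<phi> x" "-c"]
    by (simp add: indicator_def)
  have i3: "integrable lborel (\<lambda>x. indicator A x * ?\<phi> x)" if "A \<in> sets borel" for A
    using integrable_real_mult_indicator[OF _ integrable_normal_density[of 1 0], of A] that by (simp add: mult.commute)
  have eq: "indicator {0<..} x * (\<sigma> * x - exp (- \<sigma>\<^sup>2 / 2) * sinh (\<sigma> * x)) * ?\<phi> x
      = \<sigma> * (indicator {0<..} x * (x * ?\<phi> x)) - (indicator {0<..} x * ?\<phi> (x - \<sigma>) - indicator {0<..} x * ?\<phi> (x - (- \<sigma>))) / 2" for x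
  proof -
    have "indicator {0<..} x * (\<sigma> * x - exp (- \<sigma>\<^sup>2 / 2) * sinh (\<sigma> * x)) * ?\<phi> x
      = \<sigma> * (indicator {0<..} x * (x * ?\<phi> x)) - indicator {0<..} x * (exp (- \<sigma>\<^sup>2 / 2) * sinh (\<sigma> * x) * ?\<phi> x)"
      by (simp add: algebra_simps)
    then show ?thesis unfolding sh by (simp add: algebra_simps)
  qed
  show "integrable lborel (\<lambda>x. indicator {0<..} x * (\<sigma> * x - exp (- \<sigma>\<^sup>2 / 2) * sinh (\<sigma> * x)) * ?\<phi> x)"
    unfolding eq using i1 i2[of \<sigma>] i2[of "-\<sigma>"] by (auto simp: has_bochner_integral_iff)
  have "(\<integral>x. indicator {-\<sigma><..} x * ?\<phi> x \<partial>lborel) - (\<integral>x. indicator {\<sigma><..} x * ?\<phi> x \<partial>lborel)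
     = (\<integral>x. indicator {-\<sigma><..} x * ?\<phi> x - indicator {\<sigma><..} x * ?\<phi> x \<partial>lborel)"
    by (intro Bochner_Integration.integral_diff[symmetric] i3) auto
  also have "\<dots> = (\<integral>x. indicator {-\<sigma><..\<sigma>} x * ?\<phi> x \<partial>lborel)"
    using assms by (intro Bochner_Integration.integral_cong) (auto simp: indicator_def)
  also have "\<dots> \<le> (\<integral>x. indicator {-\<sigma><..\<sigma>} x * (1 / sqrt (2 * pi)) \<partial>lborel)"
  proof (intro integral_mono i3)
    show "integrable lborel (\<lambda>x. indicator {-\<sigma><..\<sigma>} x * (1 / sqrt (2 * pi)))"
      using assms by (intro integrable_mult_left integrable_real_indicator) (auto simp: emeasure_lborel_Ioc)
    fix x :: real
    have "?\<phi> x \<le> 1 / sqrt (2 * pi)"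
      by (simp add: std_normal_density_def divide_right_mono)
    then show "indicator {-\<sigma><..\<sigma>} x * ?\<phi> x \<le> indicator {-\<sigma><..\<sigma>} x * (1 / sqrt (2 * pi))"
      by (intro mult_left_mono) auto
  qed auto
  also have "\<dots> = 2 * \<sigma> / sqrt (2 * pi)"
    using assms by simp
  finally have le: "(\<integral>x. indicator {-\<sigma><..} x * ?\<phi> x \<partial>lborel) - (\<integral>x. indicator {\<sigma><..} x * ?\<phi> x \<partial>lborel) \<le> 2 * \<sigma> / sqrt (2 * pi)" .
  have "(\<integral>x. indicator {0<..} x * (\<sigma> * x - exp (- \<sigma>\<^sup>2 / 2) * sinh (\<sigma> * x)) * ?\<phi> x \<partial>lborel)
     = \<sigma> * (1 / sqrt (2 * pi)) - ((\<integral>x. indicator {-\<sigma><..} x * ?\<phi> x \<partial>lborel) - (\<integral>x. indicator {\<sigma><..} x * ?\<phi> x \<partial>lborel)) / 2"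
    unfolding eq using i1 i2[of \<sigma>] i2[of "-\<sigma>"] e2[of \<sigma>] e2[of "-\<sigma>"] by (simp add: has_bochner_integral_iff)
  then show "0 \<le> (\<integral>x. indicator {0<..} x * (\<sigma> * x - exp (- \<sigma>\<^sup>2 / 2) * sinh (\<sigma> * x)) * ?\<phi> x \<partial>lborel)"
    using le by (simp add: mult.commute)
qed


text \<open>Shifting by \<open>x\<close> multiplies the integrand by a decreasing function, and the integrand for \<open>x = 0\<close> changes
  sign at most once, from plus to minus; so the case \<open>x = 0\<close> suffices.\<close>

lemma sinh_defect_normal_nonneg:
  fixes \<sigma> x :: real
  assumes "\<sigma> > 0" "x \<ge> 0"
  shows "0 \<le> (\<integral>y. (max 0 (\<sigma> * y - x) - exp (- \<sigma>\<^sup>2 / 2) * sinh (max 0 (\<sigma> * y - x))) * std_normal_density y \<partial>lborel)"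
proof -
  let ?\<phi> = std_normal_density
  define \<kappa> where "\<kappa> = exp (- \<sigma>\<^sup>2 / 2)"
  \<comment> \<open>The positive part starts at y = h. Moving the integration variable by
    \<open>h\<close> brings out the decreasing factor exp (- h y) and leaves the integrand
    \<open>f\<close> of the unshifted case.\<close>
  define h where "h = x / \<sigma>"
  have h: "h \<ge> 0" "x = \<sigma> * h" using assms by (auto simp: h_def)
  define k where "k a = a - \<kappa> * sinh a" for a
  have km[measurable]: "k \<in> borel_measurable borel"
    unfolding k_def by (intro borel_measurable_continuous_onI continuous_intros)
  define f where "f y = indicator {0<..} y * k (\<sigma> * y) * ?\<phi> y" for y
  have f: "integrable lborel f" "0 \<le> integral\<^sup>L lborel f"
    using integral_sinh_defect_zero[of \<sigma>] assms unfolding f_def k_def \<kappa>_def by auto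
  have fh: "integrable lborel (\<lambda>y. exp (- h * y) * f y)"
  proof (rule Bochner_Integration.integrable_bound[OF f(1)])
    show "AE y in lborel. norm (exp (- h * y) * f y) \<le> norm (f y)"
    proof (rule AE_I2)
      fix y :: real
      show "norm (exp (- h * y) * f y) \<le> norm (f y)"
      proof (cases "y > 0")
        case True
        then have "exp (- h * y) \<le> 1" using h by simp
        then show ?thesis using mult_right_mono[of "exp (- h * y)" 1 "\<bar>f y\<bar>"] by (simp add: abs_mult)
      qed (simp add: f_def)
    qed
  qed (simp add: f_def)
  have "0 \<le> (\<integral>y. exp (- h * y) * f y \<partial>lborel)"
  proof (rule sinh_defect_crossing[of \<kappa>])
    fix a0 assume a0: "\<And>a. 0 \<le> a \<Longrightarrow> a < a0 \<Longrightarrow> 0 \<le> a - \<kappa> * sinh a"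
      "\<And>a. 0 \<le> a \<Longrightarrow> a > a0 \<Longrightarrow> a - \<kappa> * sinh a \<le> 0"
    \<comment> \<open>The value of the weight exp (- h y) at the sign change y = a0 / \<sigma>.
      Before that point the weight is larger and \<open>f\<close> is nonnegative, after it smaller
      and \<open>f\<close> nonpositive; so E f is at most the weighted integrand everywhere.\<close>
    define E where "E = exp (- h * (a0 / \<sigma>))"
    have "0 \<le> E * integral\<^sup>L lborel f" using f by (simp add: E_def)
    also have "\<dots> = (\<integral>y. E * f y \<partial>lborel)" by simp
    also have "\<dots> \<le> (\<integral>y. exp (- h * y) * f y \<partial>lborel)"
    proof (intro integral_mono fh)
      fix y
      show "E * f y \<le> exp (- h * y) * f y"
      proof (cases "y > 0")
        case True
        then have y: "0 \<le> \<sigma> * y" using assms by simp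
        consider "\<sigma> * y < a0" | "\<sigma> * y = a0" | "\<sigma> * y > a0" by linarith
        then show ?thesis
        proof cases
          case 1
          then have "y \<le> a0 / \<sigma>" using assms by (simp add: field_simps)
          then have "E \<le> exp (- h * y)" using mult_left_mono[of y "a0 / \<sigma>" h] h(1) by (simp add: E_def)
          moreover have "0 \<le> f y" using a0(1)[OF y 1] by (simp add: f_def k_def)
          ultimately show ?thesis by (rule mult_right_mono)
        next
          case 2
          then have "a0 / \<sigma> = y" using assms by (simp add: field_simps)
          then show ?thesis by (simp add: E_def)
        next
          case 3
          then have "y \<ge> a0 / \<sigma>" using assms by (simp add: field_simps)
          then have "E \<ge> exp (- h * y)" using mult_left_mono[of "a0 / \<sigma>" y h] h(1) by (simp add: E_def)
          moreover have "f y \<le> 0" using a0(2)[OF y 3] True by (simp add: f_def k_def mult_nonpos_nonneg)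
          ultimately show ?thesis by (rule mult_right_mono_neg)
        qed
      qed (simp add: f_def)
    qed (use f in simp)
    finally show ?thesis .
  next
    assume *: "\<And>a. 0 \<le> a \<Longrightarrow> 0 \<le> a - \<kappa> * sinh a"
    have "0 \<le> f y" for y
      using *[of "\<sigma> * y"] assms by (cases "y > 0") (auto simp: f_def k_def)
    then show ?thesis by (intro integral_nonneg_AE AE_I2) auto
  qed
  then have "0 \<le> exp (- h\<^sup>2 / 2) * (\<integral>y. exp (- h * y) * f y \<partial>lborel)" by simp
  also have "\<dots> = (\<integral>y. exp (- h\<^sup>2 / 2) * (exp (- h * y) * f y) \<partial>lborel)" by simp
  also have "\<dots> = (\<integral>y. (max 0 (\<sigma> * (h + 1 * y) - x) - \<kappa> * sinh (max 0 (\<sigma> * (h + 1 * y) - x))) * ?\<phi> (h + 1 * y) \<partial>lborel)"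
  proof (rule Bochner_Integration.integral_cong[OF refl])
    fix y :: real
    have "exp (- h\<^sup>2 / 2) * (exp (- h * y) * ?\<phi> y) = ?\<phi> (h + y)"
      by (simp add: std_normal_density_def exp_add[symmetric] field_simps power2_eq_square)
    moreover have "max 0 (\<sigma> * (h + 1 * y) - x) = (if y > 0 then \<sigma> * y else 0)"
      using assms h by (auto simp: algebra_simps max_def mult_le_0_iff zero_le_mult_iff)
    ultimately show "exp (- h\<^sup>2 / 2) * (exp (- h * y) * f y)
       = (max 0 (\<sigma> * (h + 1 * y) - x) - \<kappa> * sinh (max 0 (\<sigma> * (h + 1 * y) - x))) * ?\<phi> (h + 1 * y)"
      by (auto simp: f_def k_def)
  qed
  also have "\<dots> = (\<integral>y. (max 0 (\<sigma> * y - x) - \<kappa> * sinh (max 0 (\<sigma> * y - x))) * ?\<phi> y \<partial>lborel)"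
    using lborel_integral_real_affine[of 1 "\<lambda>y. (max 0 (\<sigma> * y - x) - \<kappa> * sinh (max 0 (\<sigma> * y - x))) * ?\<phi> y" h] by simp
  finally show ?thesis unfolding \<kappa>_def .
qed

lemma integral_std_normal_uminus:
  fixes f :: "real \<Rightarrow> real"
  shows "(\<integral>y. f (- y) * std_normal_density y \<partial>lborel) = (\<integral>y. f y * std_normal_density y \<partial>lborel)"
  using lborel_integral_real_affine[of "-1" "\<lambda>y. f y * std_normal_density y" 0]
  by (simp add: std_normal_density_def)

text \<open>The one-dimensional core of subharmonicity: \<open>c\<close> stands for the cosine of
  the second coordinate, and exp (- \<sigma>^2 / 2) for its damping by a Gaussian of the same
  variance. By symmetry x >= 0. Dropping the absolute values gives functions whose means are known
  exactly, and what is dropped lives where x + \<sigma> y < 0 and forms the sinh defect.\<close>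

lemma normal_laplace_abs_ineq:
  fixes \<sigma> x c :: real
  assumes "\<sigma> \<ge> 0" "\<bar>c\<bar> \<le> 1"
  shows "exp (- \<bar>x\<bar>) * c + \<bar>x\<bar> \<le>
    exp (- \<sigma>\<^sup>2 / 2) * c * (\<integral>y. exp (- \<bar>x + \<sigma> * y\<bar>) * std_normal_density y \<partial>lborel)
      + (\<integral>y. \<bar>x + \<sigma> * y\<bar> * std_normal_density y \<partial>lborel)"
proof -
  let ?\<phi> = std_normal_density
  define \<kappa> where "\<kappa> = exp (- \<sigma>\<^sup>2 / 2)"
  have m1: "integrable lborel (\<lambda>y. y * ?\<phi> y)" "(\<integral>y. y * ?\<phi> y \<partial>lborel) = 0"
    using integrable_std_normal_moment[of 1] integral_std_normal_moment_odd[of 0] by (auto simp: mult.commute)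
  have i0: "integrable lborel (\<lambda>y. (a + \<sigma> * y) * ?\<phi> y)" for a
    using m1 by (simp add: distrib_right mult.assoc)
  have e0: "(\<integral>y. (a + \<sigma> * y) * ?\<phi> y \<partial>lborel) = a" for a
    using m1 by (simp add: distrib_right mult.assoc)
  have i1: "integrable lborel (\<lambda>y. \<bar>a + \<sigma> * y\<bar> * ?\<phi> y)" for a
    using integrable_abs[OF i0[of a]] by (simp add: abs_mult)
  have ie: "integrable lborel (\<lambda>y. exp (a + s * y) * ?\<phi> y)" for a s
    using integrable_exp_std_normal[of s] by (simp add: exp_add mult.assoc)
  have ee: "(\<integral>y. exp (a + s * y) * ?\<phi> y \<partial>lborel) = exp a * exp (s\<^sup>2 / 2)" for a s
    using integrable_exp_std_normal[of s] integral_exp_std_normal[of s] by (simp add: exp_add mult.assoc)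
  have i2: "integrable lborel (\<lambda>y. exp (- \<bar>a + \<sigma> * y\<bar>) * ?\<phi> y)" for a
  proof (rule Bochner_Integration.integrable_bound[OF integrable_normal_density[of 1 0]])
    show "AE y in lborel. norm (exp (- \<bar>a + \<sigma> * y\<bar>) * ?\<phi> y) \<le> norm (?\<phi> y)"
      by (intro AE_I2) (simp add: mult_left_le_one_le)
  qed simp_all
  have main: "exp (- x) * c + x \<le> \<kappa> * c * (\<integral>y. exp (- \<bar>x + \<sigma> * y\<bar>) * ?\<phi> y \<partial>lborel)
      + (\<integral>y. \<bar>x + \<sigma> * y\<bar> * ?\<phi> y \<partial>lborel)" if x: "x \<ge> 0" for x
  proof -
    define P Q where "P = (\<integral>y. exp (- \<bar>x + \<sigma> * y\<bar>) * ?\<phi> y \<partial>lborel)"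
      and "Q = (\<integral>y. \<bar>x + \<sigma> * y\<bar> * ?\<phi> y \<partial>lborel)"
    have \<kappa>: "\<kappa> * exp (\<sigma>\<^sup>2 / 2) = 1" by (simp add: \<kappa>_def exp_add[symmetric])
    have Ee: "\<kappa> * (\<integral>y. exp (- x + (- \<sigma>) * y) * ?\<phi> y \<partial>lborel) = exp (- x)"
      using \<kappa> unfolding ee by (simp add: mult.left_commute mult.commute)
    have "P \<le> (\<integral>y. exp (- x + (- \<sigma>) * y) * ?\<phi> y \<partial>lborel)"
      unfolding P_def by (intro integral_mono i2 ie mult_right_mono) auto
    then have Ple: "\<kappa> * P \<le> exp (- x)"
      unfolding Ee[symmetric] by (intro mult_left_mono) (auto simp: \<kappa>_def)
    \<comment> \<open>This is the case c = 1. It suffices, since \<kappa> P <= exp (- x) makes the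
      coefficient of \<open>c\<close> nonnegative once all terms with \<open>c\<close> are on one
      side.\<close>
    have "exp (- x) - \<kappa> * P \<le> Q - x"
    proof (cases "\<sigma> = 0")
      case True
      then show ?thesis using x by (simp add: P_def Q_def \<kappa>_def)
    next
      case False
      have "0 \<le> (\<integral>y. (max 0 (\<sigma> * y - x) - \<kappa> * sinh (max 0 (\<sigma> * y - x))) * ?\<phi> y \<partial>lborel)"
        unfolding \<kappa>_def using False assms x by (intro sinh_defect_normal_nonneg) auto
      also have "\<dots> = (\<integral>y. (max 0 (\<sigma> * (-y) - x) - \<kappa> * sinh (max 0 (\<sigma> * (-y) - x))) * ?\<phi> y \<partial>lborel)"
        by (rule integral_std_normal_uminus[symmetric])
      \<comment> \<open>With z = x + \<sigma> y, now that y has been reflected: max 0 (- z) = (|z| -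
        z) / 2, and sinh of it is (exp (- z) - exp (- |z|)) / 2.\<close>
      also have "\<dots> = (\<integral>y. ((\<bar>x + \<sigma> * y\<bar> * ?\<phi> y - (x + \<sigma> * y) * ?\<phi> y)
          - \<kappa> * (exp (- x + (- \<sigma>) * y) * ?\<phi> y - exp (- \<bar>x + \<sigma> * y\<bar>) * ?\<phi> y)) / 2 \<partial>lborel)"
      proof (rule Bochner_Integration.integral_cong[OF refl])
        fix y
        have "max 0 (\<sigma> * (-y) - x) = (\<bar>x + \<sigma> * y\<bar> - (x + \<sigma> * y)) / 2" by (simp add: max_def abs_if)
        moreover have "sinh (max 0 (\<sigma> * (-y) - x)) = (exp (- x + (- \<sigma>) * y) - exp (- \<bar>x + \<sigma> * y\<bar>)) / 2"
        proof (cases "x + \<sigma> * y < 0")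
          case True
          then have "max 0 (\<sigma> * (-y) - x) = - (x + \<sigma> * y)" "\<bar>x + \<sigma> * y\<bar> = - (x + \<sigma> * y)" by auto
          moreover have "- x + (- \<sigma>) * y = - (x + \<sigma> * y)" by simp
          ultimately show ?thesis by (simp only: sinh_field_def minus_minus)
        next
          case False
          then have "max 0 (\<sigma> * (-y) - x) = 0" "\<bar>x + \<sigma> * y\<bar> = x + \<sigma> * y" by auto
          moreover have "- x + (- \<sigma>) * y = - (x + \<sigma> * y)" by simp
          ultimately show ?thesis by (simp only: sinh_0) simp
        qed
        ultimately show "(max 0 (\<sigma> * (-y) - x) - \<kappa> * sinh (max 0 (\<sigma> * (-y) - x))) * ?\<phi> y
           = ((\<bar>x + \<sigma> * y\<bar> * ?\<phi> y - (x + \<sigma> * y) * ?\<phi> y)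
          - \<kappa> * (exp (- x + (- \<sigma>) * y) * ?\<phi> y - exp (- \<bar>x + \<sigma> * y\<bar>) * ?\<phi> y)) / 2"
          by (simp only:) (simp add: field_simps)
      qed
      also have "\<dots> = ((Q - x) - (\<kappa> * (\<integral>y. exp (- x + (- \<sigma>) * y) * ?\<phi> y \<partial>lborel) - \<kappa> * P)) / 2"
        unfolding P_def Q_def using i0[of x] e0[of x] i1[of x] i2[of x] ie[of "-x" "-\<sigma>"]
        by (simp add: right_diff_distrib)
      finally show ?thesis unfolding Ee by simp
    qed
    moreover have "(exp (- x) - \<kappa> * P) * c \<le> (exp (- x) - \<kappa> * P) * 1"
      using Ple assms(2) by (intro mult_left_mono) auto
    ultimately have "(exp (- x) - \<kappa> * P) * c \<le> Q - x" by simp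
    then show ?thesis unfolding P_def[symmetric] Q_def[symmetric] by (simp add: algebra_simps)
  qed
  show ?thesis
  proof (cases "x \<ge> 0")
    case True
    then show ?thesis using main[OF True] by (simp add: \<kappa>_def)
  next
    case False
    have sw: "\<bar>x + \<sigma> * (- y)\<bar> = \<bar>- x + \<sigma> * y\<bar>" for y by (simp add: abs_if)
    have "(\<integral>y. exp (- \<bar>- x + \<sigma> * y\<bar>) * ?\<phi> y \<partial>lborel) = (\<integral>y. exp (- \<bar>x + \<sigma> * y\<bar>) * ?\<phi> y \<partial>lborel)"
      "(\<integral>y. \<bar>- x + \<sigma> * y\<bar> * ?\<phi> y \<partial>lborel) = (\<integral>y. \<bar>x + \<sigma> * y\<bar> * ?\<phi> y \<partial>lborel)"
      using integral_std_normal_uminus[of "\<lambda>y. exp (- \<bar>x + \<sigma> * y\<bar>)"]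
        integral_std_normal_uminus[of "\<lambda>y. \<bar>x + \<sigma> * y\<bar>"] unfolding sw by auto
    then show ?thesis using main[of "-x"] False by (simp add: \<kappa>_def)
  qed
qed

section \<open>Characteristic functions and isotropic Gaussian vectors\<close>

lemma iexp_std_normal: "(CLINT x|std_normal_distribution. iexp (s * x)) = exp (- (complex_of_real s)\<^sup>2 / 2)"
  using fun_cong[OF char_std_normal_distribution, of s] by (simp add: char_def exp_of_real[symmetric])

text \<open>Isotropy is recorded through the laws of linear functionals, written as multiples of a
  standard normal so that a = 0 and v = 0 are covered by the same formula. Independence of
  orthogonal components is not among the data; its consequences are derived from characteristic
  functions.\<close>

locale isotropic_gaussian = prob_space G for G :: "'b::euclidean_space measure" +
  fixes v :: real
  assumes sets_G [measurable_cong, simp]: "sets G = sets borel"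
    and var_nonneg: "0 \<le> v"
    and marginal: "\<And>a. distr G borel (\<lambda>w. a \<bullet> w) = distr std_normal_distribution borel (\<lambda>x. norm a * sqrt v * x)"
begin

lemma space_G [simp]: "space G = UNIV"
  using sets_eq_imp_space_eq[OF sets_G] by simp

lemma prob_UNIV [simp]: "prob UNIV = 1"
  using prob_space by simp

lemma integral_marginal:
  fixes f :: "real \<Rightarrow> 'c::{banach, second_countable_topology}"
  assumes [measurable]: "f \<in> borel_measurable borel"
  shows "(\<integral>w. f (a \<bullet> w) \<partial>G) = (\<integral>x. f (norm a * sqrt v * x) \<partial>std_normal_distribution)"
proof -
  have "(\<integral>w. f (a \<bullet> w) \<partial>G) = (\<integral>x. f x \<partial>distr G borel (\<lambda>w. a \<bullet> w))"
    by (subst integral_distr) auto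
  also have "\<dots> = (\<integral>x. f (norm a * sqrt v * x) \<partial>std_normal_distribution)"
    unfolding marginal by (subst integral_distr) auto
  finally show ?thesis .
qed

lemma integrable_marginal:
  fixes f :: "real \<Rightarrow> 'c::{banach, second_countable_topology}"
  assumes [measurable]: "f \<in> borel_measurable borel"
  shows "integrable G (\<lambda>w. f (a \<bullet> w)) \<longleftrightarrow> integrable std_normal_distribution (\<lambda>x. f (norm a * sqrt v * x))"
proof -
  have "integrable G (\<lambda>w. f (a \<bullet> w)) \<longleftrightarrow> integrable (distr G borel (\<lambda>w. a \<bullet> w)) f"
    by (subst integrable_distr_eq) auto
  also have "\<dots> \<longleftrightarrow> integrable std_normal_distribution (\<lambda>x. f (norm a * sqrt v * x))"
    unfolding marginal by (subst integrable_distr_eq) auto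
  finally show ?thesis .
qed

lemma all_moments_inner: "all_moments G (\<lambda>w. a \<bullet> w)"
  using all_moments_std_normal[of "norm a * sqrt v"] integrable_marginal[of "\<lambda>x. \<bar>x\<bar> ^ _" a]
  unfolding all_moments_def by auto

lemma all_moments_norm: "all_moments G (\<lambda>w. norm w)"
  by (intro all_moments_norm_vec all_moments_inner finite_measure_axioms) auto

lemma integral_inner_power:
  "(\<integral>w. (a \<bullet> w) ^ m \<partial>G) = (norm a) ^ m * (sqrt v ^ m * (\<integral>x. x ^ m \<partial>std_normal_distribution))"
  by (subst integral_marginal) (auto simp: power_mult_distrib)

lemma integral_abs_inner_power:
  "(\<integral>w. \<bar>a \<bullet> w\<bar> ^ m \<partial>G) = (norm a) ^ m * (sqrt v ^ m * (\<integral>x. \<bar>x\<bar> ^ m \<partial>std_normal_distribution))"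
  using var_nonneg by (subst integral_marginal) (auto simp: power_mult_distrib abs_mult)

lemma integral_inner: "(\<integral>w. a \<bullet> w \<partial>G) = 0"
  using integral_inner_power[of a 1] integral_std_normal_distribution_moment_odd[of 1] by simp

lemma integral_inner_power2: "(\<integral>w. (a \<bullet> w)\<^sup>2 \<partial>G) = v * (norm a)\<^sup>2"
  using integral_inner_power[of a 2] std_normal_distribution_even_moments(1)[of 1] var_nonneg by simp

lemma integral_iexp: "(CLINT w|G. iexp (a \<bullet> w)) = exp (- (norm a)\<^sup>2 * v / 2)"
proof -
  have "(CLINT w|G. iexp (a \<bullet> w)) = (CLINT x|std_normal_distribution. iexp (norm a * sqrt v * x))"
    by (rule integral_marginal) simp
  also have "\<dots> = exp (- (complex_of_real (norm a * sqrt v))\<^sup>2 / 2)"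
    using iexp_std_normal[of "norm a * sqrt v"] by simp
  also have "(complex_of_real (norm a * sqrt v))\<^sup>2 = complex_of_real ((norm a)\<^sup>2 * v)"
    unfolding of_real_power[symmetric] power_mult_distrib using var_nonneg by simp
  finally show ?thesis by (simp add: exp_of_real[symmetric])
qed

lemma integrable_iexp: "integrable G (\<lambda>w. iexp (a \<bullet> w))"
  by (rule integrable_const_bound[of _ 1]) auto

lemma integral_cos: "(\<integral>w. cos (y + a \<bullet> w) \<partial>G) = exp (- (norm a)\<^sup>2 * v / 2) * cos y"
proof -
  have "(\<integral>w. cos (y + a \<bullet> w) \<partial>G) = (\<integral>w. Re (cis y * iexp (a \<bullet> w)) \<partial>G)"
    by (intro Bochner_Integration.integral_cong) (auto simp: cis_conv_exp[symmetric] cis_mult)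
  also have "\<dots> = Re (CLINT w|G. cis y * iexp (a \<bullet> w))"
    using integrable_iexp[of a] by (subst integral_Re) auto
  also have "\<dots> = Re (cis y * exp (- (norm a)\<^sup>2 * v / 2))"
    using integral_iexp[of a] integrable_iexp[of a] by simp
  finally show ?thesis by (simp add: exp_of_real mult.commute del: of_real_exp)
qed

text \<open>Weighting \<open>G\<close> with \<open>2 + cos (y + b \<bullet> w) > 0\<close>, \<open>b\<close> orthogonal to \<open>a\<close>, does not change the law
  of \<open>a \<bullet> w\<close>: compare characteristic functions.\<close>

lemma integral_mult_cos:
  fixes F :: "real \<Rightarrow> real"
  assumes ab: "a \<bullet> b = 0" and [measurable]: "F \<in> borel_measurable borel" and bd: "\<And>x. \<bar>F x\<bar> \<le> c"
  shows "(\<integral>w. F (a \<bullet> w) * cos (y + b \<bullet> w) \<partial>G) = exp (- (norm b)\<^sup>2 * v / 2) * cos y * (\<integral>w. F (a \<bullet> w) \<partial>G)"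
proof -
  define \<kappa> where "\<kappa> = exp (- (norm b)\<^sup>2 * v / 2)"
  \<comment> \<open>The mean of 2 + cos (y + b \<bullet> w), positive because |\<kappa> cos y| <= 1;
    dividing by it makes the weight a probability density.\<close>
  define D where "D = 2 + \<kappa> * cos y"
  have "\<bar>\<kappa> * cos y\<bar> \<le> 1"
    unfolding abs_mult using var_nonneg by (intro mult_le_one) (auto simp: \<kappa>_def)
  then have D: "D > 0" by (auto simp: D_def)
  define g where "g w = (2 + cos (y + b \<bullet> w)) / D" for w
  have [measurable]: "g \<in> borel_measurable borel" unfolding g_def by measurable
  have g0: "0 \<le> g w" for w
    unfolding g_def using D cos_ge_minus_one[of "y + b \<bullet> w"] by (intro divide_nonneg_pos) linarith+
  have intc: "integrable G (\<lambda>w. cos (y + b \<bullet> w))"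
    by (rule integrable_const_bound[of _ 1]) auto
  have gint: "integrable G g" unfolding g_def using intc by simp
  have "(\<integral>w. g w \<partial>G) = 1"
    unfolding g_def using intc D integral_cos[of y b] by (simp add: D_def \<kappa>_def prob_space)
  then have nn: "(\<integral>\<^sup>+w. ennreal (g w) \<partial>G) = 1"
    using nn_integral_eq_integral[OF gint] g0 by simp
  define H where "H = density G (\<lambda>w. ennreal (g w))"
  have [measurable_cong, simp]: "sets H = sets borel" by (simp add: H_def)
  interpret H: prob_space H
    by (rule prob_spaceI) (simp add: H_def emeasure_density nn)
  have intH: "(\<integral>w. f w \<partial>H) = (\<integral>w. g w *\<^sub>R f w \<partial>G)" if [measurable]: "f \<in> borel_measurable borel"
    for f :: "'b \<Rightarrow> 'c::{banach, second_countable_topology}"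
    unfolding H_def using g0 by (intro integral_density) auto
  have "distr H borel (\<lambda>w. a \<bullet> w) = distr G borel (\<lambda>w. a \<bullet> w)"
  proof (rule Levy_uniqueness)
    show "real_distribution (distr H borel (\<lambda>w. a \<bullet> w))" "real_distribution (distr G borel (\<lambda>w. a \<bullet> w))"
      by (auto intro!: H.real_distribution_distr real_distribution_distr)
    show "char (distr H borel (\<lambda>w. a \<bullet> w)) = char (distr G borel (\<lambda>w. a \<bullet> w))"
    proof
      fix s
      define u where "u = complex_of_real (exp (- (norm (s *\<^sub>R a))\<^sup>2 * v / 2))"
      \<comment> \<open>Here orthogonality enters: squared norms add, so the characteristic function
        of \<open>G\<close> at s a + b and at s a - b is its value \<open>u\<close> at s a times
        \<kappa>. The three contributions then sum to D u.\<close>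
      have nrm: "(norm (s *\<^sub>R a + b))\<^sup>2 = (norm (s *\<^sub>R a))\<^sup>2 + (norm b)\<^sup>2" "(norm (s *\<^sub>R a - b))\<^sup>2 = (norm (s *\<^sub>R a))\<^sup>2 + (norm b)\<^sup>2"
        using ab by (simp_all add: power2_norm_eq_inner inner_simps inner_commute del: norm_scaleR)
      have ex: "complex_of_real (exp (- ((norm (s *\<^sub>R a))\<^sup>2 + (norm b)\<^sup>2) * v / 2)) = u * of_real \<kappa>"
        unfolding u_def \<kappa>_def of_real_mult[symmetric] exp_add[symmetric] by (simp add: field_simps)
      have "char (distr H borel (\<lambda>w. a \<bullet> w)) s = (CLINT w|H. iexp (s * (a \<bullet> w)))"
        by (simp add: char_def integral_distr)
      also have "\<dots> = (CLINT w|G. g w *\<^sub>R iexp (s * (a \<bullet> w)))"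
        by (rule intH) simp
      also have "\<dots> = (CLINT w|G. (2 * iexp ((s *\<^sub>R a) \<bullet> w) + (cis y * iexp ((s *\<^sub>R a + b) \<bullet> w) + cis (- y) * iexp ((s *\<^sub>R a - b) \<bullet> w)) / 2) / D)"
      proof (rule Bochner_Integration.integral_cong[OF refl])
        fix w
        have c: "complex_of_real (cos (y + b \<bullet> w)) = (cis (y + b \<bullet> w) + cis (- (y + b \<bullet> w))) / 2"
          by (simp add: complex_eq_iff del: minus_add_distrib)
        have i: "iexp r = cis r" for r by (simp add: cis_conv_exp)
        have "cis y * cis ((s *\<^sub>R a + b) \<bullet> w) + cis (- y) * cis ((s *\<^sub>R a - b) \<bullet> w)
          = cis (s * (a \<bullet> w)) * (cis (y + b \<bullet> w) + cis (- (y + b \<bullet> w)))"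
          by (simp add: cis_mult inner_simps algebra_simps)
        then have k: "cis y * cis ((s *\<^sub>R a + b) \<bullet> w) + cis (- y) * cis ((s *\<^sub>R a - b) \<bullet> w)
          = cis (s * (a \<bullet> w)) * (2 * complex_of_real (cos (y + b \<bullet> w)))"
          unfolding c by simp
        show "g w *\<^sub>R iexp (s * (a \<bullet> w)) = (2 * iexp ((s *\<^sub>R a) \<bullet> w) + (cis y * iexp ((s *\<^sub>R a + b) \<bullet> w) + cis (- y) * iexp ((s *\<^sub>R a - b) \<bullet> w)) / 2) / D"
          unfolding i k g_def scaleR_conv_of_real by (simp add: add_divide_distrib distrib_left distrib_right mult.commute)
      qed
      also have "\<dots> = (2 * u + (cis y * (u * \<kappa>) + cis (- y) * (u * \<kappa>)) / 2) / D"
      proof -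
        have "(CLINT w|G. iexp ((s *\<^sub>R a) \<bullet> w)) = u" "(CLINT w|G. iexp ((s *\<^sub>R a + b) \<bullet> w)) = u * of_real \<kappa>"
          "(CLINT w|G. iexp ((s *\<^sub>R a - b) \<bullet> w)) = u * of_real \<kappa>"
          unfolding integral_iexp nrm ex u_def by simp_all
        then show ?thesis
          using integrable_iexp[of "s *\<^sub>R a"] integrable_iexp[of "s *\<^sub>R a + b"] integrable_iexp[of "s *\<^sub>R a - b"]
          by (simp del: inner_add_left inner_diff_left inner_scaleR_left)
      qed
      also have "\<dots> = u"
      proof -
        have "cis y + cis (- y) = 2 * complex_of_real (cos y)"
          by (simp add: complex_eq_iff)
        then have "2 * u + (cis y * (u * \<kappa>) + cis (- y) * (u * \<kappa>)) / 2 = u * complex_of_real D"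
          unfolding distrib_right[symmetric] D_def by (simp add: algebra_simps)
        then show ?thesis using D by simp
      qed
      also have "u = char (distr G borel (\<lambda>w. a \<bullet> w)) s"
        using integral_iexp[of "s *\<^sub>R a"] by (simp add: u_def char_def integral_distr)
      finally show "char (distr H borel (\<lambda>w. a \<bullet> w)) s = char (distr G borel (\<lambda>w. a \<bullet> w)) s" .
    qed
  qed
  then have "(\<integral>x. F x \<partial>distr H borel (\<lambda>w. a \<bullet> w)) = (\<integral>x. F x \<partial>distr G borel (\<lambda>w. a \<bullet> w))" by simp
  then have "(\<integral>w. F (a \<bullet> w) \<partial>H) = (\<integral>w. F (a \<bullet> w) \<partial>G)"
    by (simp add: integral_distr)
  then have "(\<integral>w. g w * F (a \<bullet> w) \<partial>G) = (\<integral>w. F (a \<bullet> w) \<partial>G)"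
    using intH[of "\<lambda>w. F (a \<bullet> w)"] by simp
  also have "(\<integral>w. g w * F (a \<bullet> w) \<partial>G) = (\<integral>w. (2 * F (a \<bullet> w) + F (a \<bullet> w) * cos (y + b \<bullet> w)) / D \<partial>G)"
    by (intro Bochner_Integration.integral_cong) (auto simp: g_def field_simps)
  also have "\<dots> = (2 * (\<integral>w. F (a \<bullet> w) \<partial>G) + (\<integral>w. F (a \<bullet> w) * cos (y + b \<bullet> w) \<partial>G)) / D"
  proof -
    have "integrable G (\<lambda>w. F (a \<bullet> w))"
      using bd by (intro integrable_const_bound[of _ c]) auto
    moreover have "integrable G (\<lambda>w. F (a \<bullet> w) * cos (y + b \<bullet> w))"
    proof (rule integrable_const_bound[of _ c])
      show "AE w in G. norm (F (a \<bullet> w) * cos (y + b \<bullet> w)) \<le> c"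
      proof (rule AE_I2)
        fix w
        have "\<bar>F (a \<bullet> w)\<bar> * \<bar>cos (y + b \<bullet> w)\<bar> \<le> c * 1"
          using bd[of "a \<bullet> w"] by (intro mult_mono) auto
        then show "norm (F (a \<bullet> w) * cos (y + b \<bullet> w)) \<le> c" by (simp add: abs_mult)
      qed
    qed simp
    ultimately show ?thesis by simp
  qed
  finally show ?thesis
    using D unfolding D_def \<kappa>_def[symmetric] by (simp add: field_simps)
qed

text \<open>exp (- |x|) cos y + |x| is harmonic off x = 0, and across that line its x-derivative
  jumps by 2 (1 - cos y) >= 0; so it is subharmonic, and this is its mean value inequality.
  Averaging over the orthogonal direction damps cos y, and norm a = norm b makes the damping the one
  of the one-dimensional inequality.\<close>

lemma integral_kernel_ge:
  assumes "a \<bullet> b = 0" "norm a = norm b"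
  shows "exp (- \<bar>x\<bar>) * cos y + \<bar>x\<bar> \<le> (\<integral>w. exp (- \<bar>x + a \<bullet> w\<bar>) * cos (y + b \<bullet> w) + \<bar>x + a \<bullet> w\<bar> \<partial>G)"
proof -
  define \<sigma> where "\<sigma> = norm a * sqrt v"
  have \<sigma>: "\<sigma> \<ge> 0" "\<sigma>\<^sup>2 = (norm b)\<^sup>2 * v"
    using var_nonneg assms(2) by (auto simp: \<sigma>_def power_mult_distrib)
  have N: "(\<integral>w. f (a \<bullet> w) \<partial>G) = (\<integral>y. f (\<sigma> * y) * std_normal_density y \<partial>lborel)"
    if [measurable]: "f \<in> borel_measurable borel" for f :: "real \<Rightarrow> real"
    unfolding integral_marginal[OF that] \<sigma>_def
    by (subst integral_density) (auto simp: mult.commute)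
  have i1: "integrable G (\<lambda>w. \<bar>x + a \<bullet> w\<bar>)"
    by (intro integrable_abs Bochner_Integration.integrable_add all_moments_integrable[OF all_moments_inner]) simp
  have i2: "integrable G (\<lambda>w. exp (- \<bar>x + a \<bullet> w\<bar>) * cos (y + b \<bullet> w))"
  proof (rule integrable_const_bound[of _ 1])
    show "AE w in G. norm (exp (- \<bar>x + a \<bullet> w\<bar>) * cos (y + b \<bullet> w)) \<le> 1"
      by (intro AE_I2) (simp add: abs_mult mult_le_one)
  qed simp
  have "exp (- \<bar>x\<bar>) * cos y + \<bar>x\<bar> \<le> exp (- \<sigma>\<^sup>2 / 2) * cos y * (\<integral>w. exp (- \<bar>x + a \<bullet> w\<bar>) \<partial>G) + (\<integral>w. \<bar>x + a \<bullet> w\<bar> \<partial>G)"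
    using normal_laplace_abs_ineq[OF \<sigma>(1), of "cos y" x] N[of "\<lambda>t. exp (- \<bar>x + t\<bar>)"] N[of "\<lambda>t. \<bar>x + t\<bar>"] by simp
  also have "exp (- \<sigma>\<^sup>2 / 2) * cos y * (\<integral>w. exp (- \<bar>x + a \<bullet> w\<bar>) \<partial>G)
      = (\<integral>w. exp (- \<bar>x + a \<bullet> w\<bar>) * cos (y + b \<bullet> w) \<partial>G)"
    using integral_mult_cos[OF assms(1), of "\<lambda>t. exp (- \<bar>x + t\<bar>)" 1 y] by (simp add: \<sigma>)
  finally show ?thesis using i1 i2 by simp
qed

text \<open>\<open>E (U + \<mu> V)\<^sup>m\<close> is a polynomial in \<open>\<mu>\<close> which for real \<open>\<mu>\<close> is a multiple of \<open>(1 + \<mu>\<^sup>2)\<^sup>m\<^sup>/\<^sup>2\<close>;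
  so it vanishes at \<open>\<mu> = \<i>\<close>.\<close>

lemma integral_complex_power:
  assumes ab: "a \<bullet> b = 0" "norm a = norm b" and m: "m \<ge> 1"
  shows "(CLINT w|G. (Complex (a \<bullet> w) (b \<bullet> w)) ^ m) = 0"
proof -
  define e where "e k = (\<integral>w. (a \<bullet> w) ^ (m - k) * (b \<bullet> w) ^ k \<partial>G)" for k
  have int: "integrable G (\<lambda>w. (a \<bullet> w) ^ (m - k) * (b \<bullet> w) ^ k)" for k
    by (intro all_moments_integrable all_moments_mult all_moments_power all_moments_inner finite_measure_axioms)
  define P where "P = (\<Sum>k\<le>m. monom (complex_of_real (real (m choose k) * e k)) k)"
  have polyP: "poly P z = (\<Sum>k\<le>m. of_nat (m choose k) * of_real (e k) * z ^ k)" for z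
    by (simp add: P_def poly_sum poly_monom)
  define r where "r = (norm a) ^ m * (sqrt v ^ m * (\<integral>x. x ^ m \<partial>std_normal_distribution))"
  define Q where "Q = (if even m then smult (complex_of_real r) ([:1, 0, 1:] ^ (m div 2)) else 0)"
  have expand: "(\<integral>w. (a \<bullet> w + \<mu> * (b \<bullet> w)) ^ m \<partial>G) = (\<Sum>k\<le>m. real (m choose k) * e k * \<mu> ^ k)" for \<mu>
  proof -
    have "(a \<bullet> w + \<mu> * (b \<bullet> w)) ^ m = (\<Sum>k\<le>m. (real (m choose k) * \<mu> ^ k) * ((a \<bullet> w) ^ (m - k) * (b \<bullet> w) ^ k))" for w
      using binomial_ring[of "\<mu> * (b \<bullet> w)" "a \<bullet> w" m] by (simp add: add.commute power_mult_distrib mult_ac)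
    then show ?thesis using int by (simp add: e_def mult_ac)
  qed
  have "poly P (of_real \<mu>) = poly Q (of_real \<mu>)" for \<mu>
  proof -
    have "poly P (of_real \<mu>) = of_real (\<integral>w. (a \<bullet> w + \<mu> * (b \<bullet> w)) ^ m \<partial>G)"
      unfolding polyP expand by simp
    also have "(\<integral>w. (a \<bullet> w + \<mu> * (b \<bullet> w)) ^ m \<partial>G) = (\<integral>w. ((a + \<mu> *\<^sub>R b) \<bullet> w) ^ m \<partial>G)"
      by (simp add: inner_simps)
    also have "\<dots> = norm (a + \<mu> *\<^sub>R b) ^ m * (sqrt v ^ m * (\<integral>x. x ^ m \<partial>std_normal_distribution))"
      by (rule integral_inner_power)
    also have "of_real \<dots> = poly Q (of_real \<mu>)"
    proof (cases "even m")
      case True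
      then obtain l where l: "m = 2 * l" by blast
      have "(norm (a + \<mu> *\<^sub>R b))\<^sup>2 = (norm a)\<^sup>2 * (1 + \<mu>\<^sup>2)"
        using ab(1) ab(2)[symmetric] unfolding power2_norm_eq_inner
        by (simp add: inner_simps inner_commute norm_eq_sqrt_inner power2_eq_square algebra_simps)
      then have "norm (a + \<mu> *\<^sub>R b) ^ m = norm a ^ m * (1 + \<mu>\<^sup>2) ^ l"
        unfolding l power_mult by (simp add: power_mult_distrib)
      then show ?thesis using l by (simp add: Q_def r_def power2_eq_square mult_ac)
    qed (simp add: Q_def integral_std_normal_distribution_moment_odd)
    finally show ?thesis .
  qed
  then have "\<forall>z\<in>range complex_of_real. poly P z = poly Q z" by auto
  moreover have "infinite (range complex_of_real)"
    using finite_imageD[of complex_of_real UNIV] infinite_UNIV_char_0 by (auto simp: inj_on_def)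
  ultimately have "P = Q"
    using poly_roots_finite[of "P - Q"] finite_subset[of "range complex_of_real" "{z. poly (P - Q) z = 0}"] by auto
  then have "poly P \<i> = 0"
    using m by (cases "even m") (auto simp: Q_def elim!: evenE)
  moreover have "(CLINT w|G. (Complex (a \<bullet> w) (b \<bullet> w)) ^ m) = poly P \<i>"
  proof -
    have "(Complex (a \<bullet> w) (b \<bullet> w)) ^ m = (\<Sum>k\<le>m. (of_nat (m choose k) * \<i> ^ k) * complex_of_real ((a \<bullet> w) ^ (m - k) * (b \<bullet> w) ^ k))" for w
      using binomial_ring[of "\<i> * of_real (b \<bullet> w)" "complex_of_real (a \<bullet> w)" m]
      by (simp add: Complex_eq add.commute power_mult_distrib mult_ac)
    then show ?thesis using int unfolding polyP e_def by (simp add: mult_ac del: of_real_mult of_real_power)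
  qed
  ultimately show ?thesis by simp
qed

lemma integrable_complex_power: "integrable G (\<lambda>w. (Complex (a \<bullet> w) (b \<bullet> w)) ^ m)"
proof (rule Bochner_Integration.integrable_bound)
  have "all_moments G (\<lambda>w. \<bar>a \<bullet> w\<bar> + \<bar>b \<bullet> w\<bar>)"
    by (intro all_moments_add all_moments_abs all_moments_inner)
  then show "integrable G (\<lambda>w. (\<bar>a \<bullet> w\<bar> + \<bar>b \<bullet> w\<bar>) ^ m)"
    by (intro all_moments_integrable_power finite_measure_axioms)
  show "AE w in G. norm ((Complex (a \<bullet> w) (b \<bullet> w)) ^ m) \<le> norm ((\<bar>a \<bullet> w\<bar> + \<bar>b \<bullet> w\<bar>) ^ m)"
    using cmod_le[of "Complex _ _"] by (intro AE_I2) (simp add: norm_power power_mono)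
qed (simp add: Complex_eq)

text \<open>All powers of order at least one of the planar increment have mean zero, so the binomial
  expansion keeps only z^m. This is the one-step form of the martingale property of the powers of
  Z.\<close>

lemma integral_complex_shift_power:
  assumes ab: "a \<bullet> b = 0" "norm a = norm b"
  shows "(CLINT w|G. (z + Complex (a \<bullet> w) (b \<bullet> w)) ^ m) = z ^ m"
proof -
  have "(z + Complex (a \<bullet> w) (b \<bullet> w)) ^ m = (\<Sum>k\<le>m. (of_nat (m choose k) * z ^ (m - k)) * Complex (a \<bullet> w) (b \<bullet> w) ^ k)" for w
    using binomial_ring[of "Complex (a \<bullet> w) (b \<bullet> w)" z m] by (simp add: add.commute mult_ac)
  then have "(CLINT w|G. (z + Complex (a \<bullet> w) (b \<bullet> w)) ^ m)
     = (\<Sum>k\<le>m. (of_nat (m choose k) * z ^ (m - k)) * (CLINT w|G. Complex (a \<bullet> w) (b \<bullet> w) ^ k))"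
    using integrable_complex_power[of a b] by simp
  also have "\<dots> = (\<Sum>k\<le>m. if k = 0 then z ^ m else 0)"
    using integral_complex_power[OF ab] by (intro sum.cong) (auto simp: prob_space)
  finally show ?thesis by simp
qed

end

section \<open>Integral representation of the subharmonic function\<close>

lemma vector_differentiable_bound:
  fixes f :: "real \<Rightarrow> 'b::real_normed_vector"
  assumes "convex S" "\<And>x. x \<in> S \<Longrightarrow> (f has_vector_derivative f' x) (at x within S)"
    "\<And>x. x \<in> S \<Longrightarrow> norm (f' x) \<le> B" "x \<in> S" "y \<in> S"
  shows "norm (f x - f y) \<le> B * norm (x - y)"
  using assms
  by (intro differentiable_bound[of S f "\<lambda>x h. h *\<^sub>R f' x"])
     (auto simp: has_vector_derivative_def onorm_scaleR_left bounded_linear_ident onorm_id)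

lemma norm_exp_minus_one_le:
  fixes w :: complex
  assumes "0 \<le> Re w"
  shows "norm (exp (- w) - 1) \<le> norm w"
proof -
  have "norm ((\<lambda>t. exp (- (complex_of_real t * w))) 1 - (\<lambda>t. exp (- (complex_of_real t * w))) 0) \<le> norm w * norm (1 - 0 :: real)"
  proof (rule vector_differentiable_bound[of "{0..1::real}" _ "\<lambda>t. - w * exp (- (complex_of_real t * w))"])
    fix t :: real assume t: "t \<in> {0..1}"
    show "((\<lambda>t. exp (- (complex_of_real t * w))) has_vector_derivative - w * exp (- (complex_of_real t * w))) (at t within {0..1})"
      by (rule has_vector_derivative_real_field[of "\<lambda>z. exp (- (z * w))"])
         (auto intro!: derivative_eq_intros)
    have "norm (exp (- (complex_of_real t * w))) \<le> 1" using assms t by simp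
    then show "norm (- w * exp (- (complex_of_real t * w))) \<le> norm w"
      by (simp add: norm_mult mult_left_le)
  qed auto
  then show ?thesis by simp
qed

text \<open>exp (- w) minus its first-order Taylor polynomial at 0. The subtraction makes it
  quadratically small at 0, while it still grows only linearly on the right half plane; these two
  rates are what the weight s^(-p-1) can bear.\<close>

definition exp_rem :: "complex \<Rightarrow> complex" where
  "exp_rem w = exp (- w) - 1 + w"

lemma norm_exp_rem_le:
  assumes "0 \<le> Re w"
  shows "norm (exp_rem w) \<le> (norm w)\<^sup>2" "norm (exp_rem w) \<le> 2 * norm w"
proof -
  show "norm (exp_rem w) \<le> 2 * norm w"
    unfolding exp_rem_def using norm_exp_minus_one_le[OF assms] norm_triangle_ineq[of "exp (- w) - 1" w] by linarith
  have "norm ((\<lambda>t. exp_rem (complex_of_real t * w)) 1 - (\<lambda>t. exp_rem (complex_of_real t * w)) 0) \<le> (norm w)\<^sup>2 * norm (1 - 0 :: real)"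
  proof (rule vector_differentiable_bound[of "{0..1::real}" _ "\<lambda>t. w * (1 - exp (- (complex_of_real t * w)))"])
    fix t :: real assume t: "t \<in> {0..1}"
    show "((\<lambda>t. exp_rem (complex_of_real t * w)) has_vector_derivative w * (1 - exp (- (complex_of_real t * w)))) (at t within {0..1})"
      unfolding exp_rem_def
      by (rule has_vector_derivative_real_field[of "\<lambda>z. exp (- (z * w)) - 1 + z * w"])
         (auto intro!: derivative_eq_intros simp: algebra_simps)
    have "norm (1 - exp (- (complex_of_real t * w))) \<le> norm (complex_of_real t * w)"
      using norm_exp_minus_one_le[of "complex_of_real t * w"] assms t by (simp add: norm_minus_commute)
    also have "\<dots> \<le> norm w" using t by (simp add: norm_mult mult_left_le_one_le)
    finally show "norm (w * (1 - exp (- (complex_of_real t * w)))) \<le> (norm w)\<^sup>2"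
      by (simp add: norm_mult power2_eq_square mult_left_mono)
  qed auto
  then show "norm (exp_rem w) \<le> (norm w)\<^sup>2" by (simp add: exp_rem_def)
qed

context
  fixes p :: real
  assumes p: "1 < p" "p < 2"
begin

text \<open>The quadratic bound of the remainder leaves s^(1-p) near 0 and the linear bound leaves
  s^(-p) near infinity; both are integrable exactly for 1 < p < 2.\<close>

definition kernel_dom :: "real \<Rightarrow> real" where
  "kernel_dom s = indicator {0..1} s * s powr (1 - p) + indicator {1..} s * s powr (- p)"

lemma integrable_powr_indicator:
  fixes A :: "real set"
  assumes "(\<lambda>s. s powr c) integrable_on A" "A \<in> sets borel"
  shows "integrable lborel (\<lambda>s. indicator A s * s powr c)"
proof -
  have "set_integrable lebesgue A (\<lambda>s. s powr c)"
    using assms(1) by (intro nonnegative_absolutely_integrable_1) auto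
  then have "integrable lebesgue (\<lambda>s. indicator A s * s powr c)"
    by (simp add: set_integrable_def)
  moreover have "(\<lambda>s. indicator A s * s powr c) \<in> borel_measurable lborel"
    using assms(2) by measurable
  ultimately show ?thesis
    by (simp add: integrable_completion)
qed

lemma integrable_kernel_dom: "integrable lborel kernel_dom"
proof -
  have "integrable lborel (\<lambda>s::real. indicator {0..1} s * s powr (1 - p))"
    using p by (intro integrable_powr_indicator integrable_on_powr_from_0) auto
  moreover have "((\<lambda>s. s powr (- p)) has_integral -(1 powr (- p + 1)) / (- p + 1)) {1..}"
    using p by (intro has_integral_powr_to_inf) auto
  then have "integrable lborel (\<lambda>s::real. indicator {1..} s * s powr (- p))"
    by (intro integrable_powr_indicator) (auto simp: integrable_on_def)
  ultimately show ?thesis unfolding kernel_dom_def by simp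
qed

lemma kernel_dom_nonneg: "0 \<le> kernel_dom s"
  by (simp add: kernel_dom_def)

definition kernel :: "complex \<Rightarrow> real \<Rightarrow> complex" where
  "kernel w s = (indicator {0<..} s * s powr (- p - 1)) *\<^sub>R exp_rem (of_real s * w)"

lemma norm_kernel_le:
  assumes w: "0 \<le> Re w"
  shows "norm (kernel w s) \<le> ((norm w)\<^sup>2 + 2 * norm w) * kernel_dom s"
proof (cases "s > 0")
  case True
  have re: "0 \<le> Re (of_real s * w)" using w True by simp
  have e: "s powr (- p - 1) * s\<^sup>2 = s powr (1 - p)" "s powr (- p - 1) * s = s powr (- p)"
    using True by (simp_all add: powr_diff powr_minus field_simps power2_eq_square)
  show ?thesis
  proof (cases "s \<le> 1")
    case s1: True
    have "norm (kernel w s) \<le> s powr (- p - 1) * (s\<^sup>2 * (norm w)\<^sup>2)"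
      using norm_exp_rem_le(1)[OF re] True
      by (auto simp: kernel_def norm_mult power_mult_distrib intro!: mult_left_mono)
    also have "\<dots> = (norm w)\<^sup>2 * s powr (1 - p)" using e(1) by (simp add: mult_ac)
    also have "\<dots> \<le> ((norm w)\<^sup>2 + 2 * norm w) * kernel_dom s"
      using True s1 by (intro mult_mono) (auto simp: kernel_dom_def)
    finally show ?thesis .
  next
    case s1: False
    have "norm (kernel w s) \<le> s powr (- p - 1) * (s * (2 * norm w))"
      using norm_exp_rem_le(2)[OF re] True
      by (auto simp: kernel_def norm_mult intro!: mult_left_mono)
    also have "\<dots> = (2 * norm w) * s powr (- p)" unfolding e(2)[symmetric] by (simp add: mult_ac)
    also have "\<dots> \<le> ((norm w)\<^sup>2 + 2 * norm w) * kernel_dom s"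
      using True s1 by (intro mult_mono) (auto simp: kernel_dom_def)
    finally show ?thesis .
  qed
qed (simp add: kernel_def kernel_dom_nonneg)

lemma measurable_kernel [measurable]: "kernel w \<in> borel_measurable borel"
proof -
  have [measurable]: "exp_rem \<in> borel_measurable borel"
    unfolding exp_rem_def by (intro borel_measurable_continuous_onI continuous_intros)
  show ?thesis unfolding kernel_def by measurable
qed

lemma integrable_kernel: "0 \<le> Re w \<Longrightarrow> integrable lborel (kernel w)"
proof (rule Bochner_Integration.integrable_bound[of _ "\<lambda>s. ((norm w)\<^sup>2 + 2 * norm w) * kernel_dom s"])
  assume w: "0 \<le> Re w"
  show "AE s in lborel. norm (kernel w s) \<le> norm (((norm w)\<^sup>2 + 2 * norm w) * kernel_dom s)"
    using norm_kernel_le[OF w] kernel_dom_nonneg by (intro AE_I2) (simp add: abs_mult)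
qed (use integrable_kernel_dom in auto)

text \<open>In closed form this is Gamma (- p) times the principal power w^p on the closed right
  half plane. What is proved of it is homogeneity in modulus and argument and positivity at
  1.\<close>

definition kernel_int :: "complex \<Rightarrow> complex" where
  "kernel_int w = (\<integral>s. kernel w s \<partial>lborel)"

text \<open>A contour rotation carried out as differentiation in the angle: the angular derivative
  of the integrand is an exact derivative in \<open>s\<close>, so the integral over [a, b] changes
  only by boundary terms. These are of order b^(1-p) and a^(2-p).\<close>

lemma kernel_int_truncated_rotation:
  fixes r \<theta> a b :: real
  assumes r: "0 \<le> r" and th: "\<bar>\<theta>\<bar> \<le> pi / 2" and ab: "0 < a" "a \<le> b"
  shows "norm (cis (- p * \<theta>) * integral {a..b} (kernel (r * cis \<theta>)) - integral {a..b} (kernel (complex_of_real r)))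
    \<le> (2 * r * b powr (1 - p) + r\<^sup>2 * a powr (2 - p)) * \<bar>\<theta>\<bar>"
proof -
  define f where "f x s = cis (- p * x) * ((s powr (- p - 1)) *\<^sub>R exp_rem (of_real s * (of_real r * cis x)))" for x s :: real
  \<comment> \<open>For s > 0, s times \<open>f x s\<close> depends only on the product of
    \<open>s\<close> and \<open>cis x\<close>. Hence the x-derivative of \<open>f\<close> is the
    s-derivative of \<i> s f, and \<open>u\<close> is this primitive.\<close>
  define u where "u x s = \<i> * cis (- p * x) * ((s powr (- p)) *\<^sub>R exp_rem (of_real s * (of_real r * cis x)))" for x s :: real
  define f' where "f' x s = - \<i> * of_real p * f x s + cis (- p * x) * ((s powr (- p - 1)) *\<^sub>R
     (\<i> * of_real s * (of_real r * cis x) * (1 - exp (- (of_real s * (of_real r * cis x))))))" for x s :: real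
  \<comment> \<open>On this range of angles the argument of \<open>exp_rem\<close> stays in the
    right half plane, where its bounds hold.\<close>
  define U where "U = {- pi / 2 .. pi / 2}"
  have fd: "((\<lambda>x. f x s) has_vector_derivative f' x s) (at x within U)" for x s
  proof -
    have "f x s = exp (- \<i> * of_real p * of_real x) * ((s powr (- p - 1)) *\<^sub>R (exp (- (of_real s * (of_real r * exp (\<i> * of_real x)))) - 1 + of_real s * (of_real r * exp (\<i> * of_real x))))" for x
      by (simp add: f_def exp_rem_def cis_conv_exp mult.assoc)
    moreover have "((\<lambda>x. exp (- \<i> * of_real p * of_real x) * ((s powr (- p - 1)) *\<^sub>R (exp (- (of_real s * (of_real r * exp (\<i> * of_real x)))) - 1 + of_real s * (of_real r * exp (\<i> * of_real x))))) has_vector_derivative f' x s) (at x within U)"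
      by (rule has_vector_derivative_real_field[of "\<lambda>z. exp (- \<i> * of_real p * z) * ((s powr (- p - 1)) *\<^sub>R (exp (- (of_real s * (of_real r * exp (\<i> * z)))) - 1 + of_real s * (of_real r * exp (\<i> * z))))"])
         (auto intro!: derivative_eq_intros simp: f'_def f_def exp_rem_def cis_conv_exp scaleR_conv_of_real algebra_simps)
    ultimately show ?thesis by simp
  qed
  have ud: "((u x) has_vector_derivative f' x s) (at s within {a..b})" if "s \<in> {a..b}" for x s
  proof -
    have s: "s > 0" using that ab by auto
    define w where "w = of_real r * cis x"
    have 1: "((\<lambda>s. s powr (- p)) has_field_derivative (- p * s powr (- p - 1))) (at s within {a..b})"
      using s by (auto intro!: derivative_eq_intros)
    have 2: "((\<lambda>s. exp_rem (of_real s * w)) has_vector_derivative w * (1 - exp (- (of_real s * w)))) (at s within {a..b})"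
      unfolding exp_rem_def
      by (rule has_vector_derivative_real_field[of "\<lambda>z. exp (- (z * w)) - 1 + z * w"])
         (auto intro!: derivative_eq_intros simp: algebra_simps)
    have "(u x has_vector_derivative (\<i> * cis (- p * x)) * (s powr (- p) *\<^sub>R (w * (1 - exp (- (of_real s * w))))
        + (- p * s powr (- p - 1)) *\<^sub>R exp_rem (of_real s * w))) (at s within {a..b})"
      unfolding u_def w_def[symmetric]
      by (intro has_vector_derivative_mult_right has_vector_derivative_scaleR 1 2)
    moreover have "s powr (- p) = s * s powr (- p - 1)" using s by (simp add: powr_mult_base)
    ultimately show ?thesis
      by (simp add: f'_def f_def w_def scaleR_conv_of_real algebra_simps)
  qed
  have ucont: "continuous_on (U \<times> {a..b}) (\<lambda>(x, s). f' x s)"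
    unfolding f'_def f_def exp_rem_def split_beta using ab
    by (intro continuous_intros) auto
  have fcont: "continuous_on {a..b} (f x)" for x
    unfolding f_def exp_rem_def using ab by (intro continuous_intros) auto
  have fint: "f x integrable_on cbox a b" for x
    using fcont[of x] by (simp add: integrable_continuous_interval)
  have fk: "integral {a..b} (f x) = cis (- p * x) * integral {a..b} (kernel (r * cis x))" for x
  proof -
    have "integral {a..b} (f x) = integral {a..b} (\<lambda>s. cis (- p * x) * kernel (r * cis x) s)"
      using ab by (intro integral_cong) (auto simp: f_def kernel_def)
    then show ?thesis by simp
  qed
  have der: "((\<lambda>x. integral (cbox a b) (f x)) has_vector_derivative u x b - u x a) (at x within U)" if "x \<in> U" for x
  proof -
    have "((\<lambda>x. integral (cbox a b) (f x)) has_vector_derivative integral (cbox a b) (f' x)) (at x within U)"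
      using fd fint ucont that by (intro leibniz_rule_vector_derivative) (auto simp: U_def)
    moreover have "integral (cbox a b) (f' x) = u x b - u x a"
      using fundamental_theorem_of_calculus[of a b "u x" "f' x"] ud ab by (simp add: integral_unique)
    ultimately show ?thesis by simp
  qed
  define Bd where "Bd = 2 * r * b powr (1 - p) + r\<^sup>2 * a powr (2 - p)"
  have "norm (integral (cbox a b) (f \<theta>) - integral (cbox a b) (f 0)) \<le> Bd * norm (\<theta> - 0)"
  proof (rule vector_differentiable_bound[of U "\<lambda>x. integral (cbox a b) (f x)" "\<lambda>x. u x b - u x a"])
    fix x assume x: "x \<in> U"
    then have re: "0 \<le> Re (of_real s * (of_real r * cis x))" if "s \<ge> 0" for s
      using that r by (auto simp: U_def intro!: mult_nonneg_nonneg cos_ge_zero)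
    have "norm (u x b) \<le> b powr (- p) * (2 * (b * r))"
      using norm_exp_rem_le(2)[OF re[of b]] ab r by (auto simp: u_def norm_mult intro!: mult_left_mono)
    also have "\<dots> = 2 * r * b powr (1 - p)"
      using ab by (simp add: powr_diff powr_minus field_simps)
    finally have 1: "norm (u x b) \<le> 2 * r * b powr (1 - p)" .
    have "norm (u x a) \<le> a powr (- p) * (a * r)\<^sup>2"
      using norm_exp_rem_le(1)[OF re[of a]] ab r by (auto simp: u_def norm_mult intro!: mult_left_mono)
    also have "\<dots> = r\<^sup>2 * a powr (2 - p)"
      using ab by (simp add: powr_diff powr_minus field_simps)
    finally have 2: "norm (u x a) \<le> r\<^sup>2 * a powr (2 - p)" .
    show "norm (u x b - u x a) \<le> Bd"
      using 1 2 norm_triangle_ineq4[of "u x b" "u x a"] by (simp add: Bd_def)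
  qed (use der th in \<open>auto simp: U_def\<close>)
  then show ?thesis using fk[of \<theta>] fk[of 0] by (simp add: Bd_def)
qed

text \<open>Cutting off at 1 / (n + 1) and n + 1 makes both boundary terms of the rotation vanish in
  the limit, since 1 - p < 0 < 2 - p. Together with scaling this yields the power w^p on the half
  plane.\<close>

lemma kernel_int_rotation:
  fixes r \<theta> :: real
  assumes r: "0 \<le> r" and th: "\<bar>\<theta>\<bar> \<le> pi / 2"
  shows "kernel_int (r * cis \<theta>) = cis (p * \<theta>) * kernel_int (complex_of_real r)"
proof -
  have lim: "(\<lambda>n. integral {1 / real (Suc n) .. real (Suc n)} (kernel w)) \<longlonglongrightarrow> kernel_int w" if w: "0 \<le> Re w" for w
  proof -
    have eq: "integral {1 / real (Suc n) .. real (Suc n)} (kernel w) = (\<integral>s. indicator {1 / real (Suc n) .. real (Suc n)} s *\<^sub>R kernel w s \<partial>lborel)" for n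
    proof -
      have "set_integrable lborel {1 / real (Suc n) .. real (Suc n)} (kernel w)"
        unfolding set_integrable_def using integrable_kernel[OF w] by (intro integrable_mult_indicator) auto
      from set_borel_integral_eq_integral(2)[OF this] show ?thesis
        by (simp add: set_lebesgue_integral_def)
    qed
    show ?thesis unfolding eq kernel_int_def
    proof (rule integral_dominated_convergence[where w = "\<lambda>s. norm (kernel w s)"])
      show "AE s in lborel. (\<lambda>n. indicator {1 / real (Suc n)..real (Suc n)} s *\<^sub>R kernel w s) \<longlonglongrightarrow> kernel w s"
      proof (rule AE_I2)
        fix s :: real
        show "(\<lambda>n. indicator {1 / real (Suc n)..real (Suc n)} s *\<^sub>R kernel w s) \<longlonglongrightarrow> kernel w s"
        proof (cases "s > 0")
          case True
          obtain N where N: "real N > max s (1 / s)" using reals_Archimedean2 by blast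
          have "\<forall>\<^sub>F n in sequentially. indicator {1 / real (Suc n)..real (Suc n)} s *\<^sub>R kernel w s = kernel w s"
          proof (rule eventually_sequentiallyI[of N])
            fix n assume "N \<le> n"
            then have "real (Suc n) \<ge> s" "1 / s \<le> real (Suc n)" using N by auto
            then have "s \<in> {1 / real (Suc n)..real (Suc n)}" using True by (simp add: field_simps)
            then show "indicator {1 / real (Suc n)..real (Suc n)} s *\<^sub>R kernel w s = kernel w s" by simp
          qed
          then show ?thesis by (rule tendsto_eventually)
        qed (simp add: kernel_def)
      qed
      show "AE s in lborel. norm (indicator {1 / real (Suc n)..real (Suc n)} s *\<^sub>R kernel w s) \<le> norm (kernel w s)" for n
        by (intro AE_I2) (auto simp: indicator_def)
    qed (use integrable_kernel[OF w] in auto)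
  qed
  define e where "e n = 2 * r * real (Suc n) powr (1 - p) + r\<^sup>2 * (1 / real (Suc n)) powr (2 - p)" for n
  have "e \<longlonglongrightarrow> 2 * r * 0 + r\<^sup>2 * 0"
    unfolding e_def
  proof (intro tendsto_intros)
    have "((\<lambda>x::real. x powr (1 - p)) \<longlongrightarrow> 0) at_top"
      using p by (intro tendsto_neg_powr filterlim_ident) auto
    then show "(\<lambda>n. real (Suc n) powr (1 - p)) \<longlonglongrightarrow> 0"
      by (rule filterlim_compose) (rule filterlim_compose[OF filterlim_real_sequentially filterlim_Suc])
    have "((\<lambda>x::real. x powr (p - 2)) \<longlongrightarrow> 0) at_top"
      using p by (intro tendsto_neg_powr filterlim_ident) auto
    then have "(\<lambda>n. real (Suc n) powr (p - 2)) \<longlonglongrightarrow> 0"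
      by (rule filterlim_compose) (rule filterlim_compose[OF filterlim_real_sequentially filterlim_Suc])
    moreover have "(1 / real (Suc n)) powr (2 - p) = real (Suc n) powr (p - 2)" for n
      by (simp add: powr_divide powr_diff field_simps)
    ultimately show "(\<lambda>n. (1 / real (Suc n)) powr (2 - p)) \<longlonglongrightarrow> 0" by simp
  qed
  then have "e \<longlonglongrightarrow> 0" by simp
  then have e0: "(\<lambda>n. e n * \<bar>\<theta>\<bar>) \<longlonglongrightarrow> 0" by (rule tendsto_mult_left_zero)
  have re: "0 \<le> Re (r * cis \<theta>)" "0 \<le> Re (complex_of_real r)"
    using r th by (auto intro!: mult_nonneg_nonneg cos_ge_zero)
  have "(\<lambda>n. cis (- p * \<theta>) * integral {1 / real (Suc n)..real (Suc n)} (kernel (r * cis \<theta>))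
       - integral {1 / real (Suc n)..real (Suc n)} (kernel (complex_of_real r))) \<longlonglongrightarrow> cis (- p * \<theta>) * kernel_int (r * cis \<theta>) - kernel_int (complex_of_real r)"
    by (intro tendsto_intros lim re)
  moreover have "(\<lambda>n. cis (- p * \<theta>) * integral {1 / real (Suc n)..real (Suc n)} (kernel (r * cis \<theta>))
       - integral {1 / real (Suc n)..real (Suc n)} (kernel (complex_of_real r))) \<longlonglongrightarrow> 0"
  proof (rule Lim_null_comparison[OF _ e0], rule always_eventually, rule allI)
    fix n
    have "1 / real (Suc n) \<le> 1" "1 \<le> real (Suc n)" by auto
    then have "1 / real (Suc n) \<le> real (Suc n)" by linarith
    then show "norm (cis (- p * \<theta>) * integral {1 / real (Suc n)..real (Suc n)} (kernel (r * cis \<theta>))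
       - integral {1 / real (Suc n)..real (Suc n)} (kernel (complex_of_real r))) \<le> e n * \<bar>\<theta>\<bar>"
      unfolding e_def by (intro kernel_int_truncated_rotation r th) auto
  qed
  ultimately have "cis (- p * \<theta>) * kernel_int (r * cis \<theta>) = kernel_int (complex_of_real r)"
    using LIMSEQ_unique by fastforce
  then have "cis (p * \<theta>) * (cis (- p * \<theta>) * kernel_int (r * cis \<theta>)) = cis (p * \<theta>) * kernel_int (complex_of_real r)"
    by simp
  then show ?thesis by (simp add: mult.assoc[symmetric] cis_mult)
qed

lemma kernel_int_scale:
  fixes r :: real
  assumes "r > 0"
  shows "kernel_int (complex_of_real r) = r powr p *\<^sub>R kernel_int 1"
proof -
  have "kernel_int 1 = \<bar>r\<bar> *\<^sub>R (\<integral>s. kernel 1 (0 + r * s) \<partial>lborel)"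
    unfolding kernel_int_def using assms by (intro lborel_integral_real_affine) auto
  also have "(\<lambda>s. kernel 1 (0 + r * s)) = (\<lambda>s. r powr (- p - 1) *\<^sub>R kernel (complex_of_real r) s)"
    using assms by (auto simp: kernel_def fun_eq_iff indicator_def zero_less_mult_iff powr_mult mult.commute)
  finally have "kernel_int 1 = (r * r powr (- p - 1)) *\<^sub>R kernel_int (complex_of_real r)"
    using assms by (simp add: kernel_int_def)
  also have "r * r powr (- p - 1) = r powr (- p)"
    using assms by (simp add: powr_mult_base)
  finally show ?thesis using assms by (simp add: powr_minus)
qed

lemma kernel_int_one: "kernel_int 1 = complex_of_real (Re (kernel_int 1))" "0 < Re (kernel_int 1)"
proof -
  define g where "g s = indicator {0<..} s * s powr (- p - 1) * (exp (- s) - 1 + s)" for s :: real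
  have k: "kernel 1 = (\<lambda>s. complex_of_real (g s))"
    by (auto simp: kernel_def g_def exp_rem_def fun_eq_iff scaleR_conv_of_real exp_of_real[symmetric])
  show *: "kernel_int 1 = complex_of_real (Re (kernel_int 1))"
    unfolding kernel_int_def k by simp
  have int: "integrable lborel g"
    using integrable_kernel[of 1] unfolding k by (simp add: complex_of_real_integrable_eq)
  have pos: "g s > 0" if "s > 0" for s
    using that exp_minus_greater[of s] by (simp add: g_def)
  have ge: "g s \<ge> 0" for s using pos[of s] by (cases "s > 0") (auto simp: g_def)
  have "integral\<^sup>L lborel g \<noteq> 0"
  proof
    assume "integral\<^sup>L lborel g = 0"
    then have "AE s in lborel. g s = 0"
      using integral_nonneg_eq_0_iff_AE[OF int] ge by auto
    then have "AE s in lborel. s \<notin> {0<..1::real}"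
      by eventually_elim (use pos in force)
    then have "emeasure lborel {0<..1::real} = 0"
      by (subst (asm) AE_iff_measurable[of "{0<..1}"]) auto
    then show False by simp
  qed
  moreover have "integral\<^sup>L lborel g \<ge> 0" using ge by simp
  ultimately show "0 < Re (kernel_int 1)"
    unfolding kernel_int_def k by simp
qed

end

section \<open>Essen's inequality in the plane and its integrated form\<close>

context
  fixes p :: real
  assumes p: "1 < p" "p < 2"
begin

text \<open>The factor of cos (p \<theta>) in the trigonometric inequality, divided by the value at
  1: at modulus r and angle \<theta> the real part of \<open>kernel_int\<close> is that value times
  r^p cos (p \<theta>).\<close>

definition essen_const :: real where
  "essen_const = sin (pi / (2 * p)) powr (p - 1) / cos (pi / (2 * p)) / Re (kernel_int p 1)"

lemma essen_const_pos: "essen_const > 0"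
proof -
  have "0 < pi / (2 * p)" "pi / (2 * p) < pi / 2" using p by (auto simp: field_simps)
  then have "sin (pi / (2 * p)) > 0" "cos (pi / (2 * p)) > 0"
    by (auto intro!: sin_gt_zero cos_gt_zero)
  then show ?thesis unfolding essen_const_def using kernel_int_one(2)[OF p] by simp
qed

text \<open>The point |x| + \<i> y has an angle between -pi/2 and pi/2, and all terms are
  homogeneous of degree p in its modulus; what remains is the trigonometric inequality.\<close>

lemma essen_ineq:
  fixes x y :: real
  shows "\<bar>y\<bar> powr p \<le> tan (pi / (2 * p)) powr p * \<bar>x\<bar> powr p - essen_const * Re (kernel_int p (Complex \<bar>x\<bar> y))"
proof (cases "x = 0 \<and> y = 0")
  case True
  then have "Complex \<bar>x\<bar> y = 0" by (simp add: complex_eq_iff)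
  moreover have "kernel_int p 0 = 0"
    unfolding kernel_int_def[OF p] kernel_def[OF p] exp_rem_def by simp
  ultimately show ?thesis using True by simp
next
  case False
  define z where "z = Complex \<bar>x\<bar> y"
  define r \<theta> where "r = norm z" and "\<theta> = Arg z"
  have z0: "z \<noteq> 0" using False by (simp add: z_def complex_eq_iff)
  then have r: "r > 0" by (simp add: r_def)
  have zr: "z = of_real r * cis \<theta>"
    unfolding r_def \<theta>_def using rcis_cmod_Arg[of z] by (simp add: rcis_def)
  have th: "\<bar>\<theta>\<bar> \<le> pi / 2"
    unfolding \<theta>_def using Arg_Re_nonneg[of z] by (simp add: z_def)
  have xr: "\<bar>x\<bar> = r * cos \<bar>\<theta>\<bar>" and yr: "\<bar>y\<bar> = r * sin \<bar>\<theta>\<bar>"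
  proof -
    have "Re z = r * cos \<theta>" "Im z = r * sin \<theta>" unfolding zr by auto
    moreover have "sin \<bar>\<theta>\<bar> \<ge> 0" using th by (intro sin_ge_zero) auto
    then have "\<bar>sin \<theta>\<bar> = sin \<bar>\<theta>\<bar>" by (auto simp: abs_if split: if_splits)
    ultimately show "\<bar>x\<bar> = r * cos \<bar>\<theta>\<bar>" "\<bar>y\<bar> = r * sin \<bar>\<theta>\<bar>"
      using r by (auto simp: z_def abs_mult)
  qed
  have pos: "cos \<bar>\<theta>\<bar> \<ge> 0" "sin \<bar>\<theta>\<bar> \<ge> 0" using th by (auto intro!: sin_ge_zero cos_ge_zero)
  have "Re (kernel_int p z) = r powr p * Re (kernel_int p 1) * cos (p * \<bar>\<theta>\<bar>)"
  proof -
    have "kernel_int p z = cis (p * \<theta>) * (r powr p *\<^sub>R complex_of_real (Re (kernel_int p 1)))"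
      unfolding zr using kernel_int_rotation[OF p _ th, of r] kernel_int_scale[OF p r] kernel_int_one(1)[OF p] r by simp
    moreover have "cos (p * \<bar>\<theta>\<bar>) = cos (p * \<theta>)" by (simp add: abs_if)
    ultimately show ?thesis by (simp add: mult_ac)
  qed
  moreover have "sin \<bar>\<theta>\<bar> powr p \<le> tan (pi / (2 * p)) powr p * cos \<bar>\<theta>\<bar> powr p - (essen_const * Re (kernel_int p 1)) * cos (p * \<bar>\<theta>\<bar>)"
    using essen_trig_ineq[OF p, of "\<bar>\<theta>\<bar>"] th kernel_int_one(2)[OF p] by (simp add: essen_const_def)
  then have "r powr p * sin \<bar>\<theta>\<bar> powr p \<le> r powr p * (tan (pi / (2 * p)) powr p * cos \<bar>\<theta>\<bar> powr p - (essen_const * Re (kernel_int p 1)) * cos (p * \<bar>\<theta>\<bar>))"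
    by (intro mult_left_mono) auto
  moreover have "\<bar>x\<bar> powr p = r powr p * cos \<bar>\<theta>\<bar> powr p" "\<bar>y\<bar> powr p = r powr p * sin \<bar>\<theta>\<bar> powr p"
    unfolding xr yr using r pos by (simp_all add: powr_mult)
  ultimately show ?thesis
    unfolding z_def[symmetric] by (simp add: right_diff_distrib mult_ac)
qed

text \<open>The 1 in \<open>ge\<close> is the value of the kernel function at the origin, where the
  processes start. Subtracting it leaves the real part of \<open>exp_rem\<close>, whose mixture over
  s is \<open>kernel_int\<close>, so the last term of Essen's inequality has a favourable sign after
  integration. Second moments supply the domination for Fubini's theorem and the finiteness of p-th
  moments.\<close>

lemma integral_powr_le_of_kernel:
  fixes X Y :: "'a \<Rightarrow> real"
  assumes "prob_space M"
    and X: "X \<in> borel_measurable M" "integrable M (\<lambda>\<omega>. (X \<omega>)\<^sup>2)"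
    and Y: "Y \<in> borel_measurable M" "integrable M (\<lambda>\<omega>. (Y \<omega>)\<^sup>2)"
    and ge: "\<And>s. s > 0 \<Longrightarrow> 1 \<le> (\<integral>\<omega>. exp (- \<bar>s * X \<omega>\<bar>) * cos (s * Y \<omega>) + \<bar>s * X \<omega>\<bar> \<partial>M)"
  shows "(\<integral>\<^sup>+\<omega>. ennreal (\<bar>Y \<omega>\<bar> powr p) \<partial>M) \<le> ennreal (tan (pi / (2 * p)) powr p) * (\<integral>\<^sup>+\<omega>. ennreal (\<bar>X \<omega>\<bar> powr p) \<partial>M)"
proof -
  interpret prob_space M by fact
  note [measurable] = X(1) Y(1)
  have pw: "integrable M (\<lambda>\<omega>. \<bar>f \<omega>\<bar> powr p)" "integrable M f" if "f \<in> borel_measurable M" "integrable M (\<lambda>\<omega>. (f \<omega>)\<^sup>2)" for f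
  proof -
    note [measurable] = that(1)
    show "integrable M f" using that by (rule square_integrable_imp_integrable)
    have le: "\<bar>a\<bar> powr p \<le> 1 + a\<^sup>2" for a :: real
    proof (cases "\<bar>a\<bar> \<le> 1")
      case True
      then have "\<bar>a\<bar> powr p \<le> 1" using p by (intro powr_le1) auto
      then show ?thesis by (smt (verit) zero_le_power2)
    next
      case False
      then have "\<bar>a\<bar> powr p \<le> \<bar>a\<bar> powr 2" using p by (intro powr_mono) auto
      then show ?thesis using False by (simp add: powr_numeral)
    qed
    show "integrable M (\<lambda>\<omega>. \<bar>f \<omega>\<bar> powr p)"
      by (rule Bochner_Integration.integrable_bound[of _ "\<lambda>\<omega>. 1 + (f \<omega>)\<^sup>2"])
         (use le that in \<open>auto intro!: AE_I2\<close>)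
  qed
  interpret pair_sigma_finite M lborel ..
  define Z where "Z \<omega> = Complex \<bar>X \<omega>\<bar> (Y \<omega>)" for \<omega>
  have [measurable]: "Z \<in> borel_measurable M" unfolding Z_def Complex_eq by measurable
  define k where "k \<omega> s = Re (kernel p (Z \<omega>) s)" for \<omega> s
  have kd: "k \<omega> s = indicator {0<..} s * s powr (- p - 1) * (exp (- \<bar>s * X \<omega>\<bar>) * cos (s * Y \<omega>) + \<bar>s * X \<omega>\<bar> - 1)" for \<omega> s
    by (auto simp: k_def kernel_def[OF p] exp_rem_def Z_def Re_exp abs_mult indicator_def)
  have km[measurable]: "(\<lambda>(\<omega>, s). k \<omega> s) \<in> borel_measurable (M \<Otimes>\<^sub>M lborel)"
    unfolding kd by measurable
  have Re0: "0 \<le> Re (Z \<omega>)" for \<omega> by (simp add: Z_def)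
  have int: "integrable (M \<Otimes>\<^sub>M lborel) (\<lambda>(\<omega>, s). k \<omega> s)"
  proof (rule Bochner_Integration.integrable_bound[of _ "\<lambda>x. ((norm (Z (fst x)))\<^sup>2 + 2 * norm (Z (fst x))) * kernel_dom p (snd x)"])
    have "integrable M (\<lambda>\<omega>. (norm (Z \<omega>))\<^sup>2)"
      using X Y by (simp add: Z_def cmod_power2)
    moreover from this have "integrable M (\<lambda>\<omega>. norm (Z \<omega>))"
      using pw(2)[of "\<lambda>\<omega>. norm (Z \<omega>)"] by simp
    ultimately have iz: "integrable M (\<lambda>\<omega>. (norm (Z \<omega>))\<^sup>2 + 2 * norm (Z \<omega>))" by simp
    have [measurable]: "kernel_dom p \<in> borel_measurable borel"
      using integrable_kernel_dom[OF p] by (simp add: borel_measurable_integrable)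
    show "integrable (M \<Otimes>\<^sub>M lborel) (\<lambda>x. ((norm (Z (fst x)))\<^sup>2 + 2 * norm (Z (fst x))) * kernel_dom p (snd x))"
    proof (rule Fubini_integrable)
      show "integrable M (\<lambda>\<omega>. \<integral>s. norm (((norm (Z (fst (\<omega>, s))))\<^sup>2 + 2 * norm (Z (fst (\<omega>, s)))) * kernel_dom p (snd (\<omega>, s))) \<partial>lborel)"
        using iz kernel_dom_nonneg[OF p] by (simp add: abs_mult)
      show "AE \<omega> in M. integrable lborel (\<lambda>s. ((norm (Z (fst (\<omega>, s))))\<^sup>2 + 2 * norm (Z (fst (\<omega>, s)))) * kernel_dom p (snd (\<omega>, s)))"
        using integrable_kernel_dom[OF p] by simp
    qed simp
    show "AE x in M \<Otimes>\<^sub>M lborel. norm (case x of (\<omega>, s) \<Rightarrow> k \<omega> s) \<le> norm (((norm (Z (fst x)))\<^sup>2 + 2 * norm (Z (fst x))) * kernel_dom p (snd x))"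
    proof (rule AE_I2, clarsimp)
      fix \<omega> s
      have "\<bar>k \<omega> s\<bar> \<le> norm (kernel p (Z \<omega>) s)" unfolding k_def by (rule abs_Re_le_cmod)
      also have "\<dots> \<le> ((norm (Z \<omega>))\<^sup>2 + 2 * norm (Z \<omega>)) * kernel_dom p s"
        by (rule norm_kernel_le[OF p Re0])
      finally show "\<bar>k \<omega> s\<bar> \<le> \<bar>((norm (Z \<omega>))\<^sup>2 + 2 * norm (Z \<omega>)) * kernel_dom p s\<bar>" by simp
    qed
  qed simp
  have "0 \<le> (\<integral>s. (\<integral>\<omega>. k \<omega> s \<partial>M) \<partial>lborel)"
  proof (rule integral_nonneg_AE, rule AE_I2)
    fix s :: real
    show "0 \<le> (\<integral>\<omega>. k \<omega> s \<partial>M)"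
    proof (cases "s > 0")
      case True
      have "integrable M (\<lambda>\<omega>. exp (- \<bar>s * X \<omega>\<bar>) * cos (s * Y \<omega>))"
      proof (rule integrable_const_bound[of _ 1])
        show "AE \<omega> in M. norm (exp (- \<bar>s * X \<omega>\<bar>) * cos (s * Y \<omega>)) \<le> 1"
          by (intro AE_I2) (simp add: abs_mult mult_le_one)
      qed simp
      moreover have "integrable M (\<lambda>\<omega>. \<bar>s * X \<omega>\<bar>)"
        using pw(2)[OF X] by simp
      ultimately have "(\<integral>\<omega>. exp (- \<bar>s * X \<omega>\<bar>) * cos (s * Y \<omega>) + \<bar>s * X \<omega>\<bar> - 1 \<partial>M) \<ge> 0"
        using ge[OF True] by (simp add: prob_space)
      then show ?thesis unfolding kd by simp
    qed (simp add: kd)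
  qed
  also have "\<dots> = (\<integral>\<omega>. (\<integral>s. k \<omega> s \<partial>lborel) \<partial>M)"
    by (rule Fubini_integral[OF int])
  also have "(\<lambda>\<omega>. \<integral>s. k \<omega> s \<partial>lborel) = (\<lambda>\<omega>. Re (kernel_int p (Z \<omega>)))"
    unfolding k_def kernel_int_def[OF p] using integrable_kernel[OF p Re0] by simp
  finally have nonneg: "0 \<le> (\<integral>\<omega>. Re (kernel_int p (Z \<omega>)) \<partial>M)" .
  have ik: "integrable M (\<lambda>\<omega>. Re (kernel_int p (Z \<omega>)))"
  proof -
    have "integrable M (\<lambda>\<omega>. (\<integral>s. k \<omega> s \<partial>lborel))" using integrable_fst[OF int] .
    then show ?thesis
      unfolding k_def kernel_int_def[OF p] using integrable_kernel[OF p Re0] by simp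
  qed
  define T where "T = tan (pi / (2 * p)) powr p"
  have "(\<integral>\<omega>. \<bar>Y \<omega>\<bar> powr p \<partial>M) \<le> (\<integral>\<omega>. T * \<bar>X \<omega>\<bar> powr p - essen_const * Re (kernel_int p (Z \<omega>)) \<partial>M)"
    using pw(1)[OF X] pw(1)[OF Y] ik essen_ineq unfolding T_def Z_def
    by (intro integral_mono) auto
  also have "\<dots> = T * (\<integral>\<omega>. \<bar>X \<omega>\<bar> powr p \<partial>M) - essen_const * (\<integral>\<omega>. Re (kernel_int p (Z \<omega>)) \<partial>M)"
    using pw(1)[OF X] ik by simp
  also have "\<dots> \<le> T * (\<integral>\<omega>. \<bar>X \<omega>\<bar> powr p \<partial>M)"
    using nonneg essen_const_pos by simp
  finally have "ennreal (\<integral>\<omega>. \<bar>Y \<omega>\<bar> powr p \<partial>M) \<le> ennreal (T * (\<integral>\<omega>. \<bar>X \<omega>\<bar> powr p \<partial>M))"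
    by (rule ennreal_leI)
  then show ?thesis
    using pw(1)[OF X] pw(1)[OF Y]
    by (simp add: nn_integral_eq_integral ennreal_mult T_def)
qed

end

section \<open>Brownian increments\<close>

lemma finite_real_grid:
  fixes S :: "real set"
  assumes "finite S" "S \<noteq> {}"
  obtains n and g :: "nat \<Rightarrow> real" where "g ` {..n} = S" "\<And>i. i < n \<Longrightarrow> g i < g (Suc i)" "g 0 = Min S" "g n = Max S"
proof -
  have "\<exists>n g. g ` {..n::nat} = S \<and> (\<forall>i<n. g i < g (Suc i)) \<and> g 0 = Min S \<and> g n = Max S"
    using assms
  proof (induction S rule: finite_linorder_max_induct)
    case (insert b A)
    show ?case
    proof (cases "A = {}")
      case True
      then show ?thesis by (intro exI[of _ 0] exI[of _ "\<lambda>_. b"]) auto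
    next
      case False
      then obtain n g where g: "g ` {..n::nat} = A" "\<forall>i<n. g i < g (Suc i)" "g 0 = Min A" "g n = Max A"
        using insert by blast
      define h where "h i = (if i \<le> n then g i else b)" for i
      have "h ` {..Suc n} = insert b (h ` {..n})" unfolding atMost_Suc by (auto simp: h_def)
      also have "h ` {..n} = g ` {..n}" by (intro image_cong) (auto simp: h_def)
      finally have "h ` {..Suc n} = insert b A" using g by simp
      moreover have "\<forall>i<Suc n. h i < h (Suc i)"
        using g insert.hyps by (auto simp: h_def less_Suc_eq)
      moreover have "Min (insert b A) = Min A"
        using False insert.hyps by (simp add: min_def) (metis Min_in less_le_not_le)
      moreover have "Max (insert b A) = b"
        using insert.hyps by (intro Max_eqI) (auto intro: less_imp_le)
      ultimately show ?thesis using g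
        by (intro exI[of _ "Suc n"] exI[of _ h]) (auto simp: h_def)
    qed
  qed simp
  then show ?thesis using that by blast
qed

lemma strict_grid_mono:
  fixes g :: "nat \<Rightarrow> real"
  assumes "\<And>i. i < n \<Longrightarrow> g i < g (Suc i)" "i < j" "j \<le> n"
  shows "g i < g j"
  using assms(2,3)
proof (induction j)
  case (Suc j)
  then show ?case using assms(1)[of j] by (cases "i = j") (auto intro: less_trans)
qed simp

lemma strict_grid_mono_le:
  fixes g :: "nat \<Rightarrow> real"
  assumes "\<And>i. i < n \<Longrightarrow> g i < g (Suc i)" "i \<le> j" "j \<le> n"
  shows "g i \<le> g j"
  using strict_grid_mono[of n g i j] assms by (cases "i = j") (auto intro: less_imp_le)

lemma borel_measurable_vec_lambda:
  fixes f :: "'n::finite \<Rightarrow> 'a \<Rightarrow> real"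
  assumes "\<And>i. f i \<in> borel_measurable M"
  shows "(\<lambda>x. \<chi> i. f i x) \<in> borel_measurable M"
  unfolding borel_measurable_euclidean_space[of "\<lambda>x. \<chi> i. f i x"]
  using assms by (auto simp: Basis_vec_def inner_axis)

lemma distr_normal_eq_scaled:
  assumes "\<sigma> > 0"
  shows "density lborel (normal_density 0 \<sigma>) = distr std_normal_distribution borel (\<lambda>x. \<sigma> * x)"
proof -
  have "distributed std_normal_distribution lborel (\<lambda>x. x) std_normal_density"
    unfolding distributed_def by (simp add: distr_id2)
  then have "distributed std_normal_distribution lborel (\<lambda>x. 0 + \<sigma> * x) (normal_density (0 + \<sigma> * 0) (\<bar>\<sigma>\<bar> * 1))"
    using assms by (intro std_normal.normal_density_affine) auto
  then have "distributed std_normal_distribution lborel (\<lambda>x. \<sigma> * x) (normal_density 0 \<sigma>)"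
    using assms by simp
  from distributed_distr_eq_density[OF this] show ?thesis
    by (metis distr_cong sets_lborel)
qed

locale brownian =
  fixes M :: "'a measure" and B :: "real \<Rightarrow> 'a \<Rightarrow> real^'n"
  assumes bm: "std_brownian M B"
begin

sublocale prob_space M
  using bm by (simp add: std_brownian_def)

abbreviation F :: "real \<Rightarrow> 'a measure" where "F \<equiv> nat_filtration M B"

lemma B_measurable [measurable]: "B t \<in> borel_measurable M"
  using bm by (simp add: std_brownian_def)

lemma B_0: "\<omega> \<in> space M \<Longrightarrow> B 0 \<omega> = 0"
  using bm by (simp add: std_brownian_def)

lemma space_F [simp]: "space (F s) = space M"
  unfolding nat_filtration_def by (intro space_measure_of) auto

lemma sets_F: "sets (F s) = sigma_sets (space M) {B u -` U \<inter> space M | u U. 0 \<le> u \<and> u \<le> s \<and> U \<in> sets borel}"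
  unfolding nat_filtration_def by (intro sets_measure_of) auto

lemma sets_F_subset: "sets (F s) \<subseteq> sets M"
  unfolding sets_F by (intro sets.sigma_sets_subset) (auto intro: measurable_sets)

lemma subalgebra_F: "subalgebra M (F s)"
  by (simp add: subalgebra_def sets_F_subset)

lemma sets_F_mono: "s \<le> t \<Longrightarrow> sets (F s) \<subseteq> sets (F t)"
  unfolding sets_F by (intro sigma_sets_mono') fastforce

lemma measurable_F_M: "f \<in> borel_measurable (F s) \<Longrightarrow> f \<in> borel_measurable M"
  using measurable_from_subalg[OF subalgebra_F] .

lemma measurable_F_mono: "f \<in> borel_measurable (F s) \<Longrightarrow> s \<le> t \<Longrightarrow> f \<in> borel_measurable (F t)"
  using sets_F_mono[of s t] by (intro measurable_from_subalg[of "F t" "F s"]) (auto simp: subalgebra_def)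

lemma B_measurable_F: "0 \<le> u \<Longrightarrow> u \<le> s \<Longrightarrow> B u \<in> borel_measurable (F s)"
  by (rule measurableI) (auto simp: sets_F)

lemma grid_increments_indep:
  fixes ts :: "nat \<Rightarrow> real"
  assumes "0 \<le> ts 0" "\<forall>j<k. ts j \<le> ts (Suc j)"
  shows "indep_vars (\<lambda>_. borel) (\<lambda>(j, i) \<omega>. (B (ts (Suc j)) \<omega> - B (ts j) \<omega>) $ i) ({..<k} \<times> (UNIV :: 'n set))"
  using bm assms unfolding std_brownian_def by blast

lemma increment_inner_distr:
  fixes a :: "real^'n"
  assumes su: "0 \<le> s" "s < u"
  shows "distr M borel (\<lambda>\<omega>. a \<bullet> (B u \<omega> - B s \<omega>)) = distr std_normal_distribution borel (\<lambda>x. norm a * sqrt (u - s) * x)"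
proof (cases "a = 0")
  case True
  then show ?thesis
    using distr_const[of 0 borel] std_normal.distr_const[of 0 borel] by simp
next
  case False
  \<comment> \<open>Vanishing coefficients are dropped because the sum rule for independent normal
    variables asks for positive standard deviations.\<close>
  define I where "I = {i. a $ i \<noteq> 0}"
  have I: "I \<noteq> {}" using False by (auto simp: I_def vec_eq_iff)
  define ts :: "nat \<Rightarrow> real" where "ts j = (if j = 0 then s else u)" for j
  have "indep_vars (\<lambda>_. borel) (\<lambda>(j, i) \<omega>. (B (ts (Suc j)) \<omega> - B (ts j) \<omega>) $ i) ({..<1} \<times> (UNIV :: 'n set))"
    using su by (intro grid_increments_indep) (auto simp: ts_def)
  then have "indep_vars (\<lambda>_. borel) (\<lambda>(j, i) \<omega>. (B (ts (Suc j)) \<omega> - B (ts j) \<omega>) $ i) ({0} \<times> I)"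
    by (rule indep_vars_subset) auto
  then have ind: "indep_vars (\<lambda>_. borel) (\<lambda>q \<omega>. a $ snd q * (case q of (j, i) \<Rightarrow> (\<lambda>\<omega>. (B (ts (Suc j)) \<omega> - B (ts j) \<omega>) $ i)) \<omega>) ({0} \<times> I)"
    by (rule indep_vars_compose2) auto
  have "distributed M lborel (\<lambda>\<omega>. \<Sum>q\<in>{0} \<times> I. a $ snd q * (case q of (j, i) \<Rightarrow> (\<lambda>\<omega>. (B (ts (Suc j)) \<omega> - B (ts j) \<omega>) $ i)) \<omega>)
     (normal_density (\<Sum>q\<in>{0::nat} \<times> I. 0) (sqrt (\<Sum>q\<in>{0::nat} \<times> I. (\<bar>a $ snd q\<bar> * sqrt (u - s))\<^sup>2)))"
  proof (rule sum_indep_normal[OF _ _ ind])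
    fix q assume q: "q \<in> {0::nat} \<times> I"
    then obtain i where i: "i \<in> I" "q = (0, i)" by auto
    show "0 < \<bar>a $ snd q\<bar> * sqrt (u - s)" using i su by (simp add: I_def)
    have "distributed M lborel (\<lambda>\<omega>. (B u \<omega> - B s \<omega>) $ i) (normal_density 0 (sqrt (u - s)))"
      using bm su unfolding std_brownian_def by blast
    then have "distributed M lborel (\<lambda>\<omega>. 0 + a $ i * ((B u \<omega> - B s \<omega>) $ i)) (normal_density (0 + a $ i * 0) (\<bar>a $ i\<bar> * sqrt (u - s)))"
      using i su by (intro normal_density_affine) (auto simp: I_def)
    then show "distributed M lborel (\<lambda>\<omega>. a $ snd q * (case q of (j, i) \<Rightarrow> (\<lambda>\<omega>. (B (ts (Suc j)) \<omega> - B (ts j) \<omega>) $ i)) \<omega>) (normal_density 0 (\<bar>a $ snd q\<bar> * sqrt (u - s)))"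
      by (simp add: i ts_def)
  qed (use I in auto)
  moreover have "(\<Sum>q\<in>{0::nat} \<times> I. f q) = (\<Sum>i\<in>I. f (0, i))" for f :: "nat \<times> 'n \<Rightarrow> real"
    by (simp add: sum.cartesian_product[symmetric, of "\<lambda>j i. f (j, i)", simplified])
  ultimately have "distributed M lborel (\<lambda>\<omega>. \<Sum>i\<in>I. a $ i * ((B u \<omega> - B s \<omega>) $ i))
     (normal_density 0 (sqrt (\<Sum>i\<in>I. (\<bar>a $ i\<bar> * sqrt (u - s))\<^sup>2)))"
    by (simp add: ts_def)
  moreover have "(\<Sum>i\<in>I. a $ i * ((B u \<omega> - B s \<omega>) $ i)) = a \<bullet> (B u \<omega> - B s \<omega>)" for \<omega>
    unfolding inner_vec_def by (intro sum.mono_neutral_cong_left) (auto simp: I_def)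
  moreover have "sqrt (\<Sum>i\<in>I. (\<bar>a $ i\<bar> * sqrt (u - s))\<^sup>2) = norm a * sqrt (u - s)"
  proof -
    have "(\<Sum>i\<in>I. (\<bar>a $ i\<bar> * sqrt (u - s))\<^sup>2) = (\<Sum>i\<in>I. (a $ i)\<^sup>2) * (u - s)"
      using su by (simp add: power_mult_distrib sum_distrib_right)
    also have "(\<Sum>i\<in>I. (a $ i)\<^sup>2) = (norm a)\<^sup>2"
      unfolding power2_norm_eq_inner inner_vec_def
      by (intro sum.mono_neutral_cong_left) (auto simp: I_def power2_eq_square)
    finally show ?thesis by (simp add: real_sqrt_mult)
  qed
  ultimately have "distributed M lborel (\<lambda>\<omega>. a \<bullet> (B u \<omega> - B s \<omega>)) (normal_density 0 (norm a * sqrt (u - s)))"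
    by simp
  then have "distr M lborel (\<lambda>\<omega>. a \<bullet> (B u \<omega> - B s \<omega>)) = density lborel (normal_density 0 (norm a * sqrt (u - s)))"
    by (rule distributed_distr_eq_density)
  also have "\<dots> = distr std_normal_distribution borel (\<lambda>x. norm a * sqrt (u - s) * x)"
    using False su by (intro distr_normal_eq_scaled) simp
  also have "distr M lborel (\<lambda>\<omega>. a \<bullet> (B u \<omega> - B s \<omega>)) = distr M borel (\<lambda>\<omega>. a \<bullet> (B u \<omega> - B s \<omega>))"
    by (intro distr_cong) auto
  finally show ?thesis .
qed

lemma increment_gaussian:
  assumes "0 \<le> s" "s < u"
  shows "isotropic_gaussian (distr M borel (\<lambda>\<omega>. B u \<omega> - B s \<omega>)) (u - s)"
proof -
  interpret D: prob_space "distr M borel (\<lambda>\<omega>. B u \<omega> - B s \<omega>)"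
    by (rule prob_space_distr) simp
  show ?thesis
    by unfold_locales (use assms increment_inner_distr[OF assms] in \<open>auto simp: distr_distr comp_def\<close>)
qed

text \<open>The definition of Brownian motion speaks of increments over a grid, the filtration of
  values at single times. Since \<open>B\<close> starts at 0, values at grid times are sums of
  earlier increments; so the event \<open>C\<close> concerns the cells before \<open>s\<close>,
  while the increment from \<open>s\<close> to \<open>u\<close> is one further cell.\<close>

lemma increment_indep_cylinder:
  fixes J :: "real set" and U :: "real \<Rightarrow> (real^'n) set"
  assumes su: "0 \<le> s" "s < u" and J: "finite J" "J \<subseteq> {0..s}" and U: "\<And>r. r \<in> J \<Longrightarrow> U r \<in> sets borel"
    and V: "V \<in> sets borel"
  defines "C \<equiv> {\<omega>\<in>space M. \<forall>r\<in>J. B r \<omega> \<in> U r}" and "D \<equiv> (\<lambda>\<omega>. B u \<omega> - B s \<omega>) -` V \<inter> space M"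
  shows "prob (C \<inter> D) = prob C * prob D"
proof -
  \<comment> \<open>0 is added so that the increments sum up to values, \<open>s\<close> so that the
    cells before and after it separate.\<close>
  define S where "S = J \<union> {0, s}"
  have S: "finite S" "S \<noteq> {}" using J by (auto simp: S_def)
  obtain k g where g: "g ` {..k} = S" "\<And>i. i < k \<Longrightarrow> g i < g (Suc i)" "g 0 = Min S" "g k = Max S"
    using finite_real_grid[OF S] by metis
  have g0: "g 0 = 0" unfolding g(3) using J su S by (intro Min_eqI) (auto simp: S_def)
  have gk: "g k = s" unfolding g(4) using J su S by (intro Max_eqI) (auto simp: S_def)
  define ts where "ts j = (if j \<le> k then g j else u)" for j
  define X :: "nat \<times> 'n \<Rightarrow> 'a \<Rightarrow> real" where "X = (\<lambda>(j, i) \<omega>. (B (ts (Suc j)) \<omega> - B (ts j) \<omega>) $ i)"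
  have mono: "\<forall>j<Suc k. ts j \<le> ts (Suc j)"
    using g(2) gk su by (auto simp: ts_def le_Suc_eq less_Suc_eq intro: less_imp_le)
  then have "indep_vars (\<lambda>_. borel) X ({..<Suc k} \<times> (UNIV :: 'n set))"
    unfolding X_def using g0 by (intro grid_increments_indep) (auto simp: ts_def)
  then have ind: "indep_var (PiM ({..<k} \<times> UNIV) (\<lambda>_. borel)) (\<lambda>\<omega>. restrict (\<lambda>i. X i \<omega>) ({..<k} \<times> UNIV))
     (PiM ({k} \<times> UNIV) (\<lambda>_. borel)) (\<lambda>\<omega>. restrict (\<lambda>i. X i \<omega>) ({k} \<times> UNIV))"
    by (rule indep_var_restrict) auto
  \<comment> \<open>The indicator of \<open>C\<close> as a function of the earlier increments. It
    takes values in real^n like the increment, because \<open>indep_var\<close> relates variables of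
    one type.\<close>
  define Y1 :: "(nat \<times> 'n \<Rightarrow> real) \<Rightarrow> real^'n" where
    "Y1 f = (if \<forall>j\<in>{..k}. g j \<in> J \<longrightarrow> (\<chi> i. \<Sum>l<j. f (l, i)) \<in> U (g j) then 1 else 0)" for f
  define Y2 :: "(nat \<times> 'n \<Rightarrow> real) \<Rightarrow> real^'n" where "Y2 f = (\<chi> i. f (k, i))" for f
  have vm: "(\<lambda>f::nat \<times> 'n \<Rightarrow> real. \<chi> i. \<Sum>l<j. f (l, i)) \<in> borel_measurable (PiM ({..<k} \<times> UNIV) (\<lambda>_. borel))" if "j \<le> k" for j
    using that by (intro borel_measurable_vec_lambda borel_measurable_sum measurable_component_singleton) auto
  have Y1m: "Y1 \<in> borel_measurable (PiM ({..<k} \<times> UNIV) (\<lambda>_. borel))"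
  proof -
    have "Measurable.pred (PiM ({..<k} \<times> UNIV) (\<lambda>_. borel)) (\<lambda>f::nat \<times> 'n \<Rightarrow> real. g j \<in> J \<longrightarrow> (\<chi> i. \<Sum>l<j. f (l, i)) \<in> U (g j))"
      if "j \<in> {..k}" for j
      using U[of "g j"] vm[of j] that by (cases "g j \<in> J") (auto intro: pred_sets2)
    then have [measurable]: "Measurable.pred (PiM ({..<k} \<times> UNIV) (\<lambda>_. borel))
        (\<lambda>f::nat \<times> 'n \<Rightarrow> real. \<forall>j\<in>{..k}. g j \<in> J \<longrightarrow> (\<chi> i. \<Sum>l<j. f (l, i)) \<in> U (g j))"
      by (intro pred_intros_finite) auto
    show ?thesis unfolding Y1_def by measurable
  qed
  have Y2m: "Y2 \<in> borel_measurable (PiM ({k} \<times> UNIV) (\<lambda>_. borel))"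
    unfolding Y2_def by (intro borel_measurable_vec_lambda measurable_component_singleton) auto
  have ind2: "indep_var borel (\<lambda>\<omega>. Y1 (restrict (\<lambda>i. X i \<omega>) ({..<k} \<times> UNIV))) borel (\<lambda>\<omega>. Y2 (restrict (\<lambda>i. X i \<omega>) ({k} \<times> UNIV)))"
    using indep_var_compose[OF ind Y1m Y2m] by (simp add: comp_def)
  have eq2: "Y2 (restrict (\<lambda>i. X i \<omega>) ({k} \<times> UNIV)) = B u \<omega> - B s \<omega>" for \<omega>
    by (simp add: Y2_def X_def ts_def gk vec_eq_iff)
  have tel: "(\<chi> i. \<Sum>l<j. (restrict (\<lambda>i. X i \<omega>) ({..<k} \<times> UNIV)) (l, i)) = B (g j) \<omega>" if "j \<le> k" "\<omega> \<in> space M" for j \<omega>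
  proof -
    have "(\<Sum>l<j. (restrict (\<lambda>i. X i \<omega>) ({..<k} \<times> UNIV)) (l, i)) = B (g j) \<omega> $ i" for i
    proof -
      have "(\<Sum>l<j. (restrict (\<lambda>i. X i \<omega>) ({..<k} \<times> UNIV)) (l, i)) = (\<Sum>l<j. B (g (Suc l)) \<omega> $ i - B (g l) \<omega> $ i)"
        using that by (intro sum.cong) (auto simp: X_def ts_def)
      also have "\<dots> = B (g j) \<omega> $ i"
        using sum_lessThan_telescope[of "\<lambda>l. B (g l) \<omega> $ i" j] that by (simp add: g0 B_0)
      finally show ?thesis .
    qed
    then show ?thesis by (simp add: vec_eq_iff)
  qed
  have eq1: "(\<lambda>\<omega>. Y1 (restrict (\<lambda>i. X i \<omega>) ({..<k} \<times> UNIV))) -` {1} \<inter> space M = C"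
  proof -
    have "(\<forall>j\<in>{..k}. g j \<in> J \<longrightarrow> B (g j) \<omega> \<in> U (g j)) \<longleftrightarrow> (\<forall>r\<in>J. B r \<omega> \<in> U r)" for \<omega>
    proof -
      have "J \<subseteq> g ` {..k}" unfolding g(1) S_def by auto
      then show ?thesis by blast
    qed
    moreover have "(\<forall>j\<in>{..k}. g j \<in> J \<longrightarrow> (\<chi> i. \<Sum>l<j. (restrict (\<lambda>i. X i \<omega>) ({..<k} \<times> UNIV)) (l, i)) \<in> U (g j))
        \<longleftrightarrow> (\<forall>j\<in>{..k}. g j \<in> J \<longrightarrow> B (g j) \<omega> \<in> U (g j))" if "\<omega> \<in> space M" for \<omega>
      by (intro ball_cong refl imp_cong) (simp only: tel atMost_iff that)
    ultimately have "Y1 (restrict (\<lambda>i. X i \<omega>) ({..<k} \<times> UNIV)) = (if \<forall>r\<in>J. B r \<omega> \<in> U r then 1 else 0)" if "\<omega> \<in> space M" for \<omega>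
      unfolding Y1_def using that by presburger
    then show ?thesis
      unfolding C_def by (auto split: if_splits)
  qed
  have "prob ((\<lambda>x. (Y1 (restrict (\<lambda>i. X i x) ({..<k} \<times> UNIV)), B u x - B s x)) -` ({1} \<times> V) \<inter> space M) = prob C * prob D"
    using indep_varD[OF ind2, of "{1}" V] V unfolding eq2 eq1 D_def by simp
  also have "(\<lambda>x. (Y1 (restrict (\<lambda>i. X i x) ({..<k} \<times> UNIV)), B u x - B s x)) -` ({1} \<times> V) \<inter> space M = C \<inter> D"
    unfolding eq1[symmetric] D_def by auto
  finally show ?thesis .
qed

text \<open>Cylinder events over finitely many times in [0, s] are stable under intersection and
  generate F s, so the product formula extends from them to the whole past.\<close>

lemma increment_indep:
  assumes su: "0 \<le> s" "s < u"
    and A: "A \<in> sets (F s)" and V: "V \<in> sets borel"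
  shows "prob (A \<inter> ((\<lambda>\<omega>. B u \<omega> - B s \<omega>) -` V \<inter> space M)) = prob A * prob ((\<lambda>\<omega>. B u \<omega> - B s \<omega>) -` V \<inter> space M)"
proof -
  define P where "P = {{\<omega>\<in>space M. \<forall>r\<in>J. B r \<omega> \<in> U r} | J U. finite J \<and> J \<subseteq> {0..s} \<and> (\<forall>r\<in>J. U r \<in> sets borel)}"
  define Q where "Q = {(\<lambda>\<omega>. B u \<omega> - B s \<omega>) -` A \<inter> space M |A. A \<in> sets borel}"
  have PM: "P \<subseteq> sets (F s)"
  proof
    fix C assume "C \<in> P"
    then obtain J U where C: "C = {\<omega>\<in>space M. \<forall>r\<in>J. B r \<omega> \<in> U r}" and J: "finite J" "J \<subseteq> {0..s}" "\<forall>r\<in>J. U r \<in> sets borel"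
      unfolding P_def by blast
    have "{\<omega>\<in>space (F s). \<forall>r\<in>J. B r \<omega> \<in> U r} \<in> sets (F s)"
    proof (rule sets.sets_Collect_finite_All[OF _ J(1)])
      fix r assume "r \<in> J"
      then have "B r -` U r \<inter> space (F s) \<in> sets (F s)"
        using J by (intro measurable_sets[OF B_measurable_F]) auto
      then show "{\<omega> \<in> space (F s). B r \<omega> \<in> U r} \<in> sets (F s)"
        by (simp add: vimage_def Int_def conj_commute)
    qed
    then show "C \<in> sets (F s)" by (simp add: C)
  qed
  have sig: "sigma_sets (space M) P = sets (F s)"
  proof
    show "sigma_sets (space M) P \<subseteq> sets (F s)"
      using PM sets.sigma_sets_subset[of P "F s"] by simp
    show "sets (F s) \<subseteq> sigma_sets (space M) P"
      unfolding sets_F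
    proof (rule sigma_sets_mono')
      show "{B u -` U \<inter> space M |u U. 0 \<le> u \<and> u \<le> s \<and> U \<in> sets borel} \<subseteq> P"
      proof clarify
        fix r U assume "0 \<le> r" "r \<le> s" "U \<in> sets (borel :: (real^'n) measure)"
        then show "B r -` U \<inter> space M \<in> P"
          unfolding P_def by (intro CollectI exI[of _ "{r}"] exI[of _ "\<lambda>_. U"]) auto
      qed
    qed
  qed
  have intP: "Int_stable P"
  proof (rule Int_stableI)
    fix C D assume "C \<in> P" "D \<in> P"
    then obtain J U K V where C: "C = {\<omega>\<in>space M. \<forall>r\<in>J. B r \<omega> \<in> U r}" and J: "finite J" "J \<subseteq> {0..s}" "\<forall>r\<in>J. U r \<in> sets borel"
      and D: "D = {\<omega>\<in>space M. \<forall>r\<in>K. B r \<omega> \<in> V r}" and K: "finite K" "K \<subseteq> {0..s}" "\<forall>r\<in>K. V r \<in> sets borel"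
      unfolding P_def by blast
    define W where "W r = (if r \<in> J then U r else UNIV) \<inter> (if r \<in> K then V r else UNIV)" for r
    have "C \<inter> D = {\<omega>\<in>space M. \<forall>r\<in>J \<union> K. B r \<omega> \<in> W r}"
      unfolding C D W_def by auto
    moreover have "\<forall>r\<in>J \<union> K. W r \<in> sets borel"
      using J K by (auto simp: W_def)
    ultimately show "C \<inter> D \<in> P"
      unfolding P_def using J K by (intro CollectI exI[of _ "J \<union> K"] exI[of _ W]) auto
  qed
  have intQ: "Int_stable Q"
  proof (rule Int_stableI)
    fix C D assume "C \<in> Q" "D \<in> Q"
    then obtain V W where "C = (\<lambda>\<omega>. B u \<omega> - B s \<omega>) -` V \<inter> space M" "D = (\<lambda>\<omega>. B u \<omega> - B s \<omega>) -` W \<inter> space M"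
      "V \<in> sets borel" "W \<in> sets borel" by (auto simp: Q_def)
    then show "C \<inter> D \<in> Q" unfolding Q_def by (intro CollectI exI[of _ "V \<inter> W"]) auto
  qed
  have "indep_set P Q"
    unfolding indep_sets2_eq
  proof (intro conjI ballI)
    show "P \<subseteq> events" using PM sets_F_subset by blast
    show "Q \<subseteq> events" unfolding Q_def by auto
    fix C D assume "C \<in> P" "D \<in> Q"
    then show "prob (C \<inter> D) = prob C * prob D"
      unfolding P_def Q_def using increment_indep_cylinder[OF su] by blast
  qed
  from indep_set_sigma_sets[OF this intP intQ]
  have "indep_set (sets (F s)) (sigma_sets (space M) Q)" unfolding sig .
  moreover have "(\<lambda>\<omega>. B u \<omega> - B s \<omega>) -` V \<inter> space M \<in> sigma_sets (space M) Q"
    using V by (auto simp: Q_def)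
  ultimately show ?thesis
    using A unfolding indep_sets2_eq by blast
qed

text \<open>Serves as conditional expectation given F s: by independence the pair of outcome and
  increment has a product law on F s times the Borel sets, so whatever the past determines may be
  held fixed while the increment is averaged.\<close>

lemma freeze_integral:
  fixes \<Phi> :: "'a \<times> (real^'n) \<Rightarrow> 'c::{banach, second_countable_topology}"
  assumes su: "0 \<le> s" "s < u" and m: "\<Phi> \<in> borel_measurable (F s \<Otimes>\<^sub>M borel)"
    and int: "integrable M (\<lambda>\<omega>. \<Phi> (\<omega>, B u \<omega> - B s \<omega>))"
  shows "(\<integral>\<omega>. \<Phi> (\<omega>, B u \<omega> - B s \<omega>) \<partial>M) = (\<integral>\<omega>. (\<integral>w. \<Phi> (\<omega>, w) \<partial>distr M borel (\<lambda>\<omega>. B u \<omega> - B s \<omega>)) \<partial>M)"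
    and "integrable M (\<lambda>\<omega>. \<integral>w. \<Phi> (\<omega>, w) \<partial>distr M borel (\<lambda>\<omega>. B u \<omega> - B s \<omega>))"
proof -
  let ?d = "\<lambda>\<omega>. B u \<omega> - B s \<omega>"
  let ?G = "distr M borel ?d"
  let ?N = "distr M (F s) (\<lambda>\<omega>. \<omega>)"
  have rv: "(\<lambda>\<omega>. \<omega>) \<in> measurable M (F s)"
    using sets_F_subset[of s] by (intro measurableI) (auto simp: sets.Int_space_eq2 subset_iff)
  have pm: "(\<lambda>\<omega>. (\<omega>, ?d \<omega>)) \<in> measurable M (F s \<Otimes>\<^sub>M borel)"
    using rv by (intro measurable_Pair) auto
  interpret N: prob_space ?N by (rule prob_space_distr[OF rv])
  interpret G: prob_space ?G by (rule prob_space_distr) simp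
  interpret NG: pair_sigma_finite ?N ?G ..
  have eq: "?N \<Otimes>\<^sub>M ?G = distr M (F s \<Otimes>\<^sub>M borel) (\<lambda>\<omega>. (\<omega>, ?d \<omega>))"
  proof (rule pair_measure_eqI)
    fix A V assume "A \<in> sets ?N" "V \<in> sets ?G"
    then have A: "A \<in> sets (F s)" and V: "V \<in> sets borel" by auto
    have AM: "A \<subseteq> space M" using sets.sets_into_space[OF A] by simp
    have "emeasure (distr M (F s \<Otimes>\<^sub>M borel) (\<lambda>\<omega>. (\<omega>, ?d \<omega>))) (A \<times> V) = emeasure M (A \<inter> (?d -` V \<inter> space M))"
      using A V AM by (subst emeasure_distr[OF pm]) (auto intro!: arg_cong[where f = "emeasure M"])
    also have "\<dots> = ennreal (prob A * prob (?d -` V \<inter> space M))"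
      using increment_indep[OF su A V] by (simp add: emeasure_eq_measure)
    also have "\<dots> = emeasure ?N A * emeasure ?G V"
    proof -
      have "emeasure ?N A = ennreal (prob A)"
        using A AM rv by (subst emeasure_distr) (auto simp: emeasure_eq_measure Int_absorb2)
      moreover have "emeasure ?G V = ennreal (prob (?d -` V \<inter> space M))"
        using V by (subst emeasure_distr) (auto simp: emeasure_eq_measure)
      ultimately show ?thesis by (simp add: ennreal_mult)
    qed
    finally show "emeasure ?N A * emeasure ?G V = emeasure (distr M (F s \<Otimes>\<^sub>M borel) (\<lambda>\<omega>. (\<omega>, ?d \<omega>))) (A \<times> V)" by simp
  qed (auto simp: N.sigma_finite_measure_axioms G.sigma_finite_measure_axioms intro!: sets_pair_measure_cong)
  have i: "integrable (?N \<Otimes>\<^sub>M ?G) \<Phi>"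
    unfolding eq using pm m int by (subst integrable_distr_eq) auto
  have m': "\<Phi> \<in> borel_measurable (F s \<Otimes>\<^sub>M ?G)"
    using m by (simp cong: measurable_cong_sets sets_pair_measure_cong)
  have inner: "(\<lambda>\<omega>. \<integral>w. \<Phi> (\<omega>, w) \<partial>?G) \<in> borel_measurable (F s)"
    using m' G.borel_measurable_lebesgue_integral[of "\<lambda>\<omega> w. \<Phi> (\<omega>, w)" "F s"] by simp
  have "(\<integral>\<omega>. \<Phi> (\<omega>, ?d \<omega>) \<partial>M) = (\<integral>x. \<Phi> x \<partial>(?N \<Otimes>\<^sub>M ?G))"
    unfolding eq using pm m by (subst integral_distr) auto
  also have "\<dots> = (\<integral>\<omega>. (\<integral>w. \<Phi> (\<omega>, w) \<partial>?G) \<partial>?N)"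
    using NG.integral_fst'[OF i] by simp
  also have "\<dots> = (\<integral>\<omega>. (\<integral>w. \<Phi> (\<omega>, w) \<partial>?G) \<partial>M)"
    using rv inner by (subst integral_distr) auto
  finally show "(\<integral>\<omega>. \<Phi> (\<omega>, ?d \<omega>) \<partial>M) = (\<integral>\<omega>. (\<integral>w. \<Phi> (\<omega>, w) \<partial>?G) \<partial>M)" .
  have "integrable ?N (\<lambda>\<omega>. \<integral>w. \<Phi> (\<omega>, w) \<partial>?G)"
    using NG.integrable_fst'[OF i] .
  then show "integrable M (\<lambda>\<omega>. \<integral>w. \<Phi> (\<omega>, w) \<partial>?G)"
    using rv inner by (subst (asm) integrable_distr_eq) auto
qed

end

section \<open>Stochastic integrals on a grid\<close>

lemma all_moments_distr:
  assumes "d \<in> measurable M N" "f \<in> borel_measurable N"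
  shows "all_moments (distr M N d) f \<longleftrightarrow> all_moments M (\<lambda>x. f (d x))"
  unfolding all_moments_def using assms by (auto simp: integrable_distr_eq)

lemma integrable_Complex_power:
  fixes U V :: "'a \<Rightarrow> real"
  assumes "finite_measure M" "all_moments M U" "all_moments M V"
  shows "integrable M (\<lambda>x. Complex (U x) (V x) ^ m)"
proof (rule Bochner_Integration.integrable_bound)
  show "integrable M (\<lambda>x. (\<bar>U x\<bar> + \<bar>V x\<bar>) ^ m)"
    using assms by (intro all_moments_integrable_power all_moments_add all_moments_abs)
  show "AE x in M. norm (Complex (U x) (V x) ^ m) \<le> norm ((\<bar>U x\<bar> + \<bar>V x\<bar>) ^ m)"
    using cmod_le[of "Complex _ _"] by (intro AE_I2) (simp add: norm_power power_mono)
  have [measurable]: "U \<in> borel_measurable M" "V \<in> borel_measurable M"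
    using assms by (auto simp: all_moments_def)
  show "(\<lambda>x. Complex (U x) (V x) ^ m) \<in> borel_measurable M"
    unfolding Complex_eq by measurable
qed

lemma cotlar_matrix_properties:
  fixes A :: "real^'n^'n"
  assumes "cotlar_matrix A"
  shows "v \<bullet> (A *v v) = 0" "norm (A *v v) = norm v"
proof -
  have z: "(A *v w) \<bullet> w = 0" for w using assms by (simp add: cotlar_matrix_def)
  then show "v \<bullet> (A *v v) = 0" by (simp add: inner_commute)
  \<comment> \<open>Skewness at v + A v: the mixed terms leave |A v|^2 + A^2 v \<bullet> v = 0, and
    A^2 = -I makes \<open>A\<close> an isometry.\<close>
  have "(A *v (v + A *v v)) \<bullet> (v + A *v v) = 0" by (rule z)
  then have "(A *v v) \<bullet> (A *v v) + (A *v (A *v v)) \<bullet> v = 0"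
    by (simp add: matrix_vector_right_distrib inner_add_left inner_add_right z)
  moreover have "A *v (A *v v) = - v"
  proof -
    have "A *v (A *v v) = (A ** A) *v v" by (simp add: matrix_vector_mul_assoc)
    also have "\<dots> = - (mat 1 *v v)"
      using assms by (simp add: cotlar_matrix_def matrix_vector_mult_def vec_eq_iff sum_negf)
    finally show ?thesis by simp
  qed
  ultimately have "(A *v v) \<bullet> (A *v v) = v \<bullet> v" by simp
  then show "norm (A *v v) = norm v" by (simp add: norm_eq_sqrt_inner)
qed

lemma measurable_matrix_vector_mult [measurable (raw)]:
  fixes A :: "real^'n^'m"
  assumes "f \<in> borel_measurable M"
  shows "(\<lambda>x. A *v f x) \<in> borel_measurable M"
  using borel_measurable_continuous_onI[OF linear_continuous_on[OF matrix_vector_mul_bounded_linear[of A]]] assms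
  by (rule measurable_compose[rotated])

section \<open>A single grid cell: Gaussian averages given the past\<close>

locale brownian_step = brownian M B for M :: "'a measure" and B :: "real \<Rightarrow> 'a \<Rightarrow> real^'n" +
  fixes s u :: real
  assumes su: "0 \<le> s" "s < u"
begin

abbreviation d :: "'a \<Rightarrow> real^'n" where "d \<omega> \<equiv> B u \<omega> - B s \<omega>"

sublocale G: isotropic_gaussian "distr M borel d" "u - s"
  by (rule increment_gaussian[OF su])

lemma all_moments_norm_d: "all_moments M (\<lambda>\<omega>. norm (d \<omega>))"
  using G.all_moments_norm by (subst (asm) all_moments_distr) auto

lemma all_moments_inner_d:
  assumes [measurable]: "a \<in> borel_measurable M" and c: "\<And>\<omega>. \<omega> \<in> space M \<Longrightarrow> norm (a \<omega>) \<le> c"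
  shows "all_moments M (\<lambda>\<omega>. a \<omega> \<bullet> d \<omega>)"
proof (rule all_moments_bound)
  show "all_moments M (\<lambda>\<omega>. c * norm (d \<omega>))"
    by (intro all_moments_mult all_moments_const all_moments_norm_d finite_measure_axioms)
  fix \<omega> assume \<omega>: "\<omega> \<in> space M"
  have "\<bar>a \<omega> \<bullet> d \<omega>\<bar> \<le> norm (a \<omega>) * norm (d \<omega>)" by (rule Cauchy_Schwarz_ineq2)
  also have "\<dots> \<le> c * norm (d \<omega>)" using c[OF \<omega>] by (intro mult_right_mono) auto
  finally show "\<bar>a \<omega> \<bullet> d \<omega>\<bar> \<le> \<bar>c * norm (d \<omega>)\<bar>" by simp
qed measurable

lemma step_orth:
  assumes a_m: "a \<in> borel_measurable (F s)" and a_bd: "\<And>\<omega>. \<omega> \<in> space M \<Longrightarrow> norm (a \<omega>) \<le> c"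
    and x: "x \<in> borel_measurable (F s)" "all_moments M x"
  shows "(\<integral>\<omega>. x \<omega> * (a \<omega> \<bullet> d \<omega>) \<partial>M) = 0"
proof -
  note [measurable] = a_m x(1)
  have "(\<integral>\<omega>. x \<omega> * (a \<omega> \<bullet> d \<omega>) \<partial>M) = (\<integral>\<omega>. (\<integral>w. x \<omega> * (a \<omega> \<bullet> w) \<partial>distr M borel d) \<partial>M)"
    using freeze_integral(1)[OF su, of "\<lambda>z. x (fst z) * (a (fst z) \<bullet> snd z)"] all_moments_integrable[OF all_moments_mult[OF x(2) all_moments_inner_d[OF measurable_F_M[OF a_m] a_bd]]]
    by simp
  also have "\<dots> = 0" by (simp only: G.integral_inner integral_mult_right_zero mult_zero_right Bochner_Integration.integral_zero)
  finally show ?thesis .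
qed

lemma step_square:
  assumes a_m: "a \<in> borel_measurable (F s)" and a_bd: "\<And>\<omega>. \<omega> \<in> space M \<Longrightarrow> norm (a \<omega>) \<le> c"
  shows "(\<integral>\<omega>. (a \<omega> \<bullet> d \<omega>)\<^sup>2 \<partial>M) = (u - s) * (\<integral>\<omega>. (norm (a \<omega>))\<^sup>2 \<partial>M)"
proof -
  note [measurable] = a_m
  have "(\<integral>\<omega>. (a \<omega> \<bullet> d \<omega>)\<^sup>2 \<partial>M) = (\<integral>\<omega>. (\<integral>w. (a \<omega> \<bullet> w)\<^sup>2 \<partial>distr M borel d) \<partial>M)"
    using freeze_integral(1)[OF su, of "\<lambda>z. (a (fst z) \<bullet> snd z)\<^sup>2"] all_moments_integrable_power[OF finite_measure_axioms all_moments_inner_d[OF measurable_F_M[OF a_m] a_bd]]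
    by simp
  also have "\<dots> = (u - s) * (\<integral>\<omega>. (norm (a \<omega>))\<^sup>2 \<partial>M)" by (simp only: G.integral_inner_power2 integral_mult_right_zero)
  finally show ?thesis .
qed

lemma step_abs_power:
  assumes a_m: "a \<in> borel_measurable (F s)" and a_bd: "\<And>\<omega>. \<omega> \<in> space M \<Longrightarrow> norm (a \<omega>) \<le> c"
  shows "(\<integral>\<omega>. \<bar>a \<omega> \<bullet> d \<omega>\<bar> ^ m \<partial>M) \<le> c ^ m * (sqrt (u - s) ^ m * (\<integral>x. \<bar>x\<bar> ^ m \<partial>std_normal_distribution))"
proof -
  note [measurable] = a_m
  define K where "K = sqrt (u - s) ^ m * (\<integral>x. \<bar>x\<bar> ^ m \<partial>std_normal_distribution)"
  have K: "K \<ge> 0" using su by (auto simp: K_def intro!: mult_nonneg_nonneg integral_nonneg_AE)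
  have "(\<integral>\<omega>. \<bar>a \<omega> \<bullet> d \<omega>\<bar> ^ m \<partial>M) = (\<integral>\<omega>. (\<integral>w. \<bar>a \<omega> \<bullet> w\<bar> ^ m \<partial>distr M borel d) \<partial>M)"
    using freeze_integral(1)[OF su, of "\<lambda>z. \<bar>a (fst z) \<bullet> snd z\<bar> ^ m"] all_moments_integrable_power[OF finite_measure_axioms all_moments_abs[OF all_moments_inner_d[OF measurable_F_M[OF a_m] a_bd]]]
    by simp
  also have "\<dots> = (\<integral>\<omega>. norm (a \<omega>) ^ m * K \<partial>M)" unfolding G.integral_abs_inner_power K_def ..
  also have "\<dots> \<le> (\<integral>\<omega>. c ^ m * K \<partial>M)"
  proof (rule integral_mono)
    have "integrable M (\<lambda>\<omega>. norm (a \<omega>) ^ m)"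
    proof (rule integrable_const_bound[of _ "c ^ m"])
      show "AE \<omega> in M. norm (norm (a \<omega>) ^ m) \<le> c ^ m"
        using a_bd by (intro AE_I2) (simp add: power_mono)
    qed (use measurable_F_M[OF a_m] in measurable)
    then show "integrable M (\<lambda>\<omega>. norm (a \<omega>) ^ m * K)" by simp
    show "norm (a \<omega>) ^ m * K \<le> c ^ m * K" if "\<omega> \<in> space M" for \<omega>
      using a_bd[OF that] K by (intro mult_right_mono power_mono) auto
  qed simp
  finally show ?thesis by (simp add: K_def prob_space)
qed

lemma integrable_exp_cos_abs:
  assumes "all_moments M U" "all_moments M V"
  shows "integrable M (\<lambda>\<omega>. exp (- \<bar>U \<omega>\<bar>) * cos (V \<omega>) + \<bar>U \<omega>\<bar>)"
proof -
  have [measurable]: "U \<in> borel_measurable M" "V \<in> borel_measurable M"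
    using assms by (auto simp: all_moments_def)
  have "integrable M (\<lambda>\<omega>. exp (- \<bar>U \<omega>\<bar>) * cos (V \<omega>))"
  proof (rule integrable_const_bound[of _ 1])
    show "AE \<omega> in M. norm (exp (- \<bar>U \<omega>\<bar>) * cos (V \<omega>)) \<le> 1"
      by (intro AE_I2) (simp add: abs_mult mult_le_one)
  qed simp
  then show ?thesis using assms(1) by (simp add: all_moments_integrable)
qed

context
  fixes a b :: "'a \<Rightarrow> real^'n" and x y :: "'a \<Rightarrow> real" and c :: real
  assumes a_m: "a \<in> borel_measurable (F s)" and a_bd: "\<And>\<omega>. \<omega> \<in> space M \<Longrightarrow> norm (a \<omega>) \<le> c"
    and b_m: "b \<in> borel_measurable (F s)" and ab: "\<And>\<omega>. a \<omega> \<bullet> b \<omega> = 0" "\<And>\<omega>. norm (a \<omega>) = norm (b \<omega>)"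
    and x: "x \<in> borel_measurable (F s)" "all_moments M x"
    and y: "y \<in> borel_measurable (F s)" "all_moments M y"
begin

lemma all_moments_a: "all_moments M (\<lambda>\<omega>. a \<omega> \<bullet> d \<omega>)"
  by (intro all_moments_inner_d[of _ c] measurable_F_M[OF a_m] a_bd)

lemma all_moments_b: "all_moments M (\<lambda>\<omega>. b \<omega> \<bullet> d \<omega>)"
  by (intro all_moments_inner_d[of _ c] measurable_F_M[OF b_m]) (use a_bd ab(2) in auto)

lemma step_power:
  "(CLINT \<omega>|M. Complex (x \<omega> + a \<omega> \<bullet> d \<omega>) (y \<omega> + b \<omega> \<bullet> d \<omega>) ^ m) = (CLINT \<omega>|M. Complex (x \<omega>) (y \<omega>) ^ m)"
proof -
  note [measurable] = a_m x(1) y(1) b_m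
  have e: "Complex (x \<omega> + a \<omega> \<bullet> w) (y \<omega> + b \<omega> \<bullet> w) = Complex (x \<omega>) (y \<omega>) + Complex (a \<omega> \<bullet> w) (b \<omega> \<bullet> w)" for \<omega> w
    by (simp add: complex_eq_iff)
  have "(CLINT \<omega>|M. Complex (x \<omega> + a \<omega> \<bullet> d \<omega>) (y \<omega> + b \<omega> \<bullet> d \<omega>) ^ m)
     = (CLINT \<omega>|M. (CLINT w|distr M borel d. Complex (x \<omega> + a \<omega> \<bullet> w) (y \<omega> + b \<omega> \<bullet> w) ^ m))"
  proof -
    have "(\<lambda>z. Complex (x (fst z) + a (fst z) \<bullet> snd z) (y (fst z) + b (fst z) \<bullet> snd z) ^ m) \<in> borel_measurable (F s \<Otimes>\<^sub>M borel)"
      unfolding Complex_eq by measurable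
    from freeze_integral(1)[OF su this]
      integrable_Complex_power[OF finite_measure_axioms all_moments_add[OF x(2) all_moments_a] all_moments_add[OF y(2) all_moments_b], of m]
    show ?thesis by simp
  qed
  also have "\<dots> = (CLINT \<omega>|M. Complex (x \<omega>) (y \<omega>) ^ m)"
    unfolding e by (simp only: G.integral_complex_shift_power[OF ab])
  finally show ?thesis .
qed

lemma step_kernel:
  "(\<integral>\<omega>. exp (- \<bar>x \<omega>\<bar>) * cos (y \<omega>) + \<bar>x \<omega>\<bar> \<partial>M)
    \<le> (\<integral>\<omega>. exp (- \<bar>x \<omega> + a \<omega> \<bullet> d \<omega>\<bar>) * cos (y \<omega> + b \<omega> \<bullet> d \<omega>) + \<bar>x \<omega> + a \<omega> \<bullet> d \<omega>\<bar> \<partial>M)"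
proof -
  note [measurable] = a_m x(1) y(1) b_m
  define \<Phi> where "\<Phi> z = exp (- \<bar>x (fst z) + a (fst z) \<bullet> snd z\<bar>) * cos (y (fst z) + b (fst z) \<bullet> snd z) + \<bar>x (fst z) + a (fst z) \<bullet> snd z\<bar>" for z
  have "\<Phi> \<in> borel_measurable (F s \<Otimes>\<^sub>M borel)" unfolding \<Phi>_def by measurable
  moreover have "integrable M (\<lambda>\<omega>. \<Phi> (\<omega>, d \<omega>))"
    unfolding \<Phi>_def using integrable_exp_cos_abs[OF all_moments_add[OF x(2) all_moments_a] all_moments_add[OF y(2) all_moments_b]] by simp
  ultimately have fr: "(\<integral>\<omega>. \<Phi> (\<omega>, d \<omega>) \<partial>M) = (\<integral>\<omega>. (\<integral>w. \<Phi> (\<omega>, w) \<partial>distr M borel d) \<partial>M)"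
    and i: "integrable M (\<lambda>\<omega>. \<integral>w. \<Phi> (\<omega>, w) \<partial>distr M borel d)"
    using freeze_integral[OF su] by blast+
  have "(\<integral>\<omega>. exp (- \<bar>x \<omega>\<bar>) * cos (y \<omega>) + \<bar>x \<omega>\<bar> \<partial>M) \<le> (\<integral>\<omega>. (\<integral>w. \<Phi> (\<omega>, w) \<partial>distr M borel d) \<partial>M)"
  proof (rule integral_mono[OF integrable_exp_cos_abs[OF x(2) y(2)] i])
    show "exp (- \<bar>x \<omega>\<bar>) * cos (y \<omega>) + \<bar>x \<omega>\<bar> \<le> (\<integral>w. \<Phi> (\<omega>, w) \<partial>distr M borel d)" for \<omega>
      unfolding \<Phi>_def fst_conv snd_conv by (rule G.integral_kernel_ge[OF ab])
  qed
  then show ?thesis unfolding fr[symmetric] by (simp add: \<Phi>_def)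
qed

end

end

context brownian
begin

text \<open>Strictly increasing, unlike the times of \<open>elem_proc\<close>, because the Gaussian
  step is set up for intervals of positive length.\<close>

definition grid :: "(nat \<Rightarrow> real) \<Rightarrow> nat \<Rightarrow> bool" where
  "grid g N \<longleftrightarrow> 0 \<le> g 0 \<and> (\<forall>i<N. g i < g (Suc i))"

text \<open>The coefficient of a cell is known at its left end. The common bound \<open>c\<close>
  puts all grid integrals into \<open>all_moments\<close>, and it reappears in the overshoot
  error.\<close>

definition adapted :: "(nat \<Rightarrow> real) \<Rightarrow> nat \<Rightarrow> real \<Rightarrow> (nat \<Rightarrow> 'a \<Rightarrow> real^'n) \<Rightarrow> bool" where
  "adapted g N c \<eta> \<longleftrightarrow> (\<forall>l<N. \<eta> l \<in> borel_measurable (F (g l)) \<and> (\<forall>\<omega>\<in>space M. norm (\<eta> l \<omega>) \<le> c))"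

definition gint :: "(nat \<Rightarrow> real) \<Rightarrow> (nat \<Rightarrow> 'a \<Rightarrow> real^'n) \<Rightarrow> nat \<Rightarrow> 'a \<Rightarrow> real" where
  "gint g \<eta> i \<omega> = (\<Sum>l<i. \<eta> l \<omega> \<bullet> (B (g (Suc l)) \<omega> - B (g l) \<omega>))"

lemma gint_0 [simp]: "gint g \<eta> 0 \<omega> = 0"
  by (simp add: gint_def)

lemma gint_Suc: "gint g \<eta> (Suc i) \<omega> = gint g \<eta> i \<omega> + \<eta> i \<omega> \<bullet> (B (g (Suc i)) \<omega> - B (g i) \<omega>)"
  by (simp add: gint_def)

lemma grid_nonneg: "grid g N \<Longrightarrow> i \<le> N \<Longrightarrow> 0 \<le> g i"
  using strict_grid_mono_le[of N g 0 i] by (force simp: grid_def)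

lemma grid_step: "grid g N \<Longrightarrow> i < N \<Longrightarrow> brownian_step M B (g i) (g (Suc i))"
  using grid_nonneg[of g N i] by unfold_locales (auto simp: grid_def)

lemma gint_measurable:
  assumes "grid g N" "adapted g N c \<eta>" "i \<le> N"
  shows "gint g \<eta> i \<in> borel_measurable (F (g i))"
  using assms(3)
proof (induction i)
  case (Suc i)
  have lt: "g i < g (Suc i)" "0 \<le> g i" using Suc.prems assms(1) grid_nonneg[OF assms(1), of i] by (auto simp: grid_def)
  have [measurable]: "gint g \<eta> i \<in> borel_measurable (F (g (Suc i)))" "\<eta> i \<in> borel_measurable (F (g (Suc i)))"
  proof -
    show "gint g \<eta> i \<in> borel_measurable (F (g (Suc i)))"
      using Suc lt by (intro measurable_F_mono[of _ "g i" "g (Suc i)"]) auto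
    show "\<eta> i \<in> borel_measurable (F (g (Suc i)))"
      using Suc.prems assms(2) lt by (intro measurable_F_mono[of _ "g i" "g (Suc i)"]) (auto simp: adapted_def)
  qed
  have [measurable]: "B (g i) \<in> borel_measurable (F (g (Suc i)))" "B (g (Suc i)) \<in> borel_measurable (F (g (Suc i)))"
    using lt by (auto intro!: B_measurable_F)
  show ?case unfolding gint_Suc[abs_def] by measurable
qed (simp add: gint_def[abs_def])

lemma gint_all_moments:
  assumes "grid g N" "adapted g N c \<eta>" "i \<le> N"
  shows "all_moments M (gint g \<eta> i)"
  using assms(3)
proof (induction i)
  case (Suc i)
  interpret S: brownian_step M B "g i" "g (Suc i)" using grid_step[OF assms(1)] Suc by auto
  have "all_moments M (\<lambda>\<omega>. \<eta> i \<omega> \<bullet> (B (g (Suc i)) \<omega> - B (g i) \<omega>))"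
    using assms(2) Suc by (intro S.all_moments_inner_d[of _ c] measurable_F_M[of _ "g i"]) (auto simp: adapted_def)
  then show ?case unfolding gint_Suc[abs_def] using Suc by (intro all_moments_add) auto
qed (simp add: gint_def[abs_def] all_moments_const finite_measure_axioms)

text \<open>The Ito isometry on a grid: the new increment is orthogonal to the integral so far, so
  the cross terms vanish.\<close>

lemma gint_square:
  assumes "grid g N" "adapted g N c \<eta>" "i \<le> N"
  shows "(\<integral>\<omega>. (gint g \<eta> i \<omega>)\<^sup>2 \<partial>M) = (\<Sum>l<i. (g (Suc l) - g l) * (\<integral>\<omega>. (norm (\<eta> l \<omega>))\<^sup>2 \<partial>M))"
  using assms(3)
proof (induction i)
  case (Suc i)
  interpret S: brownian_step M B "g i" "g (Suc i)" using grid_step[OF assms(1)] Suc by auto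
  let ?x = "gint g \<eta> i" and ?d = "\<lambda>\<omega>. B (g (Suc i)) \<omega> - B (g i) \<omega>"
  have \<eta>: "\<eta> i \<in> borel_measurable (F (g i))" "\<And>\<omega>. \<omega> \<in> space M \<Longrightarrow> norm (\<eta> i \<omega>) \<le> c"
    using assms(2) Suc by (auto simp: adapted_def)
  have x: "?x \<in> borel_measurable (F (g i))" "all_moments M ?x"
    using gint_measurable[OF assms(1,2)] gint_all_moments[OF assms(1,2)] Suc by auto
  have st: "all_moments M (\<lambda>\<omega>. \<eta> i \<omega> \<bullet> ?d \<omega>)"
    by (rule S.all_moments_inner_d[OF measurable_F_M[OF \<eta>(1)] \<eta>(2)])
  have z: "(\<integral>\<omega>. ?x \<omega> * (\<eta> i \<omega> \<bullet> ?d \<omega>) \<partial>M) = 0"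
    by (rule S.step_orth[OF \<eta> x])
  have sq: "(\<integral>\<omega>. (\<eta> i \<omega> \<bullet> ?d \<omega>)\<^sup>2 \<partial>M) = (g (Suc i) - g i) * (\<integral>\<omega>. (norm (\<eta> i \<omega>))\<^sup>2 \<partial>M)"
    by (rule S.step_square[OF \<eta>])
  have "(\<integral>\<omega>. (gint g \<eta> (Suc i) \<omega>)\<^sup>2 \<partial>M) = (\<integral>\<omega>. (?x \<omega>)\<^sup>2 + 2 * (?x \<omega> * (\<eta> i \<omega> \<bullet> ?d \<omega>)) + (\<eta> i \<omega> \<bullet> ?d \<omega>)\<^sup>2 \<partial>M)"
    unfolding gint_Suc by (simp only: power2_sum mult.assoc add_ac)
  also have "\<dots> = (\<integral>\<omega>. (?x \<omega>)\<^sup>2 \<partial>M) + 2 * (\<integral>\<omega>. ?x \<omega> * (\<eta> i \<omega> \<bullet> ?d \<omega>) \<partial>M) + (\<integral>\<omega>. (\<eta> i \<omega> \<bullet> ?d \<omega>)\<^sup>2 \<partial>M)"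
    using all_moments_integrable_power[OF finite_measure_axioms x(2), of 2] all_moments_integrable_power[OF finite_measure_axioms st, of 2]
      all_moments_integrable[OF all_moments_mult[OF x(2) st]]
    by (simp del: inner_diff_right inner_diff_left)
  finally show ?case using Suc z sq by simp
qed simp

lemma gint_diff: "gint g \<eta> i \<omega> - gint g \<eta>' i \<omega> = gint g (\<lambda>l \<omega>. \<eta> l \<omega> - \<eta>' l \<omega>) i \<omega>"
  by (simp add: gint_def inner_diff_left sum_subtractf)

lemma gint_scale: "gint g (\<lambda>l \<omega>. r *\<^sub>R \<eta> l \<omega>) i \<omega> = r * gint g \<eta> i \<omega>"
  by (simp add: gint_def sum_distrib_left)

lemma adapted_diff:
  assumes "adapted g N c \<eta>" "adapted g N c' \<eta>'"
  shows "adapted g N (c + c') (\<lambda>l \<omega>. \<eta> l \<omega> - \<eta>' l \<omega>)"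
  unfolding adapted_def
proof (intro allI impI conjI ballI)
  fix l assume l: "l < N"
  then have [measurable]: "\<eta> l \<in> borel_measurable (F (g l))" "\<eta>' l \<in> borel_measurable (F (g l))"
    using assms by (auto simp: adapted_def)
  show "(\<lambda>\<omega>. \<eta> l \<omega> - \<eta>' l \<omega>) \<in> borel_measurable (F (g l))" by measurable
  show "norm (\<eta> l \<omega> - \<eta>' l \<omega>) \<le> c + c'" if "\<omega> \<in> space M" for \<omega>
    using assms l that norm_triangle_ineq4[of "\<eta> l \<omega>" "\<eta>' l \<omega>"] by (fastforce simp: adapted_def)
qed

lemma adapted_scale:
  assumes "adapted g N c \<eta>"
  shows "adapted g N (\<bar>r\<bar> * c) (\<lambda>l \<omega>. r *\<^sub>R \<eta> l \<omega>)"
  using assms by (auto simp: adapted_def mult_left_mono)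

end

section \<open>The conformal pair on a grid and its stopping\<close>

locale cotlar_brownian = brownian M B for M :: "'a measure" and B :: "real \<Rightarrow> 'a \<Rightarrow> real^'n" +
  fixes A :: "real^'n^'n"
  assumes cotlar: "cotlar_matrix A"
begin

lemma adapted_cotlar:
  assumes "adapted g N c \<eta>"
  shows "adapted g N c (\<lambda>l \<omega>. A *v \<eta> l \<omega>)"
  using assms cotlar_matrix_properties(2)[OF cotlar] measurable_matrix_vector_mult
  by (auto simp: adapted_def)

definition gcint :: "(nat \<Rightarrow> real) \<Rightarrow> (nat \<Rightarrow> 'a \<Rightarrow> real^'n) \<Rightarrow> nat \<Rightarrow> 'a \<Rightarrow> complex" where
  "gcint g \<eta> i \<omega> = Complex (gint g \<eta> i \<omega>) (gint g (\<lambda>l \<omega>. A *v \<eta> l \<omega>) i \<omega>)"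

definition gcstep :: "(nat \<Rightarrow> real) \<Rightarrow> (nat \<Rightarrow> 'a \<Rightarrow> real^'n) \<Rightarrow> nat \<Rightarrow> 'a \<Rightarrow> complex" where
  "gcstep g \<eta> l \<omega> = Complex (\<eta> l \<omega> \<bullet> (B (g (Suc l)) \<omega> - B (g l) \<omega>)) ((A *v \<eta> l \<omega>) \<bullet> (B (g (Suc l)) \<omega> - B (g l) \<omega>))"

lemma gcint_0 [simp]: "gcint g \<eta> 0 \<omega> = 0"
  by (simp add: gcint_def complex_eq_iff)

lemma gcint_Suc: "gcint g \<eta> (Suc i) \<omega> = gcint g \<eta> i \<omega> + gcstep g \<eta> i \<omega>"
  by (simp add: gcint_def gcstep_def gint_Suc complex_eq_iff)

text \<open>Each cell leaves the mean of the m-th power unchanged, because \<eta> and A \<eta> are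
  orthogonal and of equal length; the pair starts at 0.\<close>

lemma gcint_power:
  assumes "grid g N" "adapted g N c \<eta>" "i \<le> N" "m \<ge> 1"
  shows "(CLINT \<omega>|M. gcint g \<eta> i \<omega> ^ m) = 0"
  using assms(3)
proof (induction i)
  case 0
  then show ?case using assms(4) by (simp add: power_0_left)
next
  case (Suc i)
  interpret S: brownian_step M B "g i" "g (Suc i)" using grid_step[OF assms(1)] Suc by auto
  let ?\<zeta> = "\<lambda>l \<omega>. A *v \<eta> l \<omega>"
  note adA = adapted_cotlar[OF assms(2)]
  have \<eta>: "\<eta> i \<in> borel_measurable (F (g i))" "\<And>\<omega>. \<omega> \<in> space M \<Longrightarrow> norm (\<eta> i \<omega>) \<le> c" "?\<zeta> i \<in> borel_measurable (F (g i))"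
    using assms(2) adA Suc by (auto simp: adapted_def)
  have "(CLINT \<omega>|M. gcint g \<eta> (Suc i) \<omega> ^ m) = (CLINT \<omega>|M. gcint g \<eta> i \<omega> ^ m)"
    unfolding gcint_def gint_Suc
  proof (rule S.step_power[OF \<eta>])
    show "gint g \<eta> i \<in> borel_measurable (F (g i))" "gint g ?\<zeta> i \<in> borel_measurable (F (g i))"
      "all_moments M (gint g \<eta> i)" "all_moments M (gint g ?\<zeta> i)"
      using gint_measurable[OF assms(1,2)] gint_measurable[OF assms(1) adA]
        gint_all_moments[OF assms(1,2)] gint_all_moments[OF assms(1) adA] Suc by auto
  qed (use cotlar_matrix_properties[OF cotlar] in auto)
  then show ?case using Suc by simp
qed

text \<open>A submartingale argument: each cell can only increase the mean of the subharmonic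
  kernel, which equals 1 at the start.\<close>

lemma gint_kernel:
  assumes "grid g N" "adapted g N c \<eta>" "i \<le> N"
  shows "1 \<le> (\<integral>\<omega>. exp (- \<bar>gint g \<eta> i \<omega>\<bar>) * cos (gint g (\<lambda>l \<omega>. A *v \<eta> l \<omega>) i \<omega>) + \<bar>gint g \<eta> i \<omega>\<bar> \<partial>M)"
  using assms(3)
proof (induction i)
  case 0
  then show ?case by (simp add: prob_space)
next
  case (Suc i)
  interpret S: brownian_step M B "g i" "g (Suc i)" using grid_step[OF assms(1)] Suc by auto
  let ?\<zeta> = "\<lambda>l \<omega>. A *v \<eta> l \<omega>"
  note adA = adapted_cotlar[OF assms(2)]
  have \<eta>: "\<eta> i \<in> borel_measurable (F (g i))" "\<And>\<omega>. \<omega> \<in> space M \<Longrightarrow> norm (\<eta> i \<omega>) \<le> c" "?\<zeta> i \<in> borel_measurable (F (g i))"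
    using assms(2) adA Suc by (auto simp: adapted_def)
  have "1 \<le> (\<integral>\<omega>. exp (- \<bar>gint g \<eta> i \<omega>\<bar>) * cos (gint g ?\<zeta> i \<omega>) + \<bar>gint g \<eta> i \<omega>\<bar> \<partial>M)"
    using Suc by simp
  also have "\<dots> \<le> (\<integral>\<omega>. exp (- \<bar>gint g \<eta> (Suc i) \<omega>\<bar>) * cos (gint g ?\<zeta> (Suc i) \<omega>) + \<bar>gint g \<eta> (Suc i) \<omega>\<bar> \<partial>M)"
    unfolding gint_Suc
  proof (rule S.step_kernel[OF \<eta>])
    show "gint g \<eta> i \<in> borel_measurable (F (g i))" "gint g ?\<zeta> i \<in> borel_measurable (F (g i))"
      "all_moments M (gint g \<eta> i)" "all_moments M (gint g ?\<zeta> i)"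
      using gint_measurable[OF assms(1,2)] gint_measurable[OF assms(1) adA]
        gint_all_moments[OF assms(1,2)] gint_all_moments[OF assms(1) adA] Suc by auto
  qed (use cotlar_matrix_properties[OF cotlar] in auto)
  finally show ?case .
qed

lemma gint_square_cotlar:
  assumes "grid g N" "adapted g N c \<eta>" "i \<le> N"
  shows "(\<integral>\<omega>. (gint g (\<lambda>l \<omega>. A *v \<eta> l \<omega>) i \<omega>)\<^sup>2 \<partial>M) = (\<integral>\<omega>. (gint g \<eta> i \<omega>)\<^sup>2 \<partial>M)"
  unfolding gint_square[OF assms] gint_square[OF assms(1) adapted_cotlar[OF assms(2)] assms(3)]
  by (simp add: cotlar_matrix_properties(2)[OF cotlar])

text \<open>The coefficient is switched off from the first grid time at which the pair has left the
  disc. The test includes the left end of the current cell, so the coefficient stays adapted; the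
  integral therefore freezes at the exit value, not at the last value inside the disc.\<close>

definition stopped :: "real \<Rightarrow> (nat \<Rightarrow> real) \<Rightarrow> (nat \<Rightarrow> 'a \<Rightarrow> real^'n) \<Rightarrow> nat \<Rightarrow> 'a \<Rightarrow> real^'n" where
  "stopped R g \<eta> l \<omega> = (if \<forall>j\<le>l. cmod (gcint g \<eta> j \<omega>) \<le> R then \<eta> l \<omega> else 0)"

text \<open>Either no exit has happened before time \<open>i\<close>, an exit at \<open>i\<close>
  itself being allowed, or the value at the first exit time \<open>j\<close> < \<open>i\<close> has
  been kept. In particular, if stopped and unstopped values differ, the stopped one lies outside the
  disc.\<close>

lemma gcint_stopped_cases:
  "(\<forall>l<i. cmod (gcint g \<eta> l \<omega>) \<le> R) \<and> gcint g (stopped R g \<eta>) i \<omega> = gcint g \<eta> i \<omega>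
   \<or> (\<exists>j<i. (\<forall>l<j. cmod (gcint g \<eta> l \<omega>) \<le> R) \<and> cmod (gcint g \<eta> j \<omega>) > R \<and> gcint g (stopped R g \<eta>) i \<omega> = gcint g \<eta> j \<omega>)"
proof (induction i)
  case (Suc i)
  have st: "gcstep g (stopped R g \<eta>) i \<omega> = (if \<forall>j\<le>i. cmod (gcint g \<eta> j \<omega>) \<le> R then gcstep g \<eta> i \<omega> else 0)"
    by (auto simp: gcstep_def stopped_def complex_eq_iff)
  from Suc show ?case
  proof (elim disjE exE conjE)
    assume *: "\<forall>l<i. cmod (gcint g \<eta> l \<omega>) \<le> R" "gcint g (stopped R g \<eta>) i \<omega> = gcint g \<eta> i \<omega>"
    show ?thesis
    proof (cases "cmod (gcint g \<eta> i \<omega>) \<le> R")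
      case True
      then have "\<forall>j\<le>i. cmod (gcint g \<eta> j \<omega>) \<le> R" using * by (auto simp: le_less)
      then show ?thesis using * st by (auto simp: gcint_Suc less_Suc_eq_le)
    next
      case False
      then have "\<not> (\<forall>j\<le>i. cmod (gcint g \<eta> j \<omega>) \<le> R)" by auto
      then show ?thesis using * st False by (intro disjI2 exI[of _ i]) (auto simp: gcint_Suc)
    qed
  next
    fix j assume *: "j < i" "\<forall>l<j. cmod (gcint g \<eta> l \<omega>) \<le> R" "cmod (gcint g \<eta> j \<omega>) > R"
      "gcint g (stopped R g \<eta>) i \<omega> = gcint g \<eta> j \<omega>"
    have "\<not> (\<forall>j\<le>i. cmod (gcint g \<eta> j \<omega>) \<le> R)"
      using *(1,3) by (meson less_imp_le not_less)
    then show ?thesis using * st by (intro disjI2 exI[of _ j]) (auto simp: gcint_Suc)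
  qed
qed simp

lemma gcint_stopped_const:
  assumes "l \<le> i" "\<not> (\<forall>j\<le>l. cmod (gcint g \<eta> j \<omega>) \<le> R)"
  shows "gcint g (stopped R g \<eta>) i \<omega> = gcint g (stopped R g \<eta>) l \<omega>"
  using assms(1)
proof (induction i)
  case (Suc i)
  show ?case
  proof (cases "l = Suc i")
    case False
    then have "\<not> (\<forall>j\<le>i. cmod (gcint g \<eta> j \<omega>) \<le> R)" using Suc.prems assms(2)
      by (meson le_SucE order_trans)
    then have "gcstep g (stopped R g \<eta>) i \<omega> = 0"
      by (auto simp: gcstep_def stopped_def complex_eq_iff)
    then show ?thesis using Suc False by (simp add: gcint_Suc)
  qed simp
qed simp

text \<open>The value before an exit has modulus at most \<open>R\<close>, so the exit value exceeds
  \<open>R\<close> by at most the size of one step.\<close>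

lemma gcint_stopped_overshoot:
  assumes "R \<ge> 0"
  shows "cmod (gcint g (stopped R g \<eta>) i \<omega>) \<le> R \<or> (\<exists>l<i. cmod (gcint g (stopped R g \<eta>) i \<omega>) \<le> R + cmod (gcstep g \<eta> l \<omega>))"
proof -
  have *: "cmod (gcint g \<eta> j \<omega>) \<le> R \<or> (\<exists>l<j. cmod (gcint g \<eta> j \<omega>) \<le> R + cmod (gcstep g \<eta> l \<omega>))"
    if "\<forall>l<j. cmod (gcint g \<eta> l \<omega>) \<le> R" for j
  proof (cases j)
    case 0
    then show ?thesis using assms by simp
  next
    case (Suc l)
    then have "cmod (gcint g \<eta> l \<omega>) \<le> R" using that by simp
    then have "cmod (gcint g \<eta> j \<omega>) \<le> R + cmod (gcstep g \<eta> l \<omega>)"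
      unfolding Suc gcint_Suc using norm_triangle_ineq[of "gcint g \<eta> l \<omega>" "gcstep g \<eta> l \<omega>"] by linarith
    then show ?thesis using Suc by auto
  qed
  show ?thesis
    using gcint_stopped_cases[of i g \<eta> \<omega> R]
  proof (elim disjE exE conjE)
    assume "\<forall>l<i. cmod (gcint g \<eta> l \<omega>) \<le> R" "gcint g (stopped R g \<eta>) i \<omega> = gcint g \<eta> i \<omega>"
    then show ?thesis using *[of i] by simp
  next
    fix j assume "j < i" "\<forall>l<j. cmod (gcint g \<eta> l \<omega>) \<le> R" "gcint g (stopped R g \<eta>) i \<omega> = gcint g \<eta> j \<omega>"
    then show ?thesis using *[of j] by (auto intro: less_trans)
  qed
qed

lemma measurable_gcint:
  assumes "grid g N" "adapted g N c \<eta>" "i \<le> N"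
  shows "gcint g \<eta> i \<in> borel_measurable (F (g i))"
proof -
  have [measurable]: "gint g \<eta> i \<in> borel_measurable (F (g i))" "gint g (\<lambda>l \<omega>. A *v \<eta> l \<omega>) i \<in> borel_measurable (F (g i))"
    using gint_measurable[OF assms] gint_measurable[OF assms(1) adapted_cotlar[OF assms(2)] assms(3)] by auto
  show ?thesis unfolding gcint_def[abs_def] Complex_eq by measurable
qed

lemma pred_alive:
  assumes "grid g N" "adapted g N c \<eta>" "l \<le> N"
  shows "Measurable.pred (F (g l)) (\<lambda>\<omega>. \<forall>j\<in>{..l}. cmod (gcint g \<eta> j \<omega>) \<le> R)"
proof (rule pred_intros_finite(3))
  fix j assume j: "j \<in> {..l}"
  have "g j \<le> g l" using assms(1,3) j strict_grid_mono_le[of N g j l] by (auto simp: grid_def)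
  then have [measurable]: "gcint g \<eta> j \<in> borel_measurable (F (g l))"
    using measurable_gcint[OF assms(1,2), of j] j assms(3) by (intro measurable_F_mono[of _ "g j" "g l"]) auto
  show "Measurable.pred (F (g l)) (\<lambda>\<omega>. cmod (gcint g \<eta> j \<omega>) \<le> R)" by measurable
qed simp

lemma adapted_stopped:
  assumes "grid g N" "adapted g N c \<eta>" "c \<ge> 0"
  shows "adapted g N c (stopped R g \<eta>)"
  unfolding adapted_def
proof (intro allI impI conjI ballI)
  fix l assume l: "l < N"
  have [measurable]: "\<eta> l \<in> borel_measurable (F (g l))" using assms(2) l by (simp add: adapted_def)
  have eq: "stopped R g \<eta> l = (\<lambda>\<omega>. if \<forall>j\<in>{..l}. cmod (gcint g \<eta> j \<omega>) \<le> R then \<eta> l \<omega> else 0)"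
    by (auto simp: stopped_def fun_eq_iff)
  show "stopped R g \<eta> l \<in> borel_measurable (F (g l))"
    unfolding eq
  proof (rule measurable_If)
    show "{\<omega> \<in> space (F (g l)). \<forall>j\<in>{..l}. cmod (gcint g \<eta> j \<omega>) \<le> R} \<in> sets (F (g l))"
      using pred_alive[OF assms(1,2), of l R] l unfolding pred_def by simp
  qed simp_all
  show "norm (stopped R g \<eta> l \<omega>) \<le> c" if "\<omega> \<in> space M" for \<omega>
    using assms l that by (auto simp: stopped_def adapted_def)
qed

text \<open>Optional stopping in weak form: what the integral gains after the exit is orthogonal to
  bounded functions of the stopped value.\<close>

lemma stopped_orthogonal:
  fixes \<phi> :: "real \<Rightarrow> real"
  assumes "grid g N" "adapted g N c \<eta>" "c \<ge> 0"
    and [measurable]: "\<phi> \<in> borel_measurable borel" and bd: "\<And>x. \<bar>\<phi> x\<bar> \<le> b"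
  shows "(\<integral>\<omega>. \<phi> (gint g (stopped R g \<eta>) N \<omega>) * (gint g \<eta> N \<omega> - gint g (stopped R g \<eta>) N \<omega>) \<partial>M) = 0"
proof -
  let ?s = "stopped R g \<eta>"
  note ads = adapted_stopped[OF assms(1-3), of R]
  note adD = adapted_diff[OF assms(2) ads]
  let ?\<delta> = "\<lambda>l \<omega>. \<eta> l \<omega> - ?s l \<omega>"
  let ?d = "\<lambda>l \<omega>. B (g (Suc l)) \<omega> - B (g l) \<omega>"
  \<comment> \<open>On a cell where \<eta> and its stopped version differ, the exit has already
    occurred. So the final stopped value equals the one at the left end of the cell, which belongs
    to the past of that cell.\<close>
  have eq: "\<phi> (gint g ?s N \<omega>) * (gint g \<eta> N \<omega> - gint g ?s N \<omega>)
      = (\<Sum>l<N. \<phi> (gint g ?s l \<omega>) * (?\<delta> l \<omega> \<bullet> ?d l \<omega>))" for \<omega>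
  proof -
    have "\<phi> (gint g ?s N \<omega>) * (?\<delta> l \<omega> \<bullet> ?d l \<omega>) = \<phi> (gint g ?s l \<omega>) * (?\<delta> l \<omega> \<bullet> ?d l \<omega>)" if "l < N" for l
    proof (cases "\<forall>j\<le>l. cmod (gcint g \<eta> j \<omega>) \<le> R")
      case True
      then have "?\<delta> l \<omega> = 0" by (simp add: stopped_def)
      then show ?thesis by simp
    next
      case False
      have "Re (gcint g ?s N \<omega>) = Re (gcint g ?s l \<omega>)"
        using gcint_stopped_const[OF _ False, of N] that by simp
      then show ?thesis by (simp add: gcint_def)
    qed
    then show ?thesis
      unfolding gint_diff gint_def[of g ?\<delta>] sum_distrib_left by (intro sum.cong) auto
  qed
  have \<phi>m: "all_moments M (\<lambda>\<omega>. \<phi> (gint g ?s l \<omega>))" "(\<lambda>\<omega>. \<phi> (gint g ?s l \<omega>)) \<in> borel_measurable (F (g l))" if "l < N" for l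
  proof -
    have [measurable]: "gint g ?s l \<in> borel_measurable (F (g l))" "gint g ?s l \<in> borel_measurable M"
      using gint_measurable[OF assms(1) ads, of l] measurable_F_M[OF gint_measurable[OF assms(1) ads, of l]] that by simp_all
    show "all_moments M (\<lambda>\<omega>. \<phi> (gint g ?s l \<omega>))"
    proof (rule all_moments_bound[OF all_moments_const[OF finite_measure_axioms, of b]])
      show "\<bar>\<phi> (gint g ?s l \<omega>)\<bar> \<le> \<bar>b\<bar>" for \<omega>
        using bd[of "gint g ?s l \<omega>"] by linarith
    qed measurable
    show "(\<lambda>\<omega>. \<phi> (gint g ?s l \<omega>)) \<in> borel_measurable (F (g l))" by measurable
  qed
  have \<delta>: "?\<delta> l \<in> borel_measurable (F (g l))" "\<And>\<omega>. \<omega> \<in> space M \<Longrightarrow> norm (?\<delta> l \<omega>) \<le> c + c" if "l < N" for l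
    using adD that by (auto simp: adapted_def)
  have zero: "(\<integral>\<omega>. \<phi> (gint g ?s l \<omega>) * (?\<delta> l \<omega> \<bullet> ?d l \<omega>) \<partial>M) = 0"
    and int: "integrable M (\<lambda>\<omega>. \<phi> (gint g ?s l \<omega>) * (?\<delta> l \<omega> \<bullet> ?d l \<omega>))" if l: "l < N" for l
  proof -
    interpret S: brownian_step M B "g l" "g (Suc l)" using grid_step[OF assms(1) l] .
    show "(\<integral>\<omega>. \<phi> (gint g ?s l \<omega>) * (?\<delta> l \<omega> \<bullet> ?d l \<omega>) \<partial>M) = 0"
      by (rule S.step_orth[OF \<delta>[OF l] \<phi>m(2,1)[OF l]])
    show "integrable M (\<lambda>\<omega>. \<phi> (gint g ?s l \<omega>) * (?\<delta> l \<omega> \<bullet> ?d l \<omega>))"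
      by (intro all_moments_integrable all_moments_mult \<phi>m[OF l] S.all_moments_inner_d[OF measurable_F_M[OF \<delta>(1)[OF l]] \<delta>(2)[OF l]])
  qed
  show ?thesis unfolding eq using zero int by (subst Bochner_Integration.integral_sum) auto
qed

end

section \<open>Moment bounds for the stopped pair when p = 2^k\<close>

lemma even_power_above_tangent:
  fixes x c :: real
  assumes "even q"
  shows "c ^ q + real q * c ^ (q - 1) * (x - c) \<le> x ^ q"
proof -
  have "x ^ q - c ^ q \<ge> (real q * c ^ (q - 1)) * (x - c)"
    by (rule convex_on_imp_above_tangent[of UNIV "\<lambda>x. x ^ q"])
       (auto intro!: derivative_eq_intros convex_power_even assms)
  then show ?thesis by simp
qed

text \<open>Keeps the slope of the tangent to x^q bounded, so that the approximation error enters
  through its L^1 norm.\<close>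

definition clamp_real :: "real \<Rightarrow> real \<Rightarrow> real" where
  "clamp_real L x = max (- L) (min L x)"

lemma measurable_clamp_real [measurable]: "clamp_real L \<in> borel_measurable borel"
  unfolding clamp_real_def by measurable

lemma abs_clamp_real_le: "L \<ge> 0 \<Longrightarrow> \<bar>clamp_real L x\<bar> \<le> L"
  by (auto simp: clamp_real_def)

lemma clamp_real_odd_power_nonneg:
  assumes "odd m" "L \<ge> 0"
  shows "0 \<le> clamp_real L x ^ m * (x - clamp_real L x)"
proof -
  consider "\<bar>x\<bar> \<le> L" | "x > L" | "x < - L" by linarith
  then show ?thesis
  proof cases
    case 1
    then have "clamp_real L x = x" by (auto simp: clamp_real_def)
    then show ?thesis by simp
  next
    case 2
    then have "clamp_real L x = L" using assms by (auto simp: clamp_real_def)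
    then show ?thesis using 2 assms by simp
  next
    case 3
    then have "clamp_real L x = - L" using assms by (auto simp: clamp_real_def)
    then show ?thesis using 3 assms by (simp add: mult_nonneg_nonpos)
  qed
qed

context cotlar_brownian
begin

text \<open>A Gaussian step over length \<Delta> has m-th moment of order \<Delta>^(m/2), and m >= 4
  with \<Delta> <= h <= 1 makes this at most h \<Delta>. Summed over the cells this is of order h
  times the total time, so it disappears with the mesh.\<close>

lemma gcstep_moment:
  assumes g: "grid g N" and ad: "adapted g N c \<eta>" "c \<ge> 0" and l: "l < N"
    and h: "g (Suc l) - g l \<le> h" "h \<le> 1" and m: "even m" "m \<ge> 4"
  shows "integrable M (\<lambda>\<omega>. (2 * cmod (gcstep g \<eta> l \<omega>)) ^ m)"
    and "(\<integral>\<omega>. (2 * cmod (gcstep g \<eta> l \<omega>)) ^ m \<partial>M)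
      \<le> 4 ^ m * 2 * c ^ m * (\<integral>x. \<bar>x\<bar> ^ m \<partial>std_normal_distribution) * h * (g (Suc l) - g l)"
proof -
  interpret S: brownian_step M B "g l" "g (Suc l)" using grid_step[OF g l] .
  let ?u = "\<lambda>\<omega>. \<eta> l \<omega> \<bullet> S.d \<omega>" and ?v = "\<lambda>\<omega>. (A *v \<eta> l \<omega>) \<bullet> S.d \<omega>"
  have 1: "\<eta> l \<in> borel_measurable (F (g l))" "\<And>\<omega>. \<omega> \<in> space M \<Longrightarrow> norm (\<eta> l \<omega>) \<le> c"
    and 2: "(\<lambda>\<omega>. A *v \<eta> l \<omega>) \<in> borel_measurable (F (g l))" "\<And>\<omega>. \<omega> \<in> space M \<Longrightarrow> norm (A *v \<eta> l \<omega>) \<le> c"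
    using ad adapted_cotlar[OF ad(1)] l by (auto simp: adapted_def)
  have am: "all_moments M ?u" "all_moments M ?v"
    by (rule S.all_moments_inner_d[OF measurable_F_M[OF 1(1)] 1(2)], assumption)
       (rule S.all_moments_inner_d[OF measurable_F_M[OF 2(1)] 2(2)], assumption)
  have iuv: "integrable M (\<lambda>\<omega>. \<bar>?u \<omega>\<bar> ^ m)" "integrable M (\<lambda>\<omega>. \<bar>?v \<omega>\<bar> ^ m)"
    using am unfolding all_moments_def by blast+
  have le: "(2 * cmod (gcstep g \<eta> l \<omega>)) ^ m \<le> 4 ^ m * (\<bar>?u \<omega>\<bar> ^ m + \<bar>?v \<omega>\<bar> ^ m)" for \<omega>
  proof -
    have "2 * cmod (gcstep g \<eta> l \<omega>) \<le> 4 * max \<bar>?u \<omega>\<bar> \<bar>?v \<omega>\<bar>"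
      using cmod_le[of "gcstep g \<eta> l \<omega>"] unfolding gcstep_def complex.sel by linarith
    then have "(2 * cmod (gcstep g \<eta> l \<omega>)) ^ m \<le> (4 * max \<bar>?u \<omega>\<bar> \<bar>?v \<omega>\<bar>) ^ m"
      by (intro power_mono) auto
    also have "\<dots> = 4 ^ m * max \<bar>?u \<omega>\<bar> \<bar>?v \<omega>\<bar> ^ m" by (simp add: power_mult_distrib)
    also have "\<dots> \<le> 4 ^ m * (\<bar>?u \<omega>\<bar> ^ m + \<bar>?v \<omega>\<bar> ^ m)"
      by (intro mult_left_mono) (auto simp: max_def)
    finally show ?thesis .
  qed
  have [measurable]: "gcstep g \<eta> l \<in> borel_measurable M"
  proof -
    have *: "(\<lambda>\<omega>. complex_of_real (?u \<omega>)) \<in> borel_measurable M" "(\<lambda>\<omega>. complex_of_real (?v \<omega>)) \<in> borel_measurable M"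
      using am[THEN all_moments_measurable] by (auto intro: borel_measurable_of_real)
    show ?thesis
      unfolding gcstep_def[abs_def] Complex_eq
      by (intro borel_measurable_add borel_measurable_times borel_measurable_const *)
  qed
  show int: "integrable M (\<lambda>\<omega>. (2 * cmod (gcstep g \<eta> l \<omega>)) ^ m)"
  proof (rule Bochner_Integration.integrable_bound)
    show "integrable M (\<lambda>\<omega>. 4 ^ m * (\<bar>?u \<omega>\<bar> ^ m + \<bar>?v \<omega>\<bar> ^ m))" using iuv by simp
    show "AE \<omega> in M. norm ((2 * cmod (gcstep g \<eta> l \<omega>)) ^ m) \<le> norm (4 ^ m * (\<bar>?u \<omega>\<bar> ^ m + \<bar>?v \<omega>\<bar> ^ m))"
      using le by (intro AE_I2) (simp add: order_trans[OF _ abs_ge_self])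
  qed measurable
  define \<Delta> where "\<Delta> = g (Suc l) - g l"
  define \<mu> where "\<mu> = (\<integral>x. \<bar>x\<bar> ^ m \<partial>std_normal_distribution)"
  have \<Delta>: "\<Delta> > 0" "\<Delta> \<le> h" using S.su h by (auto simp: \<Delta>_def)
  have \<mu>: "\<mu> \<ge> 0" unfolding \<mu>_def by (intro integral_nonneg_AE) auto
  have "sqrt \<Delta> ^ m \<le> h * \<Delta>"
  proof -
    obtain r where r: "m = 2 * r" using m(1) by blast
    then have "r \<ge> 2" using m by simp
    have "sqrt \<Delta> ^ m = \<Delta> ^ r" using \<Delta> by (simp add: r power_mult)
    also have "\<dots> \<le> \<Delta> ^ 2" using \<Delta> h \<open>r \<ge> 2\<close> by (intro power_decreasing) auto
    also have "\<dots> \<le> h * \<Delta>" using \<Delta> by (simp add: power2_eq_square mult_right_mono)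
    finally show ?thesis .
  qed
  then have b: "c ^ m * (sqrt \<Delta> ^ m * \<mu>) \<le> c ^ m * (h * \<Delta> * \<mu>)"
    using ad \<mu> by (intro mult_left_mono mult_right_mono) auto
  have "(\<integral>\<omega>. (2 * cmod (gcstep g \<eta> l \<omega>)) ^ m \<partial>M) \<le> (\<integral>\<omega>. 4 ^ m * (\<bar>?u \<omega>\<bar> ^ m + \<bar>?v \<omega>\<bar> ^ m) \<partial>M)"
    using iuv by (intro integral_mono int le) auto
  also have "\<dots> = 4 ^ m * ((\<integral>\<omega>. \<bar>?u \<omega>\<bar> ^ m \<partial>M) + (\<integral>\<omega>. \<bar>?v \<omega>\<bar> ^ m \<partial>M))"
    using iuv by (simp del: inner_diff_right)
  also have "\<dots> \<le> 4 ^ m * (c ^ m * (h * \<Delta> * \<mu>) + c ^ m * (h * \<Delta> * \<mu>))"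
  proof (intro mult_left_mono add_mono)
    show "(\<integral>\<omega>. \<bar>?u \<omega>\<bar> ^ m \<partial>M) \<le> c ^ m * (h * \<Delta> * \<mu>)"
      using b unfolding \<Delta>_def \<mu>_def by (rule order_trans[OF S.step_abs_power[OF 1], rotated])
    show "(\<integral>\<omega>. \<bar>?v \<omega>\<bar> ^ m \<partial>M) \<le> c ^ m * (h * \<Delta> * \<mu>)"
      using b unfolding \<Delta>_def \<mu>_def by (rule order_trans[OF S.step_abs_power[OF 2], rotated])
  qed simp
  finally show "(\<integral>\<omega>. (2 * cmod (gcstep g \<eta> l \<omega>)) ^ m \<partial>M)
      \<le> 4 ^ m * 2 * c ^ m * (\<integral>x. \<bar>x\<bar> ^ m \<partial>std_normal_distribution) * h * (g (Suc l) - g l)"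
    unfolding \<Delta>_def[symmetric] \<mu>_def[symmetric] by (simp add: algebra_simps)
qed

text \<open>The stopped pair has all moments, so Cotlar's induction bounds \<open>V\<close> by
  \<open>U\<close>. Replacing \<open>U\<close> by \<open>X\<close> costs two errors: the L^1
  distance of the unstopped integral from \<open>X\<close>, with a factor depending on
  \<open>R\<close>, and the contribution of large overshoots, which is linear in the mesh.\<close>

lemma stopped_moment_bound:
  fixes X :: "'a \<Rightarrow> real"
  assumes g: "grid g N" "g N \<le> t" and ad: "adapted g N c \<eta>" "c \<ge> 0"
    and h: "\<And>i. i < N \<Longrightarrow> g (Suc i) - g i \<le> h" "0 \<le> h" "h \<le> 1"
    and R: "R \<ge> 1" and k: "k \<ge> 1" and q: "q = 2 ^ k"
    and X: "integrable M X" "integrable M (\<lambda>\<omega>. X \<omega> ^ q)"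
  shows "(\<integral>\<omega>. (gint g (\<lambda>l \<omega>. A *v stopped R g \<eta> l \<omega>) N \<omega>) ^ q \<partial>M) \<le>
    cot (pi / (2 * real q)) ^ q * ((\<integral>\<omega>. X \<omega> ^ q \<partial>M) + real q * (2 * R) ^ (q - 1) * (\<integral>\<omega>. \<bar>gint g \<eta> N \<omega> - X \<omega>\<bar> \<partial>M)
      + 4 ^ (q + 2) * 2 * c ^ (q + 2) * (\<integral>x. \<bar>x\<bar> ^ (q + 2) \<partial>std_normal_distribution) * h * t)"
proof -
  \<comment> \<open>Two more than \<open>q\<close> gives an even exponent of at least 4, large
    enough for the step moments to be of order h \<Delta>.\<close>
  define m where "m = q + 2"
  have q2: "even q" "q \<ge> 2" "odd (q - 1)"
    using k unfolding q by (auto intro: self_le_power)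
  have m: "even m" "m \<ge> 4" using q2 by (auto simp: m_def)
  note ads = adapted_stopped[OF g(1) ad, of R]
  define U V W where "U = gint g (stopped R g \<eta>) N" and "V = gint g (\<lambda>l \<omega>. A *v stopped R g \<eta> l \<omega>) N"
    and "W = gint g \<eta> N"
  have UVW: "all_moments M U" "all_moments M V" "all_moments M W"
    unfolding U_def V_def W_def
    using gint_all_moments[OF g(1) ads] gint_all_moments[OF g(1) adapted_cotlar[OF ads]] gint_all_moments[OF g(1) ad(1)] by auto
  note [measurable] = UVW[THEN all_moments_measurable] X(1)[THEN borel_measurable_integrable]
  have iU: "integrable M (\<lambda>\<omega>. U \<omega> ^ q)" and iV: "integrable M (\<lambda>\<omega>. V \<omega> ^ q)"
    using UVW by (auto intro: all_moments_integrable_power finite_measure_axioms)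
  have iW: "integrable M W" and iU1: "integrable M U"
    using UVW by (auto intro: all_moments_integrable)
  have "(\<integral>\<omega>. Re (Complex (U \<omega>) (V \<omega>) ^ q) \<partial>M) = 0"
  proof -
    have "(\<integral>\<omega>. Re (Complex (U \<omega>) (V \<omega>) ^ q) \<partial>M) = Re (CLINT \<omega>|M. Complex (U \<omega>) (V \<omega>) ^ q)"
      by (intro integral_Re integrable_Complex_power finite_measure_axioms UVW)
    also have "(CLINT \<omega>|M. Complex (U \<omega>) (V \<omega>) ^ q) = 0"
      using gcint_power[OF g(1) ads order_refl, of q] q2 unfolding gcint_def U_def V_def by simp
    finally show ?thesis by simp
  qed
  then have VU: "(\<integral>\<omega>. V \<omega> ^ q \<partial>M) \<le> cot (pi / (2 * real q)) ^ q * (\<integral>\<omega>. U \<omega> ^ q \<partial>M)"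
    using cotlar_moment_bound[OF k, of U M V] iU iV unfolding q by simp
  \<comment> \<open>Clamping at 2 R instead of R: a value beyond 2 R must come from a step of size
    at least half of it, since all earlier values were within R.\<close>
  define L where "L = 2 * R"
  have L: "L \<ge> 0" using R by (simp add: L_def)
  define C where "C \<omega> = clamp_real L (U \<omega>)" for \<omega>
  have Cb: "\<bar>C \<omega>\<bar> \<le> L" for \<omega> unfolding C_def by (rule abs_clamp_real_le[OF L])
  have [measurable]: "C \<in> borel_measurable M" unfolding C_def[abs_def] by measurable
  have Cpb: "\<bar>C \<omega> ^ j\<bar> \<le> L ^ j" for \<omega> j
    unfolding power_abs using Cb by (intro power_mono) auto
  have iC: "integrable M (\<lambda>\<omega>. C \<omega> ^ q)"
    using Cpb by (intro integrable_const_bound[of _ "L ^ q"]) auto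
  have iCW: "integrable M (\<lambda>\<omega>. C \<omega> ^ (q - 1) * (W \<omega> - U \<omega>))"
  proof (rule Bochner_Integration.integrable_bound)
    show "integrable M (\<lambda>\<omega>. L ^ (q - 1) * (W \<omega> - U \<omega>))" using iW iU1 by simp
    show "AE \<omega> in M. norm (C \<omega> ^ (q - 1) * (W \<omega> - U \<omega>)) \<le> norm (L ^ (q - 1) * (W \<omega> - U \<omega>))"
      using Cpb L by (intro AE_I2) (simp add: abs_mult mult_right_mono)
  qed measurable
  have orth: "(\<integral>\<omega>. C \<omega> ^ (q - 1) * (W \<omega> - U \<omega>) \<partial>M) = 0"
    unfolding C_def U_def W_def
  proof (rule stopped_orthogonal[OF g(1) ad])
    show "\<bar>clamp_real L x ^ (q - 1)\<bar> \<le> L ^ (q - 1)" for x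
      unfolding power_abs using abs_clamp_real_le[OF L, of x] by (intro power_mono) auto
  qed measurable
  \<comment> \<open>Tangent to x^q at \<open>C\<close>, evaluated at \<open>X\<close>, with X - C =
    (X - W) + (W - U) + (U - C). The slope makes the first part an L^1 error, the second is
    orthogonal to it, and the third contributes with nonnegative sign because q - 1 is odd.\<close>
  have "(\<integral>\<omega>. C \<omega> ^ q \<partial>M) \<le> (\<integral>\<omega>. X \<omega> ^ q + real q * L ^ (q - 1) * \<bar>W \<omega> - X \<omega>\<bar> - real q * (C \<omega> ^ (q - 1) * (W \<omega> - U \<omega>)) \<partial>M)"
  proof (rule integral_mono[OF iC])
    show "integrable M (\<lambda>\<omega>. X \<omega> ^ q + real q * L ^ (q - 1) * \<bar>W \<omega> - X \<omega>\<bar> - real q * (C \<omega> ^ (q - 1) * (W \<omega> - U \<omega>)))"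
      using X iW iCW by simp
    fix \<omega>
    have t: "C \<omega> ^ q + real q * C \<omega> ^ (q - 1) * (X \<omega> - C \<omega>) \<le> X \<omega> ^ q"
      by (rule even_power_above_tangent[OF q2(1)])
    have p: "0 \<le> real q * (C \<omega> ^ (q - 1) * (U \<omega> - C \<omega>))"
      using clamp_real_odd_power_nonneg[OF q2(3) L, of "U \<omega>"] by (simp add: C_def)
    have "C \<omega> ^ (q - 1) * (W \<omega> - X \<omega>) \<le> \<bar>C \<omega> ^ (q - 1)\<bar> * \<bar>W \<omega> - X \<omega>\<bar>"
      unfolding abs_mult[symmetric] by simp
    also have "\<dots> \<le> L ^ (q - 1) * \<bar>W \<omega> - X \<omega>\<bar>" using Cpb by (intro mult_right_mono) auto
    finally have "real q * (C \<omega> ^ (q - 1) * (W \<omega> - X \<omega>)) \<le> real q * (L ^ (q - 1) * \<bar>W \<omega> - X \<omega>\<bar>)"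
      by (intro mult_left_mono) auto
    then show "C \<omega> ^ q \<le> X \<omega> ^ q + real q * L ^ (q - 1) * \<bar>W \<omega> - X \<omega>\<bar> - real q * (C \<omega> ^ (q - 1) * (W \<omega> - U \<omega>))"
      using t p by (simp add: algebra_simps)
  qed
  also have "\<dots> = (\<integral>\<omega>. X \<omega> ^ q \<partial>M) + real q * L ^ (q - 1) * (\<integral>\<omega>. \<bar>W \<omega> - X \<omega>\<bar> \<partial>M)"
    using X iW iCW orth by simp
  finally have CX: "(\<integral>\<omega>. C \<omega> ^ q \<partial>M) \<le> (\<integral>\<omega>. X \<omega> ^ q \<partial>M) + real q * L ^ (q - 1) * (\<integral>\<omega>. \<bar>W \<omega> - X \<omega>\<bar> \<partial>M)" .
  \<comment> \<open>Where |U| > 2 R the stopped modulus exceeds 1 and is at most twice some step, so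
    its q-th power is below the m-th power of twice that step. The sum over all cells makes it
    unnecessary to single out the exit cell.\<close>
  define D where "D \<omega> = (\<Sum>l<N. (2 * cmod (gcstep g \<eta> l \<omega>)) ^ m)" for \<omega>
  have iD: "integrable M D"
    unfolding D_def[abs_def] using gcstep_moment(1)[OF g(1) ad _ h(1,3) m] by auto
  define \<kappa> where "\<kappa> = 4 ^ m * 2 * c ^ m * (\<integral>x. \<bar>x\<bar> ^ m \<partial>std_normal_distribution)"
  have \<kappa>: "\<kappa> \<ge> 0" unfolding \<kappa>_def using ad by (auto intro!: mult_nonneg_nonneg integral_nonneg_AE)
  have "(\<integral>\<omega>. D \<omega> \<partial>M) = (\<Sum>l<N. (\<integral>\<omega>. (2 * cmod (gcstep g \<eta> l \<omega>)) ^ m \<partial>M))"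
    unfolding D_def using gcstep_moment(1)[OF g(1) ad _ h(1,3) m] by (intro Bochner_Integration.integral_sum) auto
  also have "\<dots> \<le> (\<Sum>l<N. \<kappa> * h * (g (Suc l) - g l))"
    unfolding \<kappa>_def using gcstep_moment(2)[OF g(1) ad _ h(1,3) m] by (intro sum_mono) auto
  also have "\<dots> = \<kappa> * h * (g N - g 0)"
    by (simp add: sum_distrib_left[symmetric] sum_lessThan_telescope)
  also have "\<dots> \<le> \<kappa> * h * t"
    using g \<kappa> h(2) by (intro mult_left_mono) (auto simp: grid_def)
  finally have D: "(\<integral>\<omega>. D \<omega> \<partial>M) \<le> \<kappa> * h * t" .
  have D0: "D \<omega> \<ge> 0" for \<omega> unfolding D_def by (intro sum_nonneg) simp
  have "(\<integral>\<omega>. U \<omega> ^ q \<partial>M) \<le> (\<integral>\<omega>. C \<omega> ^ q + D \<omega> \<partial>M)"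
  proof (intro integral_mono iU Bochner_Integration.integrable_add iC iD)
    fix \<omega>
    show "U \<omega> ^ q \<le> C \<omega> ^ q + D \<omega>"
    proof (cases "\<bar>U \<omega>\<bar> \<le> L")
      case True
      then have "C \<omega> = U \<omega>" by (auto simp: C_def clamp_real_def)
      then show ?thesis using D0 by simp
    next
      case False
      define z where "z = cmod (gcint g (stopped R g \<eta>) N \<omega>)"
      have zU: "\<bar>U \<omega>\<bar> \<le> z" unfolding z_def U_def gcint_def using abs_Re_le_cmod[of "Complex _ _"] by simp
      then have z: "z > 2 * R" using False by (simp add: L_def)
      then obtain l where l: "l < N" "z \<le> R + cmod (gcstep g \<eta> l \<omega>)"
        using gcint_stopped_overshoot[of R g \<eta> N \<omega>] R unfolding z_def[symmetric] by fastforce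
      have z2: "z \<le> 2 * cmod (gcstep g \<eta> l \<omega>)" using l z by linarith
      have "U \<omega> ^ q = \<bar>U \<omega>\<bar> ^ q" using q2(1) by (simp add: power_even_abs)
      also have "\<dots> \<le> z ^ q" using zU by (intro power_mono) auto
      also have "\<dots> \<le> z ^ m" using z R by (intro power_increasing) (auto simp: m_def)
      also have "\<dots> \<le> (2 * cmod (gcstep g \<eta> l \<omega>)) ^ m" using z2 z R by (intro power_mono) auto
      also have "\<dots> \<le> D \<omega>" unfolding D_def using l by (intro member_le_sum) auto
      finally show ?thesis using zero_le_even_power[OF q2(1), of "C \<omega>"] by linarith
    qed
  qed
  also have "\<dots> = (\<integral>\<omega>. C \<omega> ^ q \<partial>M) + (\<integral>\<omega>. D \<omega> \<partial>M)" using iC iD by simp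
  finally have "(\<integral>\<omega>. U \<omega> ^ q \<partial>M) \<le> (\<integral>\<omega>. X \<omega> ^ q \<partial>M) + real q * L ^ (q - 1) * (\<integral>\<omega>. \<bar>W \<omega> - X \<omega>\<bar> \<partial>M) + \<kappa> * h * t"
    using CX D by linarith
  then have "cot (pi / (2 * real q)) ^ q * (\<integral>\<omega>. U \<omega> ^ q \<partial>M) \<le> cot (pi / (2 * real q)) ^ q * ((\<integral>\<omega>. X \<omega> ^ q \<partial>M) + real q * L ^ (q - 1) * (\<integral>\<omega>. \<bar>W \<omega> - X \<omega>\<bar> \<partial>M) + \<kappa> * h * t)"
    using q2(1) by (intro mult_left_mono) auto
  then show ?thesis using VU unfolding V_def W_def L_def \<kappa>_def m_def by linarith
qed

text \<open>Passage from the stopped imaginary part to the unstopped one and then to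
  \<open>Y\<close>. The first costs at most a^q times the chance of having left the disc, estimated
  by second moments over R^2; the second costs the Lipschitz constant q a^(q-1) of x^q on [0, a]
  times an L^1 distance.\<close>

lemma truncated_moment_bound:
  fixes X Y :: "'a \<Rightarrow> real"
  assumes g: "grid g N" "g N \<le> t" and ad: "adapted g N c \<eta>" "c \<ge> 0"
    and h: "\<And>i. i < N \<Longrightarrow> g (Suc i) - g i \<le> h" "0 \<le> h" "h \<le> 1"
    and R: "R \<ge> 1" and k: "k \<ge> 1" and q: "q = 2 ^ k" and a: "a \<ge> 0"
    and X: "integrable M X" "integrable M (\<lambda>\<omega>. X \<omega> ^ q)" and Y: "integrable M Y"
  shows "(\<integral>\<omega>. (min \<bar>Y \<omega>\<bar> a) ^ q \<partial>M) \<le>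
    cot (pi / (2 * real q)) ^ q * ((\<integral>\<omega>. X \<omega> ^ q \<partial>M) + real q * (2 * R) ^ (q - 1) * (\<integral>\<omega>. \<bar>gint g \<eta> N \<omega> - X \<omega>\<bar> \<partial>M)
      + 4 ^ (q + 2) * 2 * c ^ (q + 2) * (\<integral>x. \<bar>x\<bar> ^ (q + 2) \<partial>std_normal_distribution) * h * t)
    + 2 * a ^ q / R\<^sup>2 * (\<integral>\<omega>. (gint g \<eta> N \<omega>)\<^sup>2 \<partial>M)
    + real q * a ^ (q - 1) * (\<integral>\<omega>. \<bar>gint g (\<lambda>l \<omega>. A *v \<eta> l \<omega>) N \<omega> - Y \<omega>\<bar> \<partial>M)"
proof -
  have q2: "even q" "q \<ge> 2"
    using k unfolding q by (auto intro: self_le_power)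
  note ads = adapted_stopped[OF g(1) ad, of R]
  define U V W where "U = gint g (stopped R g \<eta>) N" and "V = gint g (\<lambda>l \<omega>. A *v stopped R g \<eta> l \<omega>) N"
    and "W = gint g (\<lambda>l \<omega>. A *v \<eta> l \<omega>) N"
  have UVW: "all_moments M U" "all_moments M V" "all_moments M W"
    unfolding U_def V_def W_def
    using gint_all_moments[OF g(1) ads] gint_all_moments[OF g(1) adapted_cotlar[OF ads]] gint_all_moments[OF g(1) adapted_cotlar[OF ad(1)]] by auto
  note [measurable] = UVW[THEN all_moments_measurable] X(1)[THEN borel_measurable_integrable] Y[THEN borel_measurable_integrable]
  have int: "integrable M (\<lambda>\<omega>. V \<omega> ^ q)" "integrable M (\<lambda>\<omega>. (U \<omega>)\<^sup>2)" "integrable M (\<lambda>\<omega>. (V \<omega>)\<^sup>2)" "integrable M W"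
    using UVW by (auto intro: all_moments_integrable_power all_moments_integrable finite_measure_axioms)
  have iY: "integrable M (\<lambda>\<omega>. (min \<bar>Y \<omega>\<bar> a) ^ q)"
    using a by (intro integrable_const_bound[of _ "a ^ q"]) (auto intro!: AE_I2 power_mono)
  have "(\<integral>\<omega>. (min \<bar>Y \<omega>\<bar> a) ^ q \<partial>M) \<le> (\<integral>\<omega>. V \<omega> ^ q + a ^ q / R\<^sup>2 * ((U \<omega>)\<^sup>2 + (V \<omega>)\<^sup>2) + real q * a ^ (q - 1) * \<bar>W \<omega> - Y \<omega>\<bar> \<partial>M)"
  proof (rule integral_mono[OF iY])
    show "integrable M (\<lambda>\<omega>. V \<omega> ^ q + a ^ q / R\<^sup>2 * ((U \<omega>)\<^sup>2 + (V \<omega>)\<^sup>2) + real q * a ^ (q - 1) * \<bar>W \<omega> - Y \<omega>\<bar>)"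
      using int Y by simp
    fix \<omega>
    have "(min \<bar>W \<omega>\<bar> a) ^ q \<le> V \<omega> ^ q + a ^ q / R\<^sup>2 * ((U \<omega>)\<^sup>2 + (V \<omega>)\<^sup>2)"
    proof (cases "gcint g (stopped R g \<eta>) N \<omega> = gcint g \<eta> N \<omega>")
      case True
      then have VW: "V \<omega> = W \<omega>" by (simp add: gcint_def V_def W_def)
      have "(min \<bar>W \<omega>\<bar> a) ^ q \<le> \<bar>W \<omega>\<bar> ^ q" using a by (intro power_mono) auto
      also have "\<dots> = V \<omega> ^ q" using q2(1) VW by (simp add: power_even_abs)
      finally show ?thesis using a by (simp add: add_increasing2)
    next
      \<comment> \<open>Chebyshev's inequality in pointwise form: the stopped value lies outside the
        disc, so (U^2 + V^2) / R^2 is at least 1 and pays for the full truncation level.\<close>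
      case False
      then have "cmod (gcint g (stopped R g \<eta>) N \<omega>) > R"
        using gcint_stopped_cases[of N g \<eta> \<omega> R] by auto
      then have "R\<^sup>2 \<le> (cmod (gcint g (stopped R g \<eta>) N \<omega>))\<^sup>2" using R by (intro power_mono) auto
      also have "\<dots> = (U \<omega>)\<^sup>2 + (V \<omega>)\<^sup>2" unfolding gcint_def cmod_power2 U_def V_def by simp
      finally have "1 \<le> ((U \<omega>)\<^sup>2 + (V \<omega>)\<^sup>2) / R\<^sup>2" using R by simp
      then have "a ^ q * 1 \<le> a ^ q * (((U \<omega>)\<^sup>2 + (V \<omega>)\<^sup>2) / R\<^sup>2)" using a by (intro mult_left_mono) auto
      moreover have "(min \<bar>W \<omega>\<bar> a) ^ q \<le> a ^ q" using a by (intro power_mono) auto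
      moreover have "0 \<le> V \<omega> ^ q" by (rule zero_le_even_power[OF q2(1)])
      ultimately show ?thesis by simp
    qed
    \<comment> \<open>The tangent inequality at the truncated \<open>W\<close> after exchanging
      roles: x^q - y^q <= q x^(q-1) (x - y), and truncation does not increase distances.\<close>
    moreover have "(min \<bar>Y \<omega>\<bar> a) ^ q \<le> (min \<bar>W \<omega>\<bar> a) ^ q + real q * a ^ (q - 1) * \<bar>W \<omega> - Y \<omega>\<bar>"
    proof -
      define x y where "x = min \<bar>Y \<omega>\<bar> a" and "y = min \<bar>W \<omega>\<bar> a"
      have xy: "0 \<le> x" "x \<le> a" "\<bar>x - y\<bar> \<le> \<bar>W \<omega> - Y \<omega>\<bar>" using a by (auto simp: x_def y_def)
      have "x ^ q \<le> y ^ q + real q * (x ^ (q - 1) * (x - y))"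
        using even_power_above_tangent[OF q2(1), of x y] by (simp add: algebra_simps)
      also have "x ^ (q - 1) * (x - y) \<le> x ^ (q - 1) * \<bar>x - y\<bar>" using xy by (intro mult_left_mono) auto
      also have "\<dots> \<le> a ^ (q - 1) * \<bar>W \<omega> - Y \<omega>\<bar>" using xy a by (intro mult_mono power_mono) auto
      finally show ?thesis unfolding x_def y_def by (simp add: mult.assoc mult_left_mono)
    qed
    ultimately show "(min \<bar>Y \<omega>\<bar> a) ^ q \<le> V \<omega> ^ q + a ^ q / R\<^sup>2 * ((U \<omega>)\<^sup>2 + (V \<omega>)\<^sup>2) + real q * a ^ (q - 1) * \<bar>W \<omega> - Y \<omega>\<bar>"
      by linarith
  qed
  also have "\<dots> = (\<integral>\<omega>. V \<omega> ^ q \<partial>M) + a ^ q / R\<^sup>2 * ((\<integral>\<omega>. (U \<omega>)\<^sup>2 \<partial>M) + (\<integral>\<omega>. (V \<omega>)\<^sup>2 \<partial>M)) + real q * a ^ (q - 1) * (\<integral>\<omega>. \<bar>W \<omega> - Y \<omega>\<bar> \<partial>M)"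
    using int Y by simp
  finally have e: "(\<integral>\<omega>. (min \<bar>Y \<omega>\<bar> a) ^ q \<partial>M) \<le> (\<integral>\<omega>. V \<omega> ^ q \<partial>M) + a ^ q / R\<^sup>2 * ((\<integral>\<omega>. (U \<omega>)\<^sup>2 \<partial>M) + (\<integral>\<omega>. (V \<omega>)\<^sup>2 \<partial>M)) + real q * a ^ (q - 1) * (\<integral>\<omega>. \<bar>W \<omega> - Y \<omega>\<bar> \<partial>M)" .
  \<comment> \<open>Isometry in both forms: \<open>A\<close> preserves lengths, so \<open>U\<close>
    and \<open>V\<close> have equal second moments, and stopping only removes cells. Thus the bound
    is in terms of the unstopped integral, independently of \<open>R\<close>.\<close>
  have "(\<integral>\<omega>. (U \<omega>)\<^sup>2 \<partial>M) + (\<integral>\<omega>. (V \<omega>)\<^sup>2 \<partial>M) \<le> 2 * (\<integral>\<omega>. (gint g \<eta> N \<omega>)\<^sup>2 \<partial>M)"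
  proof -
    have "(\<integral>\<omega>. (V \<omega>)\<^sup>2 \<partial>M) = (\<integral>\<omega>. (U \<omega>)\<^sup>2 \<partial>M)"
      unfolding U_def V_def by (rule gint_square_cotlar[OF g(1) ads order_refl])
    moreover have "(\<integral>\<omega>. (U \<omega>)\<^sup>2 \<partial>M) \<le> (\<integral>\<omega>. (gint g \<eta> N \<omega>)\<^sup>2 \<partial>M)"
      unfolding U_def gint_square[OF g(1) ads order_refl] gint_square[OF g(1) ad(1) order_refl]
    proof (intro sum_mono mult_left_mono integral_mono)
      fix l assume l: "l \<in> {..<N}"
      have *: "integrable M (\<lambda>\<omega>. (norm (\<zeta> l \<omega>))\<^sup>2)" if "adapted g N c \<zeta>" for \<zeta>
      proof (rule integrable_const_bound[of _ "c\<^sup>2"])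
        have "\<zeta> l \<in> borel_measurable M" using that l by (intro measurable_F_M[of _ "g l"]) (auto simp: adapted_def)
        then show "(\<lambda>\<omega>. (norm (\<zeta> l \<omega>))\<^sup>2) \<in> borel_measurable M" by measurable
        show "AE \<omega> in M. norm ((norm (\<zeta> l \<omega>))\<^sup>2) \<le> c\<^sup>2"
          using that l by (intro AE_I2) (auto simp: adapted_def intro!: power_mono)
      qed
      show "integrable M (\<lambda>\<omega>. (norm (stopped R g \<eta> l \<omega>))\<^sup>2)" "integrable M (\<lambda>\<omega>. (norm (\<eta> l \<omega>))\<^sup>2)"
        using * ads ad by auto
      show "(norm (stopped R g \<eta> l \<omega>))\<^sup>2 \<le> (norm (\<eta> l \<omega>))\<^sup>2" for \<omega>
        by (auto simp: stopped_def)
      show "0 \<le> g (Suc l) - g l" using g(1) l by (auto simp: grid_def intro: less_imp_le)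
    qed
    ultimately show ?thesis by simp
  qed
  then have "a ^ q / R\<^sup>2 * ((\<integral>\<omega>. (U \<omega>)\<^sup>2 \<partial>M) + (\<integral>\<omega>. (V \<omega>)\<^sup>2 \<partial>M)) \<le> a ^ q / R\<^sup>2 * (2 * (\<integral>\<omega>. (gint g \<eta> N \<omega>)\<^sup>2 \<partial>M))"
    using a by (intro mult_left_mono) auto
  then have s: "a ^ q / R\<^sup>2 * ((\<integral>\<omega>. (U \<omega>)\<^sup>2 \<partial>M) + (\<integral>\<omega>. (V \<omega>)\<^sup>2 \<partial>M)) \<le> 2 * a ^ q / R\<^sup>2 * (\<integral>\<omega>. (gint g \<eta> N \<omega>)\<^sup>2 \<partial>M)"
    by (simp add: mult.assoc mult.left_commute)
  show ?thesis
    unfolding W_def[symmetric]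
    by (rule order_trans[OF e], intro add_mono order_refl s, unfold V_def, rule stopped_moment_bound[OF g ad h R k q X])
qed

end

section \<open>Elementary processes and passage to the limit\<close>

lemma increment_telescope:
  fixes g :: "nat \<Rightarrow> real" and f :: "real \<Rightarrow> 'b::real_vector"
  assumes mono: "\<And>i. i < N \<Longrightarrow> g i < g (Suc i)" and ab: "a \<in> g ` {..N}" "b \<in> g ` {..N}" "a \<le> b"
  shows "f b - f a = (\<Sum>i<N. if a < g (Suc i) \<and> g (Suc i) \<le> b then f (g (Suc i)) - f (g i) else 0)"
proof -
  obtain m n where m: "a = g m" "m \<le> N" and n: "b = g n" "n \<le> N" using ab by auto
  note lt = strict_grid_mono[of N g, OF mono]
  note le = strict_grid_mono_le[of N g, OF mono]
  have mn: "m \<le> n"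
    using lt[of n m] ab(3) m n by (cases "m \<le> n") auto
  have c: "(a < g (Suc i) \<and> g (Suc i) \<le> b) \<longleftrightarrow> (m \<le> i \<and> i < n)" if "i < N" for i
  proof -
    have "a < g (Suc i) \<longleftrightarrow> m \<le> i"
      using lt[of m "Suc i"] le[of "Suc i" m] m that by (cases "m \<le> i") (auto simp: not_le)
    moreover have "g (Suc i) \<le> b \<longleftrightarrow> i < n"
      using lt[of n "Suc i"] le[of "Suc i" n] n that by (cases "i < n") (auto simp: not_less)
    ultimately show ?thesis by simp
  qed
  have "(\<Sum>i<N. if a < g (Suc i) \<and> g (Suc i) \<le> b then f (g (Suc i)) - f (g i) else 0)
     = (\<Sum>i<N. if m \<le> i \<and> i < n then f (g (Suc i)) - f (g i) else 0)"
    using c by (intro sum.cong) auto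
  also have "\<dots> = (\<Sum>i = m..<n. f (g (Suc i)) - f (g i))"
    using n by (intro sum.mono_neutral_cong_right) auto
  also have "\<dots> = f b - f a"
    using sum_Suc_diff'[OF mn, of "\<lambda>i. f (g i)"] m n by simp
  finally show ?thesis by simp
qed

context brownian
begin

text \<open>Jump times beyond \<open>t\<close> are exempt, as \<open>elem_int\<close> caps them at
  \<open>t\<close>. Since only the set of jump times matters, a strict grid can refine a list of
  times with repetitions.\<close>

definition refines :: "(nat \<Rightarrow> real) \<Rightarrow> nat \<Rightarrow> real \<Rightarrow> nat \<Rightarrow> (nat \<Rightarrow> real) \<Rightarrow> bool" where
  "refines g N t k ts \<longleftrightarrow> grid g N \<and> g 0 = 0 \<and> g N = t \<and> ts ` {..k} \<inter> {..t} \<subseteq> g ` {..N}"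

lemma elem_proc_times:
  assumes "elem_proc M F k ts \<xi>"
  shows "j \<le> k \<Longrightarrow> 0 \<le> ts j"
proof (induction j)
  case (Suc j)
  have "ts j \<le> ts (Suc j)" using assms Suc.prems by (simp add: elem_proc_def)
  then show ?case using Suc by simp
qed (use assms in \<open>simp add: elem_proc_def\<close>)

lemma grid_exists:
  assumes "finite Q" "Q \<subseteq> {0..t}" "t \<ge> 0"
  obtains g N where "grid g N" "g 0 = 0" "g N = t" "Q \<subseteq> g ` {..N}"
proof -
  have S: "finite (Q \<union> {0, t})" "Q \<union> {0, t} \<noteq> {}" using assms by auto
  obtain N g where g: "g ` {..N} = Q \<union> {0, t}" "\<And>i. i < N \<Longrightarrow> g i < g (Suc i)" "g 0 = Min (Q \<union> {0, t})" "g N = Max (Q \<union> {0, t})"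
    using finite_real_grid[OF S] by metis
  have "g 0 = 0" unfolding g(3) using assms by (intro Min_eqI) auto
  moreover have "g N = t" unfolding g(4) using assms by (intro Max_eqI) auto
  ultimately show ?thesis using that[of g N] g by (auto simp: grid_def)
qed

lemma elem_fun_bounded:
  assumes "elem_proc M F k ts \<xi>"
  obtains c where "c \<ge> 0" "\<And>s \<omega>. \<omega> \<in> space M \<Longrightarrow> norm (elem_fun k ts \<xi> s \<omega>) \<le> c"
proof -
  have "\<forall>j\<in>{..<k}. \<exists>c. \<forall>\<omega>\<in>space M. norm (\<xi> j \<omega>) \<le> c"
    using assms unfolding elem_proc_def bounded_iff by fastforce
  then obtain C where C: "\<And>j \<omega>. j < k \<Longrightarrow> \<omega> \<in> space M \<Longrightarrow> norm (\<xi> j \<omega>) \<le> C j"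
    by (metis bchoice lessThan_iff)
  show ?thesis
  proof (rule that[of "\<Sum>j<k. \<bar>C j\<bar>"])
    fix s \<omega> assume \<omega>: "\<omega> \<in> space M"
    have "norm (elem_fun k ts \<xi> s \<omega>) \<le> (\<Sum>j<k. norm (if ts j < s \<and> s \<le> ts (Suc j) then \<xi> j \<omega> else 0))"
      unfolding elem_fun_def by (rule norm_sum)
    also have "\<dots> \<le> (\<Sum>j<k. \<bar>C j\<bar>)"
    proof (rule sum_mono)
      fix j assume "j \<in> {..<k}"
      then have "norm (\<xi> j \<omega>) \<le> \<bar>C j\<bar>" using C[of j \<omega>] \<omega> by auto
      then show "norm (if ts j < s \<and> s \<le> ts (Suc j) then \<xi> j \<omega> else 0) \<le> \<bar>C j\<bar>" by auto
    qed
    finally show "norm (elem_fun k ts \<xi> s \<omega>) \<le> (\<Sum>j<k. \<bar>C j\<bar>)" .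
  qed (simp add: sum_nonneg)
qed

context
  fixes g :: "nat \<Rightarrow> real" and N t k ts and \<xi> :: "nat \<Rightarrow> 'a \<Rightarrow> real^'n"
  assumes ref: "refines g N t k ts" and el: "elem_proc M F k ts \<xi>"
begin

lemma refines_mono: "i \<le> j \<Longrightarrow> j \<le> N \<Longrightarrow> g i \<le> g j"
  using ref strict_grid_mono_le[of N g i j] by (auto simp: refines_def grid_def)

text \<open>No jump time lies strictly inside a cell. This gives both constancy of the process on a
  cell and measurability of its value at the left end.\<close>

lemma refines_lt_imp_le:
  assumes "j \<le> k" "i < N" "ts j < g (Suc i)"
  shows "ts j \<le> g i"
proof -
  have "ts j \<le> t" using assms refines_mono[of "Suc i" N] ref by (auto simp: refines_def)
  then obtain l where l: "l \<le> N" "ts j = g l" using ref assms(1) by (force simp: refines_def)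
  have "l \<le> i"
    using refines_mono[of "Suc i" l] l assms by (cases "l \<le> i") auto
  then show ?thesis using l refines_mono[of l i] assms by auto
qed

lemma elem_fun_const_on_cell:
  assumes "i < N" "g i < s" "s \<le> g (Suc i)"
  shows "elem_fun k ts \<xi> s \<omega> = elem_fun k ts \<xi> (g (Suc i)) \<omega>"
  unfolding elem_fun_def
proof (rule sum.cong[OF refl])
  fix j assume j: "j \<in> {..<k}"
  have 1: "ts j < s \<longleftrightarrow> ts j < g (Suc i)"
    using refines_lt_imp_le[of j i] j assms by auto
  have 2: "s \<le> ts (Suc j) \<longleftrightarrow> g (Suc i) \<le> ts (Suc j)"
    using refines_lt_imp_le[of "Suc j" i] j assms by (auto simp: not_less[symmetric])
  show "(if ts j < s \<and> s \<le> ts (Suc j) then \<xi> j \<omega> else 0) = (if ts j < g (Suc i) \<and> g (Suc i) \<le> ts (Suc j) then \<xi> j \<omega> else 0)"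
    unfolding 1 2 ..
qed

text \<open>The pieces of \<open>elem_fun\<close> are open on the left and closed on the right, so
  the coefficient of a cell is the value at its right end. The increments over the coarse pieces
  telescope into cell increments, and the two sums are exchanged.\<close>

lemma elem_int_eq_gint: "elem_int B k ts \<xi> t \<omega> = gint g (\<lambda>i. elem_fun k ts \<xi> (g (Suc i))) N \<omega>"
proof -
  have gr: "\<And>i. i < N \<Longrightarrow> g i < g (Suc i)" "g N = t" using ref by (auto simp: refines_def grid_def)
  have tsmem: "min t (ts j) \<in> g ` {..N}" if "j \<le> k" for j
  proof (cases "ts j \<le> t")
    case True
    then show ?thesis using ref that by (auto simp: refines_def min_def)
  next
    case False
    then show ?thesis using gr by (auto simp: min_def)
  qed
  have "\<xi> j \<omega> \<bullet> (B (min t (ts (Suc j))) \<omega> - B (min t (ts j)) \<omega>)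
     = (\<Sum>i<N. (if ts j < g (Suc i) \<and> g (Suc i) \<le> ts (Suc j) then \<xi> j \<omega> else 0) \<bullet> (B (g (Suc i)) \<omega> - B (g i) \<omega>))" if j: "j < k" for j
  proof -
    have le: "min t (ts j) \<le> min t (ts (Suc j))" using el j by (force simp: elem_proc_def)
    have "B (min t (ts (Suc j))) \<omega> - B (min t (ts j)) \<omega>
      = (\<Sum>i<N. if min t (ts j) < g (Suc i) \<and> g (Suc i) \<le> min t (ts (Suc j)) then B (g (Suc i)) \<omega> - B (g i) \<omega> else 0)"
      using j by (intro increment_telescope[of N g _ _ "\<lambda>s. B s \<omega>"] gr(1) tsmem le) auto
    also have "\<dots> = (\<Sum>i<N. if ts j < g (Suc i) \<and> g (Suc i) \<le> ts (Suc j) then B (g (Suc i)) \<omega> - B (g i) \<omega> else 0)"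
    proof (rule sum.cong[OF refl])
      fix i assume "i \<in> {..<N}"
      then have "g (Suc i) \<le> t" using refines_mono[of "Suc i" N] gr by auto
      then have "(min t (ts j) < g (Suc i) \<and> g (Suc i) \<le> min t (ts (Suc j))) \<longleftrightarrow> (ts j < g (Suc i) \<and> g (Suc i) \<le> ts (Suc j))"
        by auto
      then show "(if min t (ts j) < g (Suc i) \<and> g (Suc i) \<le> min t (ts (Suc j)) then B (g (Suc i)) \<omega> - B (g i) \<omega> else 0)
        = (if ts j < g (Suc i) \<and> g (Suc i) \<le> ts (Suc j) then B (g (Suc i)) \<omega> - B (g i) \<omega> else 0)" by presburger
    qed
    finally show ?thesis by (simp add: inner_sum_right if_distrib[of "\<lambda>x. _ \<bullet> x"] if_distrib[of "\<lambda>x. x \<bullet> _"] cong: if_cong del: inner_diff_right)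
  qed
  then have "elem_int B k ts \<xi> t \<omega> = (\<Sum>j<k. \<Sum>i<N. (if ts j < g (Suc i) \<and> g (Suc i) \<le> ts (Suc j) then \<xi> j \<omega> else 0) \<bullet> (B (g (Suc i)) \<omega> - B (g i) \<omega>))"
    unfolding elem_int_def by (intro sum.cong) auto
  also have "\<dots> = (\<Sum>i<N. \<Sum>j<k. (if ts j < g (Suc i) \<and> g (Suc i) \<le> ts (Suc j) then \<xi> j \<omega> else 0) \<bullet> (B (g (Suc i)) \<omega> - B (g i) \<omega>))"
    by (rule sum.swap)
  also have "\<dots> = gint g (\<lambda>i. elem_fun k ts \<xi> (g (Suc i))) N \<omega>"
    unfolding gint_def elem_fun_def inner_sum_left ..
  finally show ?thesis .
qed

lemma adapted_elem_fun:
  assumes c: "\<And>s \<omega>. \<omega> \<in> space M \<Longrightarrow> norm (elem_fun k ts \<xi> s \<omega>) \<le> c"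
  shows "adapted g N c (\<lambda>i. elem_fun k ts \<xi> (g (Suc i)))"
  unfolding adapted_def
proof (intro allI impI conjI ballI c)
  fix i assume i: "i < N"
  show "elem_fun k ts \<xi> (g (Suc i)) \<in> borel_measurable (F (g i))"
    unfolding elem_fun_def[abs_def]
  proof (rule borel_measurable_sum)
    fix j assume j: "j \<in> {..<k}"
    show "(\<lambda>\<omega>. if ts j < g (Suc i) \<and> g (Suc i) \<le> ts (Suc j) then \<xi> j \<omega> else 0) \<in> borel_measurable (F (g i))"
    proof (cases "ts j < g (Suc i)")
      case True
      then have "\<xi> j \<in> borel_measurable (F (g i))"
        using refines_lt_imp_le[of j i] i j el by (intro measurable_F_mono[of _ "ts j" "g i"]) (auto simp: elem_proc_def)
      then show ?thesis by simp
    qed simp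
  qed
qed

end

lemma refines_two:
  assumes "t \<ge> 0" "elem_proc M F k ts \<xi>" "elem_proc M F k' ts' \<xi>'"
  obtains g N where "refines g N t k ts" "refines g N t k' ts'"
proof -
  have sub: "ts ` {..k} \<inter> {..t} \<union> ts' ` {..k'} \<inter> {..t} \<subseteq> {0..t}"
    using elem_proc_times[OF assms(2)] elem_proc_times[OF assms(3)] by auto
  have fin: "finite (ts ` {..k} \<inter> {..t} \<union> ts' ` {..k'} \<inter> {..t})" by simp
  obtain g N where "grid g N" "g 0 = 0" "g N = t" "ts ` {..k} \<inter> {..t} \<union> ts' ` {..k'} \<inter> {..t} \<subseteq> g ` {..N}"
    using grid_exists[OF fin sub assms(1)] by blast
  then show ?thesis using that[of g N] by (auto simp: refines_def)
qed

lemma refines_fine: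
  assumes "t \<ge> 0" "elem_proc M F k ts \<xi>" "h > 0"
  obtains g N where "refines g N t k ts" "\<And>i. i < N \<Longrightarrow> g (Suc i) - g i \<le> h"
proof -
  define P where "P = (\<lambda>i. real i * h) ` {..nat \<lceil>t / h\<rceil>} \<inter> {0..t}"
  have sub: "ts ` {..k} \<inter> {..t} \<union> P \<subseteq> {0..t}"
    using elem_proc_times[OF assms(2)] by (auto simp: P_def)
  have fin: "finite (ts ` {..k} \<inter> {..t} \<union> P)" by (simp add: P_def)
  obtain g N where g: "grid g N" "g 0 = 0" "g N = t" "ts ` {..k} \<inter> {..t} \<union> P \<subseteq> g ` {..N}"
    using grid_exists[OF fin sub assms(1)] by blast
  have "g (Suc i) - g i \<le> h" if i: "i < N" for i
  proof (rule ccontr)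
    assume "\<not> g (Suc i) - g i \<le> h"
    then have big: "g i + h < g (Suc i)" by simp
    have g0: "0 \<le> g i" and gt: "g (Suc i) \<le> t"
      using grid_nonneg[OF g(1)] strict_grid_mono_le[of N g "Suc i" N] g i by (auto simp: grid_def)
    \<comment> \<open>The first multiple of \<open>h\<close> beyond g i. In a cell longer than
      \<open>h\<close> it would be a grid point strictly inside.\<close>
    define n where "n = nat \<lfloor>g i / h\<rfloor> + 1"
    have n1: "real n * h > g i"
    proof -
      have "g i / h < real n" using g0 assms(3) by (simp add: n_def) linarith
      then show ?thesis using assms(3) by (simp add: field_simps)
    qed
    have n2: "real n * h \<le> g i + h"
    proof -
      have "real n \<le> g i / h + 1" using g0 assms(3) by (simp add: n_def)
      then have "real n * h \<le> (g i / h + 1) * h" using assms(3) by (intro mult_right_mono) auto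
      also have "\<dots> = g i + h" using assms(3) by (simp add: distrib_right)
      finally show ?thesis .
    qed
    have "real n * h \<le> t" using n2 big gt by linarith
    then have "real n \<le> t / h" using assms(3) by (simp add: field_simps)
    then have "n \<le> nat \<lceil>t / h\<rceil>" by linarith
    moreover have "0 \<le> real n * h" using assms(3) by simp
    ultimately have "real n * h \<in> P" unfolding P_def using \<open>real n * h \<le> t\<close> by auto
    then obtain l where l: "l \<le> N" "real n * h = g l" using g(4) by auto
    have "i < l" using n1 l strict_grid_mono_le[of N g l i] g(1) i by (cases "i < l") (auto simp: grid_def)
    then have "g (Suc i) \<le> g l" using strict_grid_mono_le[of N g "Suc i" l] g(1) l by (auto simp: grid_def)
    then show False using l n2 big by linarith
  qed
  then show ?thesis using that[of g N] g by (auto simp: refines_def)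
qed

end

section \<open>Approximation in L^2\<close>

lemma square_diff_le: "((a::real) - b)\<^sup>2 \<le> 2 * (a - c)\<^sup>2 + 2 * (c - b)\<^sup>2"
  using zero_le_power2[of "(a - c) - (c - b)"] by (simp add: power2_eq_square algebra_simps)

context prob_space
begin

lemma expectation_abs_le_sqrt:
  assumes [measurable]: "f \<in> borel_measurable M" and int: "integrable M (\<lambda>x. (f x)\<^sup>2 :: real)"
  shows "expectation (\<lambda>x. \<bar>f x\<bar>) \<le> sqrt (expectation (\<lambda>x. (f x)\<^sup>2))"
proof (rule real_le_rsqrt)
  have i: "integrable M (\<lambda>x. \<bar>f x\<bar>)" using square_integrable_imp_integrable[OF assms] by simp
  have "0 \<le> variance (\<lambda>x. \<bar>f x\<bar>)" by (rule variance_positive)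
  also have "\<dots> = expectation (\<lambda>x. \<bar>f x\<bar>\<^sup>2) - (expectation (\<lambda>x. \<bar>f x\<bar>))\<^sup>2"
    using i int by (intro variance_eq) auto
  finally show "(expectation (\<lambda>x. \<bar>f x\<bar>))\<^sup>2 \<le> expectation (\<lambda>x. (f x)\<^sup>2)" by simp
qed

lemma l2_limit:
  fixes X :: "'a \<Rightarrow> real" and I :: "nat \<Rightarrow> 'a \<Rightarrow> real"
  assumes I[measurable]: "\<And>m. I m \<in> borel_measurable M" and I2: "\<And>m. integrable M (\<lambda>\<omega>. (I m \<omega>)\<^sup>2)"
    and X[measurable]: "X \<in> borel_measurable M"
    and lim: "(\<lambda>m. \<integral>\<^sup>+\<omega>. ennreal ((I m \<omega> - X \<omega>)\<^sup>2) \<partial>M) \<longlonglongrightarrow> 0"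
  shows "integrable M (\<lambda>\<omega>. (X \<omega>)\<^sup>2)" "\<And>m. integrable M (\<lambda>\<omega>. (I m \<omega> - X \<omega>)\<^sup>2)"
    "(\<lambda>m. expectation (\<lambda>\<omega>. (I m \<omega> - X \<omega>)\<^sup>2)) \<longlonglongrightarrow> 0" "(\<lambda>m. expectation (\<lambda>\<omega>. \<bar>I m \<omega> - X \<omega>\<bar>)) \<longlonglongrightarrow> 0"
proof -
  have "eventually (\<lambda>m. (\<integral>\<^sup>+\<omega>. ennreal ((I m \<omega> - X \<omega>)\<^sup>2) \<partial>M) < 1) sequentially"
    using order_tendstoD(2)[OF lim, of 1] by simp
  then obtain m where m: "(\<integral>\<^sup>+\<omega>. ennreal ((I m \<omega> - X \<omega>)\<^sup>2) \<partial>M) < 1"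
    by (auto simp: eventually_sequentially)
  then have "(\<integral>\<^sup>+\<omega>. ennreal ((I m \<omega> - X \<omega>)\<^sup>2) \<partial>M) < \<infinity>" by (rule less_trans) simp
  then have d: "integrable M (\<lambda>\<omega>. (I m \<omega> - X \<omega>)\<^sup>2)" by (intro integrableI_nonneg) auto
  show X2: "integrable M (\<lambda>\<omega>. (X \<omega>)\<^sup>2)"
  proof (rule Bochner_Integration.integrable_bound)
    show "integrable M (\<lambda>\<omega>. 2 * (I m \<omega> - X \<omega>)\<^sup>2 + 2 * (I m \<omega>)\<^sup>2)" using d I2 by simp
    show "AE \<omega> in M. norm ((X \<omega>)\<^sup>2) \<le> norm (2 * (I m \<omega> - X \<omega>)\<^sup>2 + 2 * (I m \<omega>)\<^sup>2)"
    proof (rule AE_I2)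
      fix \<omega>
      have "(X \<omega> - 0)\<^sup>2 \<le> 2 * (X \<omega> - I m \<omega>)\<^sup>2 + 2 * (I m \<omega> - 0)\<^sup>2" by (rule square_diff_le)
      then show "norm ((X \<omega>)\<^sup>2) \<le> norm (2 * (I m \<omega> - X \<omega>)\<^sup>2 + 2 * (I m \<omega>)\<^sup>2)"
        by (simp add: power2_commute)
    qed
  qed simp
  show D: "integrable M (\<lambda>\<omega>. (I m \<omega> - X \<omega>)\<^sup>2)" for m
  proof (rule Bochner_Integration.integrable_bound)
    show "integrable M (\<lambda>\<omega>. 2 * (I m \<omega>)\<^sup>2 + 2 * (X \<omega>)\<^sup>2)" using X2 I2 by simp
    show "AE \<omega> in M. norm ((I m \<omega> - X \<omega>)\<^sup>2) \<le> norm (2 * (I m \<omega>)\<^sup>2 + 2 * (X \<omega>)\<^sup>2)"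
      using square_diff_le[of "I m _" "X _" 0] by (intro AE_I2) simp
  qed simp
  have "(\<lambda>m. ennreal (expectation (\<lambda>\<omega>. (I m \<omega> - X \<omega>)\<^sup>2))) \<longlonglongrightarrow> ennreal 0"
    using lim D by (simp add: nn_integral_eq_integral)
  then show L: "(\<lambda>m. expectation (\<lambda>\<omega>. (I m \<omega> - X \<omega>)\<^sup>2)) \<longlonglongrightarrow> 0"
    by (rule tendsto_ennrealD) auto
  have "(\<lambda>m. sqrt (expectation (\<lambda>\<omega>. (I m \<omega> - X \<omega>)\<^sup>2))) \<longlonglongrightarrow> sqrt 0"
    by (intro tendsto_intros L)
  then have "(\<lambda>m. sqrt (expectation (\<lambda>\<omega>. (I m \<omega> - X \<omega>)\<^sup>2))) \<longlonglongrightarrow> 0" by simp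
  then show "(\<lambda>m. expectation (\<lambda>\<omega>. \<bar>I m \<omega> - X \<omega>\<bar>)) \<longlonglongrightarrow> 0"
  proof (rule Lim_null_comparison[rotated], intro always_eventually allI)
    fix m
    show "norm (expectation (\<lambda>\<omega>. \<bar>I m \<omega> - X \<omega>\<bar>)) \<le> sqrt (expectation (\<lambda>\<omega>. (I m \<omega> - X \<omega>)\<^sup>2))"
      using expectation_abs_le_sqrt[OF _ D[of m]] by simp
  qed
qed

end

context brownian
begin

lemma elem_int_all_moments:
  assumes "t \<ge> 0" "elem_proc M F k ts \<xi>"
  shows "all_moments M (elem_int B k ts \<xi> t)"
proof -
  obtain g N where ref: "refines g N t k ts" using refines_two[OF assms assms(2)] by blast
  obtain c where c: "\<And>s \<omega>. \<omega> \<in> space M \<Longrightarrow> norm (elem_fun k ts \<xi> s \<omega>) \<le> c"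
    using elem_fun_bounded[OF assms(2)] by blast
  have "grid g N" using ref by (simp add: refines_def)
  moreover have "adapted g N c (\<lambda>i. elem_fun k ts \<xi> (g (Suc i)))"
    by (rule adapted_elem_fun[OF ref assms(2) c])
  moreover have "elem_int B k ts \<xi> t = gint g (\<lambda>i. elem_fun k ts \<xi> (g (Suc i))) N"
    by (rule ext) (rule elem_int_eq_gint[OF ref assms(2)])
  ultimately show ?thesis using gint_all_moments by simp
qed

text \<open>On a common refinement the difference of two elementary integrals is again a grid
  integral, and the isometry applies. The cells cover (0, t] inside [0, t], which gives an
  inequality pointwise in the outcome.\<close>

lemma elem_int_isometry_le:
  assumes t: "t \<ge> 0" and e: "elem_proc M F k ts \<xi>" "elem_proc M F k' ts' \<xi>'"
  shows "(\<integral>\<^sup>+\<omega>. ennreal ((elem_int B k ts \<xi> t \<omega> - elem_int B k' ts' \<xi>' t \<omega>)\<^sup>2) \<partial>M)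
    \<le> (\<integral>\<^sup>+\<omega>. (\<integral>\<^sup>+s\<in>{0..t}. ennreal ((norm (elem_fun k ts \<xi> s \<omega> - elem_fun k' ts' \<xi>' s \<omega>))\<^sup>2) \<partial>lborel) \<partial>M)"
proof -
  obtain g N where ref: "refines g N t k ts" "refines g N t k' ts'" using refines_two[OF t e] by blast
  obtain c c' where c: "\<And>s \<omega>. \<omega> \<in> space M \<Longrightarrow> norm (elem_fun k ts \<xi> s \<omega>) \<le> c" "\<And>s \<omega>. \<omega> \<in> space M \<Longrightarrow> norm (elem_fun k' ts' \<xi>' s \<omega>) \<le> c'"
    using elem_fun_bounded[OF e(1)] elem_fun_bounded[OF e(2)] by metis
  have g: "grid g N" "g 0 = 0" "g N = t" using ref by (auto simp: refines_def)
  have mono: "\<And>i. i < N \<Longrightarrow> g i < g (Suc i)" using g by (auto simp: grid_def)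
  define f where "f s \<omega> = elem_fun k ts \<xi> s \<omega> - elem_fun k' ts' \<xi>' s \<omega>" for s \<omega>
  define \<delta> where "\<delta> i \<omega> = f (g (Suc i)) \<omega>" for i \<omega>
  have ad: "adapted g N (c + c') \<delta>"
    unfolding \<delta>_def f_def
    by (rule adapted_diff[OF adapted_elem_fun[OF ref(1) e(1) c(1)] adapted_elem_fun[OF ref(2) e(2) c(2)]])
  have cell: "f s \<omega> = \<delta> i \<omega>" if "i < N" "g i < s" "s \<le> g (Suc i)" for i s \<omega>
    unfolding f_def \<delta>_def elem_fun_const_on_cell[OF ref(1) e(1) that] elem_fun_const_on_cell[OF ref(2) e(2) that] ..
  have diff: "elem_int B k ts \<xi> t \<omega> - elem_int B k' ts' \<xi>' t \<omega> = gint g \<delta> N \<omega>" for \<omega>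
    unfolding elem_int_eq_gint[OF ref(1) e(1)] elem_int_eq_gint[OF ref(2) e(2)] gint_diff \<delta>_def f_def ..
  have \<delta>m: "\<delta> l \<in> borel_measurable M" if "l < N" for l
    using ad that by (intro measurable_F_M[of _ "g l"]) (auto simp: adapted_def)
  have \<delta>i: "integrable M (\<lambda>\<omega>. (norm (\<delta> l \<omega>))\<^sup>2)" if "l < N" for l
  proof (rule integrable_const_bound[of _ "(c + c')\<^sup>2"])
    show "AE \<omega> in M. norm ((norm (\<delta> l \<omega>))\<^sup>2) \<le> (c + c')\<^sup>2"
      using ad that by (intro AE_I2) (auto simp: adapted_def intro!: power_mono)
    show "(\<lambda>\<omega>. (norm (\<delta> l \<omega>))\<^sup>2) \<in> borel_measurable M" using \<delta>m[OF that] by measurable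
  qed
  have "(\<integral>\<^sup>+\<omega>. ennreal ((elem_int B k ts \<xi> t \<omega> - elem_int B k' ts' \<xi>' t \<omega>)\<^sup>2) \<partial>M) = ennreal (\<integral>\<omega>. (gint g \<delta> N \<omega>)\<^sup>2 \<partial>M)"
    unfolding diff
    by (intro nn_integral_eq_integral all_moments_integrable_power finite_measure_axioms gint_all_moments[OF g(1) ad]) auto
  also have "(\<integral>\<omega>. (gint g \<delta> N \<omega>)\<^sup>2 \<partial>M) = (\<Sum>l<N. (g (Suc l) - g l) * (\<integral>\<omega>. (norm (\<delta> l \<omega>))\<^sup>2 \<partial>M))"
    by (rule gint_square[OF g(1) ad order_refl])
  also have "ennreal \<dots> = (\<Sum>l<N. ennreal ((g (Suc l) - g l) * (\<integral>\<omega>. (norm (\<delta> l \<omega>))\<^sup>2 \<partial>M)))"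
    using mono by (intro sum_ennreal[symmetric] mult_nonneg_nonneg) (auto intro: less_imp_le)
  also have "\<dots> = (\<Sum>l<N. \<integral>\<^sup>+\<omega>. ennreal ((norm (\<delta> l \<omega>))\<^sup>2) * ennreal (g (Suc l) - g l) \<partial>M)"
  proof (rule sum.cong[OF refl])
    fix l assume "l \<in> {..<N}"
    then have l: "l < N" "0 \<le> g (Suc l) - g l" using mono[of l] by auto
    have "ennreal ((g (Suc l) - g l) * (\<integral>\<omega>. (norm (\<delta> l \<omega>))\<^sup>2 \<partial>M)) = (\<integral>\<^sup>+\<omega>. ennreal ((norm (\<delta> l \<omega>))\<^sup>2) \<partial>M) * ennreal (g (Suc l) - g l)"
      using \<delta>i[OF l(1)] l(2) by (simp add: nn_integral_eq_integral ennreal_mult mult.commute)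
    also have "\<dots> = (\<integral>\<^sup>+\<omega>. ennreal ((norm (\<delta> l \<omega>))\<^sup>2) * ennreal (g (Suc l) - g l) \<partial>M)"
    proof (rule nn_integral_multc[symmetric])
      note [measurable] = \<delta>m[OF l(1)]
      show "(\<lambda>\<omega>. ennreal ((norm (\<delta> l \<omega>))\<^sup>2)) \<in> borel_measurable M" by measurable
    qed
    finally show "ennreal ((g (Suc l) - g l) * (\<integral>\<omega>. (norm (\<delta> l \<omega>))\<^sup>2 \<partial>M)) = \<dots>" .
  qed
  also have "\<dots> = (\<integral>\<^sup>+\<omega>. (\<Sum>l<N. ennreal ((norm (\<delta> l \<omega>))\<^sup>2) * ennreal (g (Suc l) - g l)) \<partial>M)"
  proof (rule nn_integral_sum[symmetric])
    fix l assume "l \<in> {..<N}"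
    then have [measurable]: "\<delta> l \<in> borel_measurable M" using \<delta>m by simp
    show "(\<lambda>\<omega>. ennreal ((norm (\<delta> l \<omega>))\<^sup>2) * ennreal (g (Suc l) - g l)) \<in> borel_measurable M" by measurable
  qed
  also have "\<dots> \<le> (\<integral>\<^sup>+\<omega>. (\<integral>\<^sup>+s\<in>{0..t}. ennreal ((norm (f s \<omega>))\<^sup>2) \<partial>lborel) \<partial>M)"
  proof (rule nn_integral_mono)
    fix \<omega>
    have "(\<Sum>l<N. ennreal ((norm (\<delta> l \<omega>))\<^sup>2) * ennreal (g (Suc l) - g l))
       = (\<Sum>l<N. \<integral>\<^sup>+s. ennreal ((norm (\<delta> l \<omega>))\<^sup>2) * indicator {g l<..g (Suc l)} s \<partial>lborel)"
      using mono by (intro sum.cong refl) (simp add: nn_integral_cmult_indicator less_imp_le)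
    also have "\<dots> = (\<integral>\<^sup>+s. (\<Sum>l<N. ennreal ((norm (\<delta> l \<omega>))\<^sup>2) * indicator {g l<..g (Suc l)} s) \<partial>lborel)"
      by (rule nn_integral_sum[symmetric]) measurable
    also have "\<dots> \<le> (\<integral>\<^sup>+s\<in>{0..t}. ennreal ((norm (f s \<omega>))\<^sup>2) \<partial>lborel)"
    proof (rule nn_integral_mono)
      fix s
      show "(\<Sum>l<N. ennreal ((norm (\<delta> l \<omega>))\<^sup>2) * indicator {g l<..g (Suc l)} s) \<le> ennreal ((norm (f s \<omega>))\<^sup>2) * indicator {0..t} s"
      proof (cases "\<exists>i<N. s \<in> {g i<..g (Suc i)}")
        case True
        then obtain i where i: "i < N" "g i < s" "s \<le> g (Suc i)" by auto
        have uniq: "l = i" if l: "l < N" "s \<in> {g l<..g (Suc l)}" for l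
        proof (rule ccontr)
          assume "l \<noteq> i"
          then consider "l < i" | "i < l" by linarith
          then show False
          proof cases
            case 1
            then have "g (Suc l) \<le> g i" using strict_grid_mono_le[of N g "Suc l" i, OF mono] i by auto
            then show False using l i by auto
          next
            case 2
            then have "g (Suc i) \<le> g l" using strict_grid_mono_le[of N g "Suc i" l, OF mono] l by auto
            then show False using l i by auto
          qed
        qed
        have "(\<Sum>l<N. ennreal ((norm (\<delta> l \<omega>))\<^sup>2) * indicator {g l<..g (Suc l)} s) = (\<Sum>l\<in>{i}. ennreal ((norm (\<delta> l \<omega>))\<^sup>2) * indicator {g l<..g (Suc l)} s)"
        proof (rule sum.mono_neutral_right)
          show "\<forall>l\<in>{..<N} - {i}. ennreal ((norm (\<delta> l \<omega>))\<^sup>2) * indicator {g l<..g (Suc l)} s = 0"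
          proof
            fix l assume "l \<in> {..<N} - {i}"
            then have "s \<notin> {g l<..g (Suc l)}" using uniq[of l] by blast
            then show "ennreal ((norm (\<delta> l \<omega>))\<^sup>2) * indicator {g l<..g (Suc l)} s = 0" by simp
          qed
        qed (use i in auto)
        also have "\<dots> = ennreal ((norm (f s \<omega>))\<^sup>2)" using cell[OF i] i by simp
        also have "\<dots> = ennreal ((norm (f s \<omega>))\<^sup>2) * indicator {0..t} s"
        proof -
          have "0 \<le> g i" "g (Suc i) \<le> t"
            using grid_nonneg[OF g(1)] strict_grid_mono_le[of N g "Suc i" N, OF mono] i g by auto
          then show ?thesis using i by simp
        qed
        finally show ?thesis by simp
      next
        case False
        then have "(\<Sum>l<N. ennreal ((norm (\<delta> l \<omega>))\<^sup>2) * indicator {g l<..g (Suc l)} s) = 0"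
          by (intro sum.neutral ballI) (metis indicator_simps(2) lessThan_iff mult_zero_right)
        then show ?thesis by simp
      qed
    qed
    finally show "(\<Sum>l<N. ennreal ((norm (\<delta> l \<omega>))\<^sup>2) * ennreal (g (Suc l) - g l)) \<le> (\<integral>\<^sup>+s\<in>{0..t}. ennreal ((norm (f s \<omega>))\<^sup>2) \<partial>lborel)" .
  qed
  finally show ?thesis unfolding f_def .
qed

text \<open>The generating rectangles of the predictable sigma-algebra are product measurable, up to
  the order of the coordinates. That algebra lives on nonnegative times, so \<open>K\<close> is
  first restricted there and then extended by zero through the indicator.\<close>

lemma predictable_measurable:
  fixes K :: "real \<Rightarrow> 'a \<Rightarrow> real^'n"
  assumes "(\<lambda>(s, \<omega>). K s \<omega>) \<in> borel_measurable (predictable_sigma M F)"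
  shows "(\<lambda>(\<omega>, s). indicator {0..t} s *\<^sub>R K s \<omega>) \<in> borel_measurable (M \<Otimes>\<^sub>M lborel)"
proof -
  let ?\<Omega> = "space M \<times> {0::real..}"
  let ?R = "restrict_space (M \<Otimes>\<^sub>M lborel) ?\<Omega>"
  have \<Omega>: "?\<Omega> \<in> sets (M \<Otimes>\<^sub>M lborel)" by simp
  have spR: "space ?R = ?\<Omega>" by (auto simp: space_restrict_space space_pair_measure)
  have T: "(\<lambda>(\<omega>, s). (s, \<omega>)) \<in> measurable ?R (predictable_sigma M F)"
    unfolding predictable_sigma_def
  proof (rule measurable_measure_of)
    show "(\<lambda>(\<omega>, s). (s, \<omega>)) \<in> space ?R \<rightarrow> {0..} \<times> space M" unfolding spR by auto
    show "{{s<..t} \<times> S |s t S. 0 \<le> s \<and> s \<le> t \<and> S \<in> sets (F s)} \<union> {{0} \<times> S |S. S \<in> sets (F 0)} \<subseteq> Pow ({0..} \<times> space M)"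
    proof (intro Un_least subsetI)
      have sp: "S \<subseteq> space M" if "S \<in> sets (F s)" for S s using sets.sets_into_space[OF that] by simp
      fix Y assume "Y \<in> {{s<..t} \<times> S |s t S. 0 \<le> s \<and> s \<le> t \<and> S \<in> sets (F s)}"
      then obtain s t S where "Y = {s<..t} \<times> S" "0 \<le> s" "S \<in> sets (F s)" by blast
      then show "Y \<in> Pow ({0..} \<times> space M)" using sp[of S s] by auto
    next
      have sp: "S \<subseteq> space M" if "S \<in> sets (F s)" for S s using sets.sets_into_space[OF that] by simp
      fix Y assume "Y \<in> {{0::real} \<times> S |S. S \<in> sets (F 0)}"
      then obtain S where "Y = {0} \<times> S" "S \<in> sets (F 0)" by blast
      then show "Y \<in> Pow ({0..} \<times> space M)" using sp[of S 0] by auto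
    qed
    fix Y assume "Y \<in> {{s<..t} \<times> S |s t S. 0 \<le> s \<and> s \<le> t \<and> S \<in> sets (F s)} \<union> {{0::real} \<times> S |S. S \<in> sets (F 0)}"
    then have "\<exists>I S r. Y = I \<times> S \<and> I \<in> sets borel \<and> I \<subseteq> {0..} \<and> S \<in> sets (F r)"
    proof (elim UnE CollectE exE conjE)
      fix s t S assume "Y = {s<..t} \<times> S" "0 \<le> s" "S \<in> sets (F s)"
      then show ?thesis by (intro exI[of _ "{s<..t}"] exI[of _ S] exI[of _ s]) auto
    next
      fix S assume "Y = {0} \<times> S" "S \<in> sets (F 0)"
      then show ?thesis by (intro exI[of _ "{0}"] exI[of _ S] exI[of _ 0]) auto
    qed
    then obtain I S r where Y: "Y = I \<times> S" "I \<in> sets borel" "I \<subseteq> {0..}" "S \<in> sets (F r)" by blast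
    then have S: "S \<in> sets M" "S \<subseteq> space M" using sets_F_subset sets.sets_into_space by blast+
    have "(\<lambda>(\<omega>, s). (s, \<omega>)) -` Y \<inter> space ?R = S \<times> I"
      unfolding spR Y(1) using Y(3) S by auto
    moreover have "S \<times> I \<in> sets ?R"
      using S Y \<Omega> by (subst sets_restrict_space_iff) auto
    ultimately show "(\<lambda>(\<omega>, s). (s, \<omega>)) -` Y \<inter> space ?R \<in> sets ?R" by simp
  qed
  have "(\<lambda>(\<omega>, s). K s \<omega>) \<in> borel_measurable ?R"
    using measurable_compose[OF T assms] by (simp add: split_beta')
  then have "(\<lambda>x. indicator ?\<Omega> x *\<^sub>R (case x of (\<omega>, s) \<Rightarrow> K s \<omega>)) \<in> borel_measurable (M \<Otimes>\<^sub>M lborel)"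
    using \<Omega> by (subst (asm) borel_measurable_restrict_space_iff) (auto simp: Int_absorb2 space_pair_measure)
  then have "(\<lambda>x. indicator {0..t} (snd x) *\<^sub>R (indicator ?\<Omega> x *\<^sub>R (case x of (\<omega>, s) \<Rightarrow> K s \<omega>))) \<in> borel_measurable (M \<Otimes>\<^sub>M lborel)"
    by measurable
  then show ?thesis
    by (rule measurable_cong[THEN iffD1, rotated]) (auto simp: space_pair_measure indicator_def)
qed

end

context cotlar_brownian
begin

lemma elem_fun_cotlar: "elem_fun k ts (\<lambda>j \<omega>. A *v \<xi> j \<omega>) s \<omega> = A *v elem_fun k ts \<xi> s \<omega>"
proof -
  interpret linear "(*v) A" by simp
  show ?thesis
    unfolding elem_fun_def sum by (intro sum.cong) (auto simp: matrix_vector_mult_0_right)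
qed

lemma elem_proc_cotlar:
  assumes "elem_proc M F k ts \<xi>"
  shows "elem_proc M F k ts (\<lambda>j \<omega>. A *v \<xi> j \<omega>)"
  using assms measurable_matrix_vector_mult cotlar_matrix_properties(2)[OF cotlar]
  unfolding elem_proc_def bounded_iff by (auto simp: image_iff)

lemma elem_int_cotlar_eq_gint:
  assumes ref: "refines g N t k ts" and el: "elem_proc M F k ts \<xi>"
  shows "elem_int B k ts (\<lambda>j \<omega>. A *v \<xi> j \<omega>) t \<omega> = gint g (\<lambda>l \<omega>. A *v elem_fun k ts \<xi> (g (Suc l)) \<omega>) N \<omega>"
  unfolding elem_int_eq_gint[OF ref elem_proc_cotlar[OF el]] elem_fun_cotlar[abs_def] ..

lemma elem_int_kernel:
  assumes t: "t \<ge> 0" and el: "elem_proc M F k ts \<xi>"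
  shows "1 \<le> (\<integral>\<omega>. exp (- \<bar>s * elem_int B k ts \<xi> t \<omega>\<bar>) * cos (s * elem_int B k ts (\<lambda>j \<omega>. A *v \<xi> j \<omega>) t \<omega>)
      + \<bar>s * elem_int B k ts \<xi> t \<omega>\<bar> \<partial>M)"
proof -
  obtain g N where ref: "refines g N t k ts" using refines_two[OF t el el] by blast
  obtain c where c: "\<And>s \<omega>. \<omega> \<in> space M \<Longrightarrow> norm (elem_fun k ts \<xi> s \<omega>) \<le> c"
    using elem_fun_bounded[OF el] by blast
  let ?\<eta> = "\<lambda>i. elem_fun k ts \<xi> (g (Suc i))"
  have g: "grid g N" using ref by (simp add: refines_def)
  have ad: "adapted g N c ?\<eta>" by (rule adapted_elem_fun[OF ref el c])
  have 1: "s * elem_int B k ts \<xi> t \<omega> = gint g (\<lambda>l \<omega>. s *\<^sub>R ?\<eta> l \<omega>) N \<omega>" for \<omega>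
    unfolding gint_scale elem_int_eq_gint[OF ref el] ..
  have 2: "s * elem_int B k ts (\<lambda>j \<omega>. A *v \<xi> j \<omega>) t \<omega> = gint g (\<lambda>l \<omega>. A *v (s *\<^sub>R ?\<eta> l \<omega>)) N \<omega>" for \<omega>
    unfolding elem_int_cotlar_eq_gint[OF ref el] gint_scale[symmetric]
    by (simp add: matrix_vector_mult_scaleR)
  show ?thesis unfolding 1 2 by (rule gint_kernel[OF g adapted_scale[OF ad] order_refl])
qed

text \<open>The integral of a fixed elementary process is the same on every refining grid, so the
  mesh may tend to 0 with everything else fixed, and the overshoot error vanishes.\<close>

lemma elem_truncated_moment_bound:
  fixes X Y :: "'a \<Rightarrow> real"
  assumes t: "t \<ge> 0" and el: "elem_proc M F k ts \<xi>"
    and R: "R \<ge> 1" and n: "n \<ge> 1" and q: "q = 2 ^ n" and a: "a \<ge> 0"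
    and X: "integrable M X" "integrable M (\<lambda>\<omega>. X \<omega> ^ q)" and Y: "integrable M Y"
  shows "(\<integral>\<omega>. (min \<bar>Y \<omega>\<bar> a) ^ q \<partial>M) \<le>
    cot (pi / (2 * real q)) ^ q * ((\<integral>\<omega>. X \<omega> ^ q \<partial>M) + real q * (2 * R) ^ (q - 1) * (\<integral>\<omega>. \<bar>elem_int B k ts \<xi> t \<omega> - X \<omega>\<bar> \<partial>M))
    + 2 * a ^ q / R\<^sup>2 * (\<integral>\<omega>. (elem_int B k ts \<xi> t \<omega>)\<^sup>2 \<partial>M)
    + real q * a ^ (q - 1) * (\<integral>\<omega>. \<bar>elem_int B k ts (\<lambda>j \<omega>. A *v \<xi> j \<omega>) t \<omega> - Y \<omega>\<bar> \<partial>M)"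
    (is "?L \<le> ?C * ?P + ?Q + ?S")
proof -
  obtain c where c: "c \<ge> 0" "\<And>s \<omega>. \<omega> \<in> space M \<Longrightarrow> norm (elem_fun k ts \<xi> s \<omega>) \<le> c"
    using elem_fun_bounded[OF el] by blast
  \<comment> \<open>Depends on the bound \<open>c\<close> of this particular process, which need not
    stay bounded along an approximating sequence; so h tends to 0 before that sequence is
    followed.\<close>
  define \<kappa> where "\<kappa> = 4 ^ (q + 2) * 2 * c ^ (q + 2) * (\<integral>x. \<bar>x\<bar> ^ (q + 2) \<partial>std_normal_distribution)"
  have bound: "?L \<le> ?C * (?P + \<kappa> * h * t) + ?Q + ?S" if h: "0 < h" "h \<le> 1" for h
  proof -
    obtain g N where ref: "refines g N t k ts" and fine: "\<And>i. i < N \<Longrightarrow> g (Suc i) - g i \<le> h"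
      using refines_fine[OF t el h(1)] by blast
    have g: "grid g N" "g N \<le> t" using ref by (auto simp: refines_def)
    have ad: "adapted g N c (\<lambda>i. elem_fun k ts \<xi> (g (Suc i)))" by (rule adapted_elem_fun[OF ref el c(2)])
    show ?thesis
      unfolding \<kappa>_def elem_int_cotlar_eq_gint[OF ref el] elem_int_eq_gint[OF ref el]
      using h by (intro truncated_moment_bound[OF g ad c(1) fine _ _ R n q a X Y]) auto
  qed
  have "((\<lambda>h. ?C * (?P + \<kappa> * h * t) + ?Q + ?S) \<longlongrightarrow> ?C * (?P + \<kappa> * 0 * t) + ?Q + ?S) (at_right 0)"
    by (intro tendsto_intros)
  moreover have "eventually (\<lambda>h. ?L \<le> ?C * (?P + \<kappa> * h * t) + ?Q + ?S) (at_right 0)"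
    unfolding eventually_at_right_field
  proof (intro exI[of _ 1] conjI allI impI)
    fix y :: real assume "0 < y" "y < 1"
    then show "?L \<le> ?C * (?P + \<kappa> * y * t) + ?Q + ?S" by (intro bound) auto
  qed simp
  ultimately have "?L \<le> ?C * (?P + \<kappa> * 0 * t) + ?Q + ?S"
    by (intro tendsto_lowerbound) auto
  then show ?thesis by simp
qed

text \<open>The definitions of the two integrals provide unrelated approximating sequences, but the
  argument for pairs needs integrands \<xi> and A \<xi>. As \<open>A\<close> is an isometry, A \<xi>
  approximates A K; the isometry for elementary integrals then shows that both sequences lead to the
  same limit \<open>Y\<close>.\<close>

lemma cotlar_transform_l2_limit:
  fixes K :: "real \<Rightarrow> 'a \<Rightarrow> real^'n"
  assumes t: "t \<ge> 0" and pred: "(\<lambda>(s, \<omega>). K s \<omega>) \<in> borel_measurable (predictable_sigma M F)"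
    and el: "\<And>m. elem_proc M F (k m) (ts m) (\<xi> m)"
    and lim: "(\<lambda>m. \<integral>\<^sup>+\<omega>. (\<integral>\<^sup>+s\<in>{0..t}. ennreal ((norm (elem_fun (k m) (ts m) (\<xi> m) s \<omega> - K s \<omega>))\<^sup>2) \<partial>lborel) \<partial>M) \<longlonglongrightarrow> 0"
    and Y: "ito_integral M B (\<lambda>s \<omega>. A *v K s \<omega>) t Y"
  shows "(\<lambda>m. \<integral>\<^sup>+\<omega>. ennreal ((elem_int B (k m) (ts m) (\<lambda>j \<omega>. A *v \<xi> m j \<omega>) t \<omega> - Y \<omega>)\<^sup>2) \<partial>M) \<longlonglongrightarrow> 0"
proof -
  obtain k' ts' \<xi>' where Ym[measurable]: "Y \<in> borel_measurable M"
    and el': "\<And>m. elem_proc M F (k' m) (ts' m) (\<xi>' m)"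
    and lim': "(\<lambda>m. \<integral>\<^sup>+\<omega>. (\<integral>\<^sup>+s\<in>{0..t}. ennreal ((norm (elem_fun (k' m) (ts' m) (\<xi>' m) s \<omega> - A *v K s \<omega>))\<^sup>2) \<partial>lborel) \<partial>M) \<longlonglongrightarrow> 0"
    and limY: "(\<lambda>m. \<integral>\<^sup>+\<omega>. ennreal ((elem_int B (k' m) (ts' m) (\<xi>' m) t \<omega> - Y \<omega>)\<^sup>2) \<partial>M) \<longlonglongrightarrow> 0"
    using Y unfolding ito_integral_def by blast
  define f where "f m s \<omega> = elem_fun (k m) (ts m) (\<xi> m) s \<omega>" for m s \<omega>
  define f' where "f' m s \<omega> = elem_fun (k' m) (ts' m) (\<xi>' m) s \<omega>" for m s \<omega>
  define I where "I m = elem_int B (k m) (ts m) (\<lambda>j \<omega>. A *v \<xi> m j \<omega>) t" for m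
  define J where "J m = elem_int B (k' m) (ts' m) (\<xi>' m) t" for m
  have [measurable]: "I m \<in> borel_measurable M" "J m \<in> borel_measurable M" for m
    unfolding I_def J_def
    using elem_int_all_moments[OF t elem_proc_cotlar[OF el]] elem_int_all_moments[OF t el'] all_moments_measurable by blast+
  have Km: "(\<lambda>(\<omega>, s). indicator {0..t} s *\<^sub>R K s \<omega>) \<in> borel_measurable (M \<Otimes>\<^sub>M lborel)"
    by (rule predictable_measurable[OF pred])
  have efm: "(\<lambda>(\<omega>, s). elem_fun k ts \<zeta> s \<omega>) \<in> borel_measurable (M \<Otimes>\<^sub>M lborel)" if "elem_proc M F k ts \<zeta>" for k ts and \<zeta> :: "nat \<Rightarrow> 'a \<Rightarrow> real^'n"
    unfolding elem_fun_def split_beta'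
  proof (rule borel_measurable_sum)
    fix j assume "j \<in> {..<k}"
    then have [measurable]: "\<zeta> j \<in> borel_measurable M"
      using that by (intro measurable_F_M[of _ "ts j"]) (auto simp: elem_proc_def)
    show "(\<lambda>x. if ts j < snd x \<and> snd x \<le> ts (Suc j) then \<zeta> j (fst x) else 0) \<in> borel_measurable (M \<Otimes>\<^sub>M lborel)"
      by measurable
  qed
  \<comment> \<open>The indicator stands inside the norm, since \<open>K\<close> is known to be
    product measurable only after multiplication by it.\<close>
  define P where "P m \<omega> s = ennreal ((norm (indicator {0..t} s *\<^sub>R f m s \<omega> - indicator {0..t} s *\<^sub>R K s \<omega>))\<^sup>2)" for m \<omega> s
  define P' where "P' m \<omega> s = ennreal ((norm (indicator {0..t} s *\<^sub>R f' m s \<omega> - A *v (indicator {0..t} s *\<^sub>R K s \<omega>)))\<^sup>2)" for m \<omega> s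
  have Pm[measurable]: "(\<lambda>(\<omega>, s). P m \<omega> s) \<in> borel_measurable (M \<Otimes>\<^sub>M lborel)" "(\<lambda>(\<omega>, s). P' m \<omega> s) \<in> borel_measurable (M \<Otimes>\<^sub>M lborel)" for m
  proof -
    have K1[measurable]: "(\<lambda>x. indicator {0..t} (snd x) *\<^sub>R K (snd x) (fst x)) \<in> borel_measurable (M \<Otimes>\<^sub>M lborel)"
      using Km by (simp add: split_beta')
    have f1[measurable]: "(\<lambda>x. f m (snd x) (fst x)) \<in> borel_measurable (M \<Otimes>\<^sub>M lborel)" "(\<lambda>x. f' m (snd x) (fst x)) \<in> borel_measurable (M \<Otimes>\<^sub>M lborel)"
      using efm[OF el[of m]] efm[OF el'[of m]] unfolding f_def f'_def split_beta' by auto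
    show "(\<lambda>(\<omega>, s). P m \<omega> s) \<in> borel_measurable (M \<Otimes>\<^sub>M lborel)" unfolding P_def split_beta' by measurable
    show "(\<lambda>(\<omega>, s). P' m \<omega> s) \<in> borel_measurable (M \<Otimes>\<^sub>M lborel)" unfolding P'_def split_beta' by measurable
  qed
  have eP: "(\<integral>\<^sup>+s\<in>{0..t}. ennreal ((norm (f m s \<omega> - K s \<omega>))\<^sup>2) \<partial>lborel) = (\<integral>\<^sup>+s. P m \<omega> s \<partial>lborel)" for m \<omega>
    unfolding P_def by (intro nn_integral_cong) (auto simp: indicator_def)
  have eP': "(\<integral>\<^sup>+s\<in>{0..t}. ennreal ((norm (f' m s \<omega> - A *v K s \<omega>))\<^sup>2) \<partial>lborel) = (\<integral>\<^sup>+s. P' m \<omega> s \<partial>lborel)" for m \<omega>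
    unfolding P'_def by (intro nn_integral_cong) (auto simp: indicator_def)
  define u where "u m = (\<integral>\<^sup>+\<omega>. (\<integral>\<^sup>+s. P m \<omega> s \<partial>lborel) \<partial>M)" for m
  define u' where "u' m = (\<integral>\<^sup>+\<omega>. (\<integral>\<^sup>+s. P' m \<omega> s \<partial>lborel) \<partial>M)" for m
  define w where "w m = (\<integral>\<^sup>+\<omega>. ennreal ((J m \<omega> - Y \<omega>)\<^sup>2) \<partial>M)" for m
  have u0: "u \<longlonglongrightarrow> 0" using lim unfolding u_def eP[symmetric] f_def .
  have u'0: "u' \<longlonglongrightarrow> 0" using lim' unfolding u'_def eP'[symmetric] f'_def .
  have w0: "w \<longlonglongrightarrow> 0" using limY unfolding w_def J_def .
  \<comment> \<open>Insert A K between the two integrands; length preservation turns the distance of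
    A f from A K into that of \<open>f\<close> from \<open>K\<close>.\<close>
  have IJ: "(\<integral>\<^sup>+\<omega>. ennreal ((I m \<omega> - J m \<omega>)\<^sup>2) \<partial>M) \<le> 2 * u m + 2 * u' m" for m
  proof -
    have "(\<integral>\<^sup>+\<omega>. ennreal ((I m \<omega> - J m \<omega>)\<^sup>2) \<partial>M)
      \<le> (\<integral>\<^sup>+\<omega>. (\<integral>\<^sup>+s\<in>{0..t}. ennreal ((norm (A *v f m s \<omega> - f' m s \<omega>))\<^sup>2) \<partial>lborel) \<partial>M)"
      using elem_int_isometry_le[OF t elem_proc_cotlar[OF el[of m]] el'[of m]]
      unfolding I_def J_def f_def f'_def elem_fun_cotlar .
    also have "\<dots> \<le> (\<integral>\<^sup>+\<omega>. (\<integral>\<^sup>+s. 2 * P m \<omega> s + 2 * P' m \<omega> s \<partial>lborel) \<partial>M)"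
    proof (intro nn_integral_mono)
      fix \<omega> s
      show "ennreal ((norm (A *v f m s \<omega> - f' m s \<omega>))\<^sup>2) * indicator {0..t} s \<le> 2 * P m \<omega> s + 2 * P' m \<omega> s"
      proof (cases "s \<in> {0..t}")
        case True
        have "norm (A *v f m s \<omega> - f' m s \<omega>) \<le> norm (A *v f m s \<omega> - A *v K s \<omega>) + norm (A *v K s \<omega> - f' m s \<omega>)"
          by norm
        also have "A *v f m s \<omega> - A *v K s \<omega> = A *v (f m s \<omega> - K s \<omega>)"
          by (simp add: matrix_vector_mult_diff_distrib)
        also have "norm (A *v (f m s \<omega> - K s \<omega>)) = norm (f m s \<omega> - K s \<omega>)"
          by (rule cotlar_matrix_properties(2)[OF cotlar])
        finally have "(norm (A *v f m s \<omega> - f' m s \<omega>))\<^sup>2 \<le> (norm (f m s \<omega> - K s \<omega>) + norm (f' m s \<omega> - A *v K s \<omega>))\<^sup>2"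
          by (intro power_mono) (auto simp: norm_minus_commute)
        also have "\<dots> \<le> 2 * (norm (f m s \<omega> - K s \<omega>))\<^sup>2 + 2 * (norm (f' m s \<omega> - A *v K s \<omega>))\<^sup>2"
          using square_diff_le[of "norm (f m s \<omega> - K s \<omega>)" "- norm (f' m s \<omega> - A *v K s \<omega>)" 0] by simp
        finally have "ennreal ((norm (A *v f m s \<omega> - f' m s \<omega>))\<^sup>2) \<le> ennreal (2 * (norm (f m s \<omega> - K s \<omega>))\<^sup>2 + 2 * (norm (f' m s \<omega> - A *v K s \<omega>))\<^sup>2)"
          by (rule ennreal_leI)
        then show ?thesis using True by (simp add: P_def P'_def ennreal_plus ennreal_mult)
      qed simp
    qed
    also have "\<dots> = (\<integral>\<^sup>+\<omega>. 2 * (\<integral>\<^sup>+s. P m \<omega> s \<partial>lborel) + 2 * (\<integral>\<^sup>+s. P' m \<omega> s \<partial>lborel) \<partial>M)"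
    proof (rule nn_integral_cong)
      fix \<omega> assume \<omega>: "\<omega> \<in> space M"
      have [measurable]: "P m \<omega> \<in> borel_measurable lborel" "P' m \<omega> \<in> borel_measurable lborel"
        using measurable_Pair2[OF Pm(1)[of m] \<omega>] measurable_Pair2[OF Pm(2)[of m] \<omega>] by auto
      show "(\<integral>\<^sup>+s. 2 * P m \<omega> s + 2 * P' m \<omega> s \<partial>lborel) = 2 * (\<integral>\<^sup>+s. P m \<omega> s \<partial>lborel) + 2 * (\<integral>\<^sup>+s. P' m \<omega> s \<partial>lborel)"
        by (simp add: nn_integral_add nn_integral_cmult)
    qed
    also have "\<dots> = 2 * u m + 2 * u' m"
    proof -
      have [measurable]: "(\<lambda>\<omega>. \<integral>\<^sup>+s. P m \<omega> s \<partial>lborel) \<in> borel_measurable M" "(\<lambda>\<omega>. \<integral>\<^sup>+s. P' m \<omega> s \<partial>lborel) \<in> borel_measurable M"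
        using lborel.borel_measurable_nn_integral[OF Pm(1)[of m]] lborel.borel_measurable_nn_integral[OF Pm(2)[of m]] by auto
      show ?thesis unfolding u_def u'_def by (simp add: nn_integral_add nn_integral_cmult)
    qed
    finally show ?thesis .
  qed
  have le: "(\<integral>\<^sup>+\<omega>. ennreal ((I m \<omega> - Y \<omega>)\<^sup>2) \<partial>M) \<le> 2 * (2 * u m + 2 * u' m) + 2 * w m" for m
  proof -
    have "(\<integral>\<^sup>+\<omega>. ennreal ((I m \<omega> - Y \<omega>)\<^sup>2) \<partial>M) \<le> (\<integral>\<^sup>+\<omega>. 2 * ennreal ((I m \<omega> - J m \<omega>)\<^sup>2) + 2 * ennreal ((J m \<omega> - Y \<omega>)\<^sup>2) \<partial>M)"
    proof (rule nn_integral_mono)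
      fix \<omega>
      have "ennreal ((I m \<omega> - Y \<omega>)\<^sup>2) \<le> ennreal (2 * (I m \<omega> - J m \<omega>)\<^sup>2 + 2 * (J m \<omega> - Y \<omega>)\<^sup>2)"
        by (intro ennreal_leI square_diff_le)
      then show "ennreal ((I m \<omega> - Y \<omega>)\<^sup>2) \<le> 2 * ennreal ((I m \<omega> - J m \<omega>)\<^sup>2) + 2 * ennreal ((J m \<omega> - Y \<omega>)\<^sup>2)"
        by (simp add: ennreal_plus ennreal_mult)
    qed
    also have "\<dots> = 2 * (\<integral>\<^sup>+\<omega>. ennreal ((I m \<omega> - J m \<omega>)\<^sup>2) \<partial>M) + 2 * w m"
      unfolding w_def by (simp add: nn_integral_add nn_integral_cmult)
    also have "\<dots> \<le> 2 * (2 * u m + 2 * u' m) + 2 * w m"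
      using IJ[of m] by (intro add_mono mult_left_mono) auto
    finally show ?thesis .
  qed
  have "(\<lambda>m. 2 * (2 * u m + 2 * u' m) + 2 * w m) \<longlonglongrightarrow> 2 * (2 * 0 + 2 * 0) + 2 * 0"
    by (intro tendsto_add ennreal_tendsto_cmult u0 u'0 w0) auto
  then have "(\<lambda>m. 2 * (2 * u m + 2 * u' m) + 2 * w m) \<longlonglongrightarrow> 0" by simp
  then have "(\<lambda>m. \<integral>\<^sup>+\<omega>. ennreal ((I m \<omega> - Y \<omega>)\<^sup>2) \<partial>M) \<longlonglongrightarrow> 0"
  proof (rule tendsto_sandwich[OF _ _ tendsto_const, rotated 2])
    show "\<forall>\<^sub>F m in sequentially. (\<integral>\<^sup>+\<omega>. ennreal ((I m \<omega> - Y \<omega>)\<^sup>2) \<partial>M) \<le> 2 * (2 * u m + 2 * u' m) + 2 * w m"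
      by (intro always_eventually allI le)
  qed simp
  then show ?thesis unfolding I_def .
qed

end

section \<open>Lipschitz bounds and the two families of exponents\<close>

lemma abs_exp_minus_diff_le:
  fixes x y :: real
  assumes "0 \<le> x" "0 \<le> y"
  shows "\<bar>exp (- x) - exp (- y)\<bar> \<le> \<bar>x - y\<bar>"
proof -
  have *: "exp (- a) - exp (- b) \<le> b - a" if "0 \<le> a" "a \<le> b" for a b :: real
  proof -
    have "exp (- a) - exp (- b) = exp (- a) * (1 - exp (- (b - a)))"
      by (simp add: right_diff_distrib exp_add[symmetric])
    also have "\<dots> \<le> 1 * (b - a)"
    proof (rule mult_mono)
      show "1 - exp (- (b - a)) \<le> b - a" using exp_ge_add_one_self[of "- (b - a)"] by linarith
    qed (use that in auto)
    finally show ?thesis by simp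
  qed
  show ?thesis
    using *[of x y] *[of y x] assms by (cases "x \<le> y") (auto simp: abs_if)
qed

lemma abs_cos_diff_le: "\<bar>cos x - cos y\<bar> \<le> \<bar>x - y\<bar>" for x y :: real
proof -
  have "\<bar>cos x - cos y\<bar> = 2 * \<bar>sin ((x + y) / 2)\<bar> * \<bar>sin ((y - x) / 2)\<bar>"
    by (simp add: cos_diff_cos abs_mult)
  also have "\<dots> \<le> 2 * 1 * \<bar>(y - x) / 2\<bar>"
    by (intro mult_mono abs_sin_x_le_abs_x) auto
  finally show ?thesis by simp
qed

lemma cot_pi_pos:
  fixes q :: real assumes "q \<ge> 2" shows "cot (pi / (2 * q)) > 0"
proof -
  have "0 < pi / (2 * q)" "pi / (2 * q) < pi / 2" using assms by (auto simp: field_simps)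
  then have "sin (pi / (2 * q)) > 0" "cos (pi / (2 * q)) > 0" by (auto intro!: sin_gt_zero cos_gt_zero)
  then show ?thesis by (simp add: cot_def)
qed

theorem theorem4p3:
  fixes M :: "'a measure" and B K :: "real \<Rightarrow> 'a \<Rightarrow> real^'n" and A :: "real^'n^'n"
    and t p :: real and k :: nat and X Y :: "'a \<Rightarrow> real"
  assumes "even CARD('n)"
    and "cotlar_matrix A"
    and "std_brownian M B"
    and "(\<lambda>(s, \<omega>). K s \<omega>) \<in> borel_measurable (predictable_sigma M (nat_filtration M B))"
    and "\<forall>u\<ge>0. (\<integral>\<^sup>+\<omega>. (\<integral>\<^sup>+s\<in>{0..u}. ennreal ((norm (K s \<omega>))\<^sup>2) \<partial>lborel) \<partial>M) < \<infinity>"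
    and "t \<ge> 0"
    and "k \<ge> 1"
    and "p = 2 ^ k \<or> p = 2 ^ k / (2 ^ k - 1)"
    and "ito_integral M B K t X"
    and "ito_integral M B (\<lambda>s \<omega>. A *v K s \<omega>) t Y"
  shows "(\<integral>\<^sup>+\<omega>. ennreal (\<bar>Y \<omega>\<bar> powr p) \<partial>M)
           \<le> ennreal (cot (pi / (2 * pstar p)) powr p) * (\<integral>\<^sup>+\<omega>. ennreal (\<bar>X \<omega>\<bar> powr p) \<partial>M)"
proof -
  interpret cotlar_brownian M B A by unfold_locales (rule assms)+
  obtain ks ts \<xi> where Xm[measurable]: "X \<in> borel_measurable M"
    and el: "\<And>m. elem_proc M F (ks m) (ts m) (\<xi> m)"
    and limK: "(\<lambda>m. \<integral>\<^sup>+\<omega>. (\<integral>\<^sup>+s\<in>{0..t}. ennreal ((norm (elem_fun (ks m) (ts m) (\<xi> m) s \<omega> - K s \<omega>))\<^sup>2) \<partial>lborel) \<partial>M) \<longlonglongrightarrow> 0"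
    and limX: "(\<lambda>m. \<integral>\<^sup>+\<omega>. ennreal ((elem_int B (ks m) (ts m) (\<xi> m) t \<omega> - X \<omega>)\<^sup>2) \<partial>M) \<longlonglongrightarrow> 0"
    using assms(9) unfolding ito_integral_def by blast
  have Ym[measurable]: "Y \<in> borel_measurable M" using assms(10) by (simp add: ito_integral_def)
  define I where "I m = elem_int B (ks m) (ts m) (\<xi> m) t" for m
  define J where "J m = elem_int B (ks m) (ts m) (\<lambda>j \<omega>. A *v \<xi> m j \<omega>) t" for m
  have Iam: "all_moments M (I m)" "all_moments M (J m)" for m
    unfolding I_def J_def by (intro elem_int_all_moments[OF assms(6)] el elem_proc_cotlar)+
  note [measurable] = Iam[THEN all_moments_measurable]
  \<comment> \<open>From here one sequence of elementary processes serves both coordinates: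
    \<open>I m\<close> and \<open>J m\<close> are the real and imaginary parts of a conformal
    pair.\<close>
  have limY: "(\<lambda>m. \<integral>\<^sup>+\<omega>. ennreal ((J m \<omega> - Y \<omega>)\<^sup>2) \<partial>M) \<longlonglongrightarrow> 0"
    unfolding J_def by (rule cotlar_transform_l2_limit[OF assms(6,4) el limK assms(10)])
  have I2: "integrable M (\<lambda>\<omega>. (I m \<omega>)\<^sup>2)" "integrable M (\<lambda>\<omega>. (J m \<omega>)\<^sup>2)" for m
    using Iam by (auto intro: all_moments_integrable_power finite_measure_axioms)
  note LX = l2_limit[OF _ I2(1) Xm limX[folded I_def]]
  note LY = l2_limit[OF _ I2(2) Ym limY]
  have X2: "integrable M (\<lambda>\<omega>. (X \<omega>)\<^sup>2)" and DX: "\<And>m. integrable M (\<lambda>\<omega>. (I m \<omega> - X \<omega>)\<^sup>2)"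
    and IX2: "(\<lambda>m. \<integral>\<omega>. (I m \<omega> - X \<omega>)\<^sup>2 \<partial>M) \<longlonglongrightarrow> 0" and IX1: "(\<lambda>m. \<integral>\<omega>. \<bar>I m \<omega> - X \<omega>\<bar> \<partial>M) \<longlonglongrightarrow> 0"
    using LX by auto
  have Y2: "integrable M (\<lambda>\<omega>. (Y \<omega>)\<^sup>2)" and DY: "\<And>m. integrable M (\<lambda>\<omega>. (J m \<omega> - Y \<omega>)\<^sup>2)" and JY1: "(\<lambda>m. \<integral>\<omega>. \<bar>J m \<omega> - Y \<omega>\<bar> \<partial>M) \<longlonglongrightarrow> 0"
    using LY by auto
  have X1: "integrable M X" and Y1: "integrable M Y"
    by (rule square_integrable_imp_integrable[OF Xm X2], rule square_integrable_imp_integrable[OF Ym Y2])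
  define q :: nat where "q = 2 ^ k"
  have q: "q \<ge> 2" "even q" using assms(7) unfolding q_def by (auto intro: self_le_power)
  have C0: "cot (pi / (2 * real q)) > 0" using q by (intro cot_pi_pos) simp
  show ?thesis
  \<comment> \<open>For k = 1 both forms of \<open>p\<close> equal 2, which this split assigns to
    the first case; in the second case q > 2 and 1 < p < 2.\<close>
  proof (cases "p = real q")
    case True
    have ps: "pstar p = real q"
    proof -
      have "real q / (real q - 1) \<le> real q" using q by (simp add: field_simps)
      then show ?thesis unfolding pstar_def True by simp
    qed
    have pw: "\<bar>x\<bar> powr p = x ^ q" for x :: real
    proof (cases "x = 0")
      case True
      then show ?thesis using q by (simp add: power_0_left)
    next
      case False
      then show ?thesis unfolding \<open>p = real q\<close> using q by (simp add: powr_realpow power_even_abs)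
    qed
    define C where "C = cot (pi / (2 * real q)) ^ q"
    have C: "C > 0" unfolding C_def using C0 by simp
    have cpw: "cot (pi / (2 * pstar p)) powr p = C"
      unfolding ps C_def using True C0 by (simp add: powr_realpow)
    have goal: "(\<integral>\<^sup>+\<omega>. ennreal (Y \<omega> ^ q) \<partial>M) \<le> ennreal C * (\<integral>\<^sup>+\<omega>. ennreal (X \<omega> ^ q) \<partial>M)"
    \<comment> \<open>If X^q is not integrable the right side is infinite, because \<open>C\<close>
      is positive.\<close>
    proof (cases "integrable M (\<lambda>\<omega>. X \<omega> ^ q)")
      case False
      have "(\<integral>\<^sup>+\<omega>. ennreal (X \<omega> ^ q) \<partial>M) = \<infinity>"
      proof (rule ccontr)
        assume "(\<integral>\<^sup>+\<omega>. ennreal (X \<omega> ^ q) \<partial>M) \<noteq> \<infinity>"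
        then have "(\<integral>\<^sup>+\<omega>. ennreal (X \<omega> ^ q) \<partial>M) < \<infinity>" by (simp add: top.not_eq_extremum)
        then have "integrable M (\<lambda>\<omega>. X \<omega> ^ q)"
          using q by (intro integrableI_nonneg) (auto simp: zero_le_even_power)
        then show False using False by simp
      qed
      then show ?thesis using C by (simp add: ennreal_mult_top)
    next
      case Xq: True
      have fixed: "(\<integral>\<omega>. (min \<bar>Y \<omega>\<bar> a) ^ q \<partial>M) \<le> C * (\<integral>\<omega>. X \<omega> ^ q \<partial>M)" if a: "a \<ge> 0" for a
      proof -
        \<comment> \<open>The approximation index tends to infinity with \<open>R\<close> and
          \<open>a\<close> fixed: all error terms are L^1 or L^2 distances with constant factors.
          What survives is the exit term, of order R^(-2), which goes next.\<close>
        have R: "(\<integral>\<omega>. (min \<bar>Y \<omega>\<bar> a) ^ q \<partial>M) \<le> C * (\<integral>\<omega>. X \<omega> ^ q \<partial>M) + 2 * a ^ q / R\<^sup>2 * (2 * (\<integral>\<omega>. (X \<omega>)\<^sup>2 \<partial>M))" if R: "R \<ge> 1" for R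
        proof (rule LIMSEQ_le_const)
          show "(\<lambda>m. C * ((\<integral>\<omega>. X \<omega> ^ q \<partial>M) + real q * (2 * R) ^ (q - 1) * (\<integral>\<omega>. \<bar>I m \<omega> - X \<omega>\<bar> \<partial>M))
              + 2 * a ^ q / R\<^sup>2 * (2 * (\<integral>\<omega>. (I m \<omega> - X \<omega>)\<^sup>2 \<partial>M) + 2 * (\<integral>\<omega>. (X \<omega>)\<^sup>2 \<partial>M))
              + real q * a ^ (q - 1) * (\<integral>\<omega>. \<bar>J m \<omega> - Y \<omega>\<bar> \<partial>M)) \<longlonglongrightarrow> C * (\<integral>\<omega>. X \<omega> ^ q \<partial>M) + 2 * a ^ q / R\<^sup>2 * (2 * (\<integral>\<omega>. (X \<omega>)\<^sup>2 \<partial>M))"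
            by (rule tendsto_eq_rhs, (rule IX1 IX2 JY1 tendsto_add tendsto_mult tendsto_const)+) simp
          show "\<exists>N. \<forall>m\<ge>N. (\<integral>\<omega>. (min \<bar>Y \<omega>\<bar> a) ^ q \<partial>M) \<le> C * ((\<integral>\<omega>. X \<omega> ^ q \<partial>M) + real q * (2 * R) ^ (q - 1) * (\<integral>\<omega>. \<bar>I m \<omega> - X \<omega>\<bar> \<partial>M))
              + 2 * a ^ q / R\<^sup>2 * (2 * (\<integral>\<omega>. (I m \<omega> - X \<omega>)\<^sup>2 \<partial>M) + 2 * (\<integral>\<omega>. (X \<omega>)\<^sup>2 \<partial>M))
              + real q * a ^ (q - 1) * (\<integral>\<omega>. \<bar>J m \<omega> - Y \<omega>\<bar> \<partial>M)"
          proof (intro exI[of _ 0] allI impI)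
            fix m
            have "(\<integral>\<omega>. (I m \<omega>)\<^sup>2 \<partial>M) \<le> (\<integral>\<omega>. 2 * (I m \<omega> - X \<omega>)\<^sup>2 + 2 * (X \<omega>)\<^sup>2 \<partial>M)"
              using square_diff_le[of "I m _" 0 "X _"] by (intro integral_mono I2) (use DX X2 in auto)
            also have "\<dots> = 2 * (\<integral>\<omega>. (I m \<omega> - X \<omega>)\<^sup>2 \<partial>M) + 2 * (\<integral>\<omega>. (X \<omega>)\<^sup>2 \<partial>M)"
              using DX X2 by simp
            finally have s: "(\<integral>\<omega>. (I m \<omega>)\<^sup>2 \<partial>M) \<le> 2 * (\<integral>\<omega>. (I m \<omega> - X \<omega>)\<^sup>2 \<partial>M) + 2 * (\<integral>\<omega>. (X \<omega>)\<^sup>2 \<partial>M)" .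
            have "(\<integral>\<omega>. (min \<bar>Y \<omega>\<bar> a) ^ q \<partial>M) \<le> C * ((\<integral>\<omega>. X \<omega> ^ q \<partial>M) + real q * (2 * R) ^ (q - 1) * (\<integral>\<omega>. \<bar>I m \<omega> - X \<omega>\<bar> \<partial>M))
              + 2 * a ^ q / R\<^sup>2 * (\<integral>\<omega>. (I m \<omega>)\<^sup>2 \<partial>M) + real q * a ^ (q - 1) * (\<integral>\<omega>. \<bar>J m \<omega> - Y \<omega>\<bar> \<partial>M)"
              unfolding C_def I_def J_def
              by (rule elem_truncated_moment_bound[OF assms(6) el R assms(7) q_def a X1 Xq Y1])
            also have "\<dots> \<le> C * ((\<integral>\<omega>. X \<omega> ^ q \<partial>M) + real q * (2 * R) ^ (q - 1) * (\<integral>\<omega>. \<bar>I m \<omega> - X \<omega>\<bar> \<partial>M))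
              + 2 * a ^ q / R\<^sup>2 * (2 * (\<integral>\<omega>. (I m \<omega> - X \<omega>)\<^sup>2 \<partial>M) + 2 * (\<integral>\<omega>. (X \<omega>)\<^sup>2 \<partial>M))
              + real q * a ^ (q - 1) * (\<integral>\<omega>. \<bar>J m \<omega> - Y \<omega>\<bar> \<partial>M)"
              using s a by (intro add_mono order_refl mult_left_mono) auto
            finally show "(\<integral>\<omega>. (min \<bar>Y \<omega>\<bar> a) ^ q \<partial>M) \<le> \<dots>" .
          qed
        qed
        have "(\<lambda>n. C * (\<integral>\<omega>. X \<omega> ^ q \<partial>M) + 2 * a ^ q * (inverse (real (Suc n)))\<^sup>2 * (2 * (\<integral>\<omega>. (X \<omega>)\<^sup>2 \<partial>M))) \<longlonglongrightarrow> C * (\<integral>\<omega>. X \<omega> ^ q \<partial>M)"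
          by (rule tendsto_eq_rhs, (rule LIMSEQ_inverse_real_of_nat tendsto_add tendsto_mult tendsto_power tendsto_const)+) simp
        then show ?thesis
        proof (rule LIMSEQ_le_const, intro exI[of _ 0] allI impI)
          fix n
          show "(\<integral>\<omega>. (min \<bar>Y \<omega>\<bar> a) ^ q \<partial>M) \<le> C * (\<integral>\<omega>. X \<omega> ^ q \<partial>M) + 2 * a ^ q * (inverse (real (Suc n)))\<^sup>2 * (2 * (\<integral>\<omega>. (X \<omega>)\<^sup>2 \<partial>M))"
            using R[of "real (Suc n)"] by (simp add: power_inverse divide_inverse)
        qed
      qed
      \<comment> \<open>With a bound uniform in the truncation level, Fatou's lemma along the levels
        \<open>n\<close> recovers the full moment of \<open>Y\<close>.\<close>
      have imin: "integrable M (\<lambda>\<omega>. (min \<bar>Y \<omega>\<bar> (real n)) ^ q)" for n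
        by (rule integrable_const_bound[of _ "real n ^ q"]) (auto intro!: AE_I2 power_mono)
      have "(\<integral>\<^sup>+\<omega>. ennreal (Y \<omega> ^ q) \<partial>M) = (\<integral>\<^sup>+\<omega>. liminf (\<lambda>n. ennreal ((min \<bar>Y \<omega>\<bar> (real n)) ^ q)) \<partial>M)"
      proof (rule nn_integral_cong)
        fix \<omega>
        obtain N where N: "\<bar>Y \<omega>\<bar> \<le> real N" using real_arch_simple by blast
        have "(\<lambda>n. ennreal ((min \<bar>Y \<omega>\<bar> (real n)) ^ q)) \<longlonglongrightarrow> ennreal (Y \<omega> ^ q)"
        proof (rule tendsto_eventually, rule eventually_sequentiallyI[of N])
          fix n assume "N \<le> n"
          then have "min \<bar>Y \<omega>\<bar> (real n) = \<bar>Y \<omega>\<bar>" using N by auto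
          then show "ennreal ((min \<bar>Y \<omega>\<bar> (real n)) ^ q) = ennreal (Y \<omega> ^ q)" using q by (simp add: power_even_abs)
        qed
        then show "ennreal (Y \<omega> ^ q) = liminf (\<lambda>n. ennreal ((min \<bar>Y \<omega>\<bar> (real n)) ^ q))"
          by (simp add: lim_imp_Liminf)
      qed
      also have "\<dots> \<le> liminf (\<lambda>n. \<integral>\<^sup>+\<omega>. ennreal ((min \<bar>Y \<omega>\<bar> (real n)) ^ q) \<partial>M)"
        by (rule nn_integral_liminf) measurable
      also have "\<dots> \<le> ennreal (C * (\<integral>\<omega>. X \<omega> ^ q \<partial>M))"
      proof (rule Liminf_le)
        show "\<forall>\<^sub>F n in sequentially. (\<integral>\<^sup>+\<omega>. ennreal ((min \<bar>Y \<omega>\<bar> (real n)) ^ q) \<partial>M) \<le> ennreal (C * (\<integral>\<omega>. X \<omega> ^ q \<partial>M))"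
          using imin fixed by (intro always_eventually allI) (simp add: nn_integral_eq_integral ennreal_leI)
      qed simp
      also have "\<dots> = ennreal C * (\<integral>\<^sup>+\<omega>. ennreal (X \<omega> ^ q) \<partial>M)"
        using Xq C q by (simp add: nn_integral_eq_integral ennreal_mult zero_le_even_power)
      finally show ?thesis .
    qed
    then show ?thesis unfolding pw cpw .
  next
    case False
    then have p: "p = real q / (real q - 1)" using assms(8) unfolding q_def by auto
    have q3: "real q > 2"
    proof -
      have "q \<noteq> 2" using False p by auto
      then show ?thesis using q by simp
    qed
    have p12: "1 < p" "p < 2" unfolding p using q3 by (auto simp: field_simps)
    have ps: "pstar p = real q"
    proof -
      have "p - 1 = 1 / (real q - 1)" unfolding p using q3 by (simp add: field_simps)
      then have "p / (p - 1) = real q" unfolding p using q3 by simp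
      then show ?thesis unfolding pstar_def using p12 q3 by simp
    qed
    \<comment> \<open>The conjugate exponent of \<open>p\<close> is \<open>q\<close>, so pi / (2 p)
      and pi / (2 q) add up to a right angle and Essen's tangent becomes the cotangent of the
      statement.\<close>
    have tan: "tan (pi / (2 * p)) = cot (pi / (2 * pstar p))"
    proof -
      have "pi / (2 * p) = pi / 2 - pi / (2 * real q)" unfolding p using q3 by (simp add: field_simps)
      then show ?thesis unfolding ps using tan_cot[of "pi / (2 * real q)"] by (simp add: tan_def cot_def sin_diff cos_diff)
    qed
    have "1 \<le> (\<integral>\<omega>. exp (- \<bar>s * X \<omega>\<bar>) * cos (s * Y \<omega>) + \<bar>s * X \<omega>\<bar> \<partial>M)" if s: "s > 0" for s
    proof (rule LIMSEQ_le_const)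
      define E where "E U V = (\<integral>\<omega>. exp (- \<bar>s * U \<omega>\<bar>) * cos (s * V \<omega>) + \<bar>s * U \<omega>\<bar> \<partial>M)" for U V :: "'a \<Rightarrow> real"
      \<comment> \<open>The kernel function is globally Lipschitz in both variables, so the
        inequality for elementary pairs survives convergence in L^1.\<close>
      have lip: "\<bar>(exp (- \<bar>s * a\<bar>) * cos (s * b) + \<bar>s * a\<bar>) - (exp (- \<bar>s * a'\<bar>) * cos (s * b') + \<bar>s * a'\<bar>)\<bar> \<le> 2 * s * \<bar>a - a'\<bar> + s * \<bar>b - b'\<bar>" for a b a' b' :: real
      proof -
        have e: "\<bar>exp (- \<bar>s * a\<bar>) - exp (- \<bar>s * a'\<bar>)\<bar> \<le> \<bar>s * a - s * a'\<bar>"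
          using abs_exp_minus_diff_le[of "\<bar>s * a\<bar>" "\<bar>s * a'\<bar>"] by linarith
        have "\<bar>exp (- \<bar>s * a\<bar>) * cos (s * b) - exp (- \<bar>s * a'\<bar>) * cos (s * b')\<bar>
          = \<bar>(exp (- \<bar>s * a\<bar>) - exp (- \<bar>s * a'\<bar>)) * cos (s * b) + exp (- \<bar>s * a'\<bar>) * (cos (s * b) - cos (s * b'))\<bar>"
          by (simp add: algebra_simps)
        also have "\<dots> \<le> \<bar>exp (- \<bar>s * a\<bar>) - exp (- \<bar>s * a'\<bar>)\<bar> * \<bar>cos (s * b)\<bar> + exp (- \<bar>s * a'\<bar>) * \<bar>cos (s * b) - cos (s * b')\<bar>"
          by (rule order_trans[OF abs_triangle_ineq]) (simp add: abs_mult)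
        also have "\<dots> \<le> \<bar>s * a - s * a'\<bar> * 1 + 1 * \<bar>s * b - s * b'\<bar>"
          using e abs_cos_diff_le[of "s * b" "s * b'"] by (intro add_mono mult_mono) auto
        finally have "\<bar>exp (- \<bar>s * a\<bar>) * cos (s * b) - exp (- \<bar>s * a'\<bar>) * cos (s * b')\<bar> \<le> \<bar>s * a - s * a'\<bar> + \<bar>s * b - s * b'\<bar>" by simp
        moreover have "\<bar>\<bar>s * a\<bar> - \<bar>s * a'\<bar>\<bar> \<le> \<bar>s * a - s * a'\<bar>" by (rule abs_triangle_ineq3)
        moreover have "\<bar>(P + x) - (P' + x')\<bar> \<le> 2 * D + D'" if "\<bar>P - P'\<bar> \<le> D + D'" "\<bar>x - x'\<bar> \<le> D" for P P' x x' D D' :: real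
          using that by linarith
        ultimately have "\<bar>(exp (- \<bar>s * a\<bar>) * cos (s * b) + \<bar>s * a\<bar>) - (exp (- \<bar>s * a'\<bar>) * cos (s * b') + \<bar>s * a'\<bar>)\<bar> \<le> 2 * \<bar>s * a - s * a'\<bar> + \<bar>s * b - s * b'\<bar>"
          by blast
        moreover have "\<bar>s * a - s * a'\<bar> = s * \<bar>a - a'\<bar>" "\<bar>s * b - s * b'\<bar> = s * \<bar>b - b'\<bar>"
          using s by (simp_all add: right_diff_distrib[symmetric] abs_mult)
        ultimately show ?thesis by (simp only: mult.assoc)
      qed
      have int: "integrable M (\<lambda>\<omega>. exp (- \<bar>s * U \<omega>\<bar>) * cos (s * V \<omega>) + \<bar>s * U \<omega>\<bar>)" if "integrable M U" "V \<in> borel_measurable M" for U V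
      proof -
        note [measurable] = that(1)[THEN borel_measurable_integrable] that(2)
        have "integrable M (\<lambda>\<omega>. exp (- \<bar>s * U \<omega>\<bar>) * cos (s * V \<omega>))"
        proof (rule integrable_const_bound[of _ 1])
          show "AE \<omega> in M. norm (exp (- \<bar>s * U \<omega>\<bar>) * cos (s * V \<omega>)) \<le> 1"
            by (intro AE_I2) (simp add: abs_mult mult_le_one)
        qed simp
        then show ?thesis using that(1) by simp
      qed
      have iIJ: "integrable M (I m)" "integrable M (J m)" for m using Iam all_moments_integrable by auto
      have "(\<lambda>m. 2 * s * (\<integral>\<omega>. \<bar>I m \<omega> - X \<omega>\<bar> \<partial>M) + s * (\<integral>\<omega>. \<bar>J m \<omega> - Y \<omega>\<bar> \<partial>M)) \<longlonglongrightarrow> 0"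
        by (rule tendsto_eq_rhs, (rule IX1 JY1 tendsto_add tendsto_mult tendsto_const)+) simp
      then have "(\<lambda>m. E (I m) (J m) - E X Y) \<longlonglongrightarrow> 0"
      proof (rule Lim_null_comparison[rotated], intro always_eventually allI)
        fix m
        have "norm (E (I m) (J m) - E X Y) = \<bar>\<integral>\<omega>. (exp (- \<bar>s * I m \<omega>\<bar>) * cos (s * J m \<omega>) + \<bar>s * I m \<omega>\<bar>) - (exp (- \<bar>s * X \<omega>\<bar>) * cos (s * Y \<omega>) + \<bar>s * X \<omega>\<bar>) \<partial>M\<bar>"
          unfolding E_def using int[OF iIJ(1)[of m], of "J m"] int[OF X1 Ym] by (subst Bochner_Integration.integral_diff) auto
        also have "\<dots> \<le> (\<integral>\<omega>. \<bar>(exp (- \<bar>s * I m \<omega>\<bar>) * cos (s * J m \<omega>) + \<bar>s * I m \<omega>\<bar>) - (exp (- \<bar>s * X \<omega>\<bar>) * cos (s * Y \<omega>) + \<bar>s * X \<omega>\<bar>)\<bar> \<partial>M)"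
          by (rule integral_abs_bound)
        also have "\<dots> \<le> (\<integral>\<omega>. 2 * s * \<bar>I m \<omega> - X \<omega>\<bar> + s * \<bar>J m \<omega> - Y \<omega>\<bar> \<partial>M)"
          using int[OF iIJ(1)[of m], of "J m"] int[OF X1 Ym] iIJ[of m] X1 Y1
          by (intro integral_mono lip) auto
        also have "\<dots> = 2 * s * (\<integral>\<omega>. \<bar>I m \<omega> - X \<omega>\<bar> \<partial>M) + s * (\<integral>\<omega>. \<bar>J m \<omega> - Y \<omega>\<bar> \<partial>M)"
          using iIJ[of m] X1 Y1 by simp
        finally show "norm (E (I m) (J m) - E X Y) \<le> 2 * s * (\<integral>\<omega>. \<bar>I m \<omega> - X \<omega>\<bar> \<partial>M) + s * (\<integral>\<omega>. \<bar>J m \<omega> - Y \<omega>\<bar> \<partial>M)" .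
      qed
      then have "(\<lambda>m. E (I m) (J m)) \<longlonglongrightarrow> E X Y" by (simp add: LIM_zero_iff)
      then show "(\<lambda>m. E (I m) (J m)) \<longlonglongrightarrow> (\<integral>\<omega>. exp (- \<bar>s * X \<omega>\<bar>) * cos (s * Y \<omega>) + \<bar>s * X \<omega>\<bar> \<partial>M)"
        by (simp only: E_def)
      show "\<exists>N. \<forall>m\<ge>N. 1 \<le> E (I m) (J m)"
        unfolding E_def I_def J_def using elem_int_kernel[OF assms(6) el] by auto
    qed
    from integral_powr_le_of_kernel[OF p12 prob_space_axioms Xm X2 Ym Y2 this]
    show ?thesis unfolding tan .
  qed
qed

end
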